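(* Every non-empty ITRM-decidable set of reals has an ITRM-recognizable element.
   Context: Reals are subsets of $\omega$. An infinite time register machine (ITRM) has finitely many registers, each holding a natural number, and runs a finite register-machine program in transfinite ordinal time; with an oracle $x\subseteq\omega$ it may test whether the content of a register belongs to $x$. At successor times it acts as an ordinary register machine; at limit times the active program line is the $\liminf$ of the earlier program lines, and each register holds the $\liminf$ of its earlier contents if that is finite, and $0$ otherwise. $P^x\downarrow=i$ means program $P$ with oracle $x$ halts with output $i$. A set $X$ of reals is ITRM-decidable iff there is a program $P$ with $P^{w}\downarrow=1$ for $w\in X$ and $P^{w}\downarrow=0$ for $w\notin X$. A real $x$ is ITRM-recognizable iff $\{x\}$ is ITRM-decidable. *)

theory Defs
  imports Main
begin

text \<open>Register machine programs (Koepke-style ITRMs). Registers are indexed by nat;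
a program mentions only finitely many of them. Lines are numbered 0 .. length P - 1;
the machine halts when the program counter leaves this range. The output is the
content of register 0 at halting time.\<close>

datatype instr =
    Zero nat
  | Inc nat
  | Copy nat nat
  | JumpEq nat nat nat
  | OracleJump nat nat

type_synonym prog = "instr list"
type_synonym config = "nat \<times> (nat \<Rightarrow> nat)"

fun exec :: "nat set \<Rightarrow> instr \<Rightarrow> config \<Rightarrow> config" where
  "exec x (Zero i) (pc, R) = (Suc pc, R(i := 0))"
| "exec x (Inc i) (pc, R) = (Suc pc, R(i := Suc (R i)))"
| "exec x (Copy i j) (pc, R) = (Suc pc, R(j := R i))"
| "exec x (JumpEq i j l) (pc, R) = (if R i = R j then (l, R) else (Suc pc, R))"
| "exec x (OracleJump i l) (pc, R) = (if R i \<in> x then (l, R) else (Suc pc, R))"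

definition step :: "prog \<Rightarrow> nat set \<Rightarrow> config \<Rightarrow> config" where
  "step P x c = exec x (P ! fst c) c"

text \<open>Ordinal time is represented by a well-order r (reflexive, as in Main's
well_order_on) on a set of times. Strict order:\<close>

definition lt :: "('o \<times> 'o) set \<Rightarrow> 'o \<Rightarrow> 'o \<Rightarrow> bool" where
  "lt r a b \<longleftrightarrow> (a, b) \<in> r \<and> a \<noteq> b"

definition cofinal_below :: "('o \<times> 'o) set \<Rightarrow> 'o \<Rightarrow> 'o set \<Rightarrow> bool" where
  "cofinal_below r a S \<longleftrightarrow> (\<forall>b. lt r b a \<longrightarrow> (\<exists>g\<in>S. (b, g) \<in> r \<and> lt r g a))"

text \<open>liminf below a limit time a of a nat-valued function: the least value taken
cofinally often below a (this is exactly the liminf when it is finite); if there is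
no such value the liminf is infinite and the result is 0.\<close>
definition liminf_below :: "('o \<times> 'o) set \<Rightarrow> 'o \<Rightarrow> ('o \<Rightarrow> nat) \<Rightarrow> nat" where
  "liminf_below r a f =
     (if \<exists>v. cofinal_below r a {g. f g = v}
      then (LEAST v. cofinal_below r a {g. f g = v}) else 0)"

definition immediate_succ :: "('o \<times> 'o) set \<Rightarrow> 'o \<Rightarrow> 'o \<Rightarrow> bool" where
  "immediate_succ r a b \<longleftrightarrow> lt r a b \<and> \<not> (\<exists>g. lt r a g \<and> lt r g b)"

definition is_limit :: "('o \<times> 'o) set \<Rightarrow> 'o \<Rightarrow> bool" where
  "is_limit r b \<longleftrightarrow> (\<exists>a. lt r a b) \<and> \<not> (\<exists>a. immediate_succ r a b)"

definition is_run :: "('o \<times> 'o) set \<Rightarrow> prog \<Rightarrow> nat set \<Rightarrow> ('o \<Rightarrow> config) \<Rightarrow> bool" where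
  "is_run r P x c \<longleftrightarrow>
     (\<forall>a\<in>Field r. (\<forall>b. \<not> lt r b a) \<longrightarrow> c a = (0, \<lambda>_. 0)) \<and>
     (\<forall>a\<in>Field r. \<forall>b\<in>Field r. immediate_succ r a b \<longrightarrow> c b = step P x (c a)) \<and>
     (\<forall>b\<in>Field r. is_limit r b \<longrightarrow>
        c b = (liminf_below r b (\<lambda>g. fst (c g)),
               \<lambda>k. liminf_below r b (\<lambda>g. snd (c g) k)))"

text \<open>P with oracle x halts with output i: there is a run along a well-order
(times are represented by well-orders on subsets of the type nat set, i.e. all
ordinals of cardinality at most the continuum) whose last time is the first time
the program counter is outside the program, and register 0 then holds i.\<close>
definition halts_with :: "prog \<Rightarrow> nat set \<Rightarrow> nat \<Rightarrow> bool" where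
  "halts_with P x i \<longleftrightarrow>
     (\<exists>(r :: (nat set \<times> nat set) set) c m.
        well_order_on (Field r) r \<and> m \<in> Field r \<and> (\<forall>a\<in>Field r. (a, m) \<in> r) \<and>
        is_run r P x c \<and>
        (\<forall>a\<in>Field r. a \<noteq> m \<longrightarrow> fst (c a) < length P) \<and>
        length P \<le> fst (c m) \<and> snd (c m) 0 = i)"

definition ITRM_decidable :: "nat set set \<Rightarrow> bool" where
  "ITRM_decidable X \<longleftrightarrow>
     (\<exists>P. \<forall>w. (w \<in> X \<longrightarrow> halts_with P w 1) \<and> (w \<notin> X \<longrightarrow> halts_with P w 0))"

definition ITRM_recognizable :: "nat set \<Rightarrow> bool" where
  "ITRM_recognizable x \<longleftrightarrow> ITRM_decidable {x}"

end

theory Submission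
  imports Defs "HOL-Library.Nat_Bijection" "HOL-Library.Countable_Set_Type"
begin

text \<open>Let \<open>P\<close> decide \<open>X\<close>. Call a limit time of a run an overflow time if some register tends to infinity there.
  Each derivative of the set of overflow times uses up another register, so finitely many derivatives
  exhaust it. Between the overflow times of a fixed level, the segments of the run form a least fixed point
  that can be defined with quantifiers over infinite paths. Hence the halting problem for \<open>P\<close> lies in every class
  of relations that is closed under Boolean operations, simple substitutions and the quantifier
  ``some infinite path through the relation starts at \<open>a\<close>''.

  Depth-first search shows that the relations decidable by total programs form such a class. So do the relations
  that can be read off from a decidable certificate \<open>\<Psi> x\<close> with co-analytic range: the set of starting points
  of infinite paths is determined by first-order conditions and the absence of certain infinite paths.

  Therefore the certificates of the elements of \<open>X\<close> form a nonempty co-analytic set. As in the proof of the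
  Kondo-Addison theorem, successive minimization of ranks and bits singles out one element \<open>z\<close> of this set.
  A real \<open>y\<close> in the set differs from \<open>z\<close> iff some real is smaller in this order, which is witnessed by a
  simulation between well-founded relations, that is, by an infinite path. So \<open>\<Psi> x = z\<close> is
  decidable, and it holds for exactly one \<open>x\<close>.\<close>

text \<open>Times of a run are ordinals and cannot be quantified over inside the logic of relations
  on numbers; configurations can, because only finitely many components matter. A segment therefore
  records two configurations and the minima in between, and these minima are all that a later limit
  needs. The natural limit rule for segments has infinitely many premises. At a limit without
  overflow the blocks can be chosen with one common minimum, which equals the limit configuration,
  and the rule shrinks to a condition on finitely many values at a time. At an overflow no common
  minimum exists. This obstacle is the reason for splitting off the overflow times and treating them
  level by level.

  A decidable set need not be co-analytic, so the minimization argument cannot be applied to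
  \<open>X\<close> directly. It is applied to certificates: a real \<open>x\<close> together with
  the path sets from which the halting relation is evaluated. A certificate is determined by
  \<open>x\<close>, computable from \<open>x\<close>, and gives \<open>x\<close> back. Singling out
  one certificate thus singles out one real.\<close>

text \<open>The cardinal successor of \<open>natLeq\<close> is a well-order of type \<open>\<omega>\<^sub>1\<close> on the type \<open>nat set\<close>, from which
  \<^const>\<open>halts_with\<close> takes its times.\<close>

typedef om1 = "Field (cardSuc natLeq)"
proof -
  have "Field (cardSuc natLeq) \<noteq> {}"
    using cardSuc_finite[OF natLeq_Card_order] Field_natLeq
    by (metis finite.emptyI infinite_UNIV_nat)
  then show ?thesis by blast
qed

instantiation om1 :: wellorder
begin
definition less_eq_om1 :: "om1 \<Rightarrow> om1 \<Rightarrow> bool" where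
  "a \<le> b \<longleftrightarrow> (Rep_om1 a, Rep_om1 b) \<in> cardSuc natLeq"
definition less_om1 :: "om1 \<Rightarrow> om1 \<Rightarrow> bool" where
  "a < b \<longleftrightarrow> (Rep_om1 a, Rep_om1 b) \<in> cardSuc natLeq \<and> a \<noteq> b"
instance
proof -
  have W: "Well_order (cardSuc natLeq)"
    using cardSuc_Card_order[OF natLeq_Card_order] card_order_on_well_order_on by blast
  then have L: "Linear_order (cardSuc natLeq)" and wf: "wf (cardSuc natLeq - Id)"
    by (auto simp: well_order_on_def)
  have refl: "refl_on (Field (cardSuc natLeq)) (cardSuc natLeq)"
    and r_trans: "trans (cardSuc natLeq)" and r_antisym: "antisym (cardSuc natLeq)"
    and r_total: "total_on (Field (cardSuc natLeq)) (cardSuc natLeq)"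
    using L by (auto simp: linear_order_on_def partial_order_on_def preorder_on_def)
  have wf': "wf {(a, b::om1). a < b}"
  proof (rule wf_subset[OF wf_inv_image[OF wf, of Rep_om1]])
    show "{(a, b::om1). a < b} \<subseteq> inv_image (cardSuc natLeq - Id) Rep_om1"
      by (auto simp: less_om1_def inv_image_def Rep_om1_inject)
  qed
  show "OFCLASS(om1, wellorder_class)"
  proof
    fix a b c :: om1
    show "(a < b) = (a \<le> b \<and> \<not> b \<le> a)"
      unfolding less_om1_def less_eq_om1_def using r_antisym refl Rep_om1
      by (metis Rep_om1_inject antisymD refl_onD)
    show "a \<le> a" unfolding less_eq_om1_def using refl Rep_om1 by (metis refl_onD)
    show "a \<le> b \<Longrightarrow> b \<le> c \<Longrightarrow> a \<le> c"
      unfolding less_eq_om1_def using r_trans by (meson transD)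
    show "a \<le> b \<Longrightarrow> b \<le> a \<Longrightarrow> a = b"
      unfolding less_eq_om1_def using r_antisym by (metis Rep_om1_inject antisymD)
    show "a \<le> b \<or> b \<le> a"
      unfolding less_eq_om1_def using r_total refl Rep_om1 by (metis refl_onD total_on_def)
    fix P :: "om1 \<Rightarrow> bool"
    show "(\<And>x. (\<And>y. y < x \<Longrightarrow> P y) \<Longrightarrow> P x) \<Longrightarrow> P a"
      using wf_induct_rule[OF wf', of P a] by blast
  qed
qed
end

lemma countable_lessThan_om1:
  includes cardinal_syntax
  shows "countable {..<a::om1}"
proof -
  let ?r = "cardSuc natLeq"
  have C: "Card_order ?r" by (rule cardSuc_Card_order[OF natLeq_Card_order])
  have "|underS ?r (Rep_om1 a)| <o ?r"
    using card_of_underS[OF C] Rep_om1 by blast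
  then have "|underS ?r (Rep_om1 a)| \<le>o natLeq"
    using cardSuc_ordLeq_ordLess[OF natLeq_Card_order card_of_Card_order] by blast
  then have c: "countable (underS ?r (Rep_om1 a))"
    using countable_card_le_natLeq by blast
  have "Rep_om1 ` {..<a} \<subseteq> underS ?r (Rep_om1 a)"
    by (auto simp: underS_def less_om1_def Rep_om1_inject)
  then have "countable (Rep_om1 ` {..<a})" using c countable_subset by blast
  then show ?thesis by (simp add: countable_image_inj_eq inj_on_def Rep_om1_inject)
qed

lemma uncountable_om1:
  includes cardinal_syntax
  shows "\<not> countable (UNIV :: om1 set)"
proof
  let ?r = "cardSuc natLeq"
  assume "countable (UNIV :: om1 set)"
  then have "countable (Field ?r)"
    by (metis countable_image type_definition.Rep_range type_definition_om1)
  then have "|Field ?r| \<le>o natLeq" using countable_card_le_natLeq by blast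
  then have "?r \<le>o natLeq"
    using card_of_Field_ordIso[OF cardSuc_Card_order[OF natLeq_Card_order]]
      ordIso_ordLeq_trans ordIso_symmetric by blast
  then show False using cardSuc_greater[OF natLeq_Card_order] not_ordLess_ordLeq by blast
qed

text \<open>Otherwise \<omega>_1 would be a countable union of countable initial segments. This is
  the source of all suprema taken below.\<close>

lemma om1_bdd:
  assumes "countable (A :: om1 set)"
  shows "\<exists>b. \<forall>a\<in>A. a < b"
proof (rule ccontr)
  assume "\<not> ?thesis"
  then have "UNIV \<subseteq> (\<Union>a\<in>A. {..<a} \<union> {a})" by (force simp: not_less le_less)
  moreover have "countable (\<Union>a\<in>A. {..<a} \<union> {a})"
    using assms countable_lessThan_om1 by auto
  ultimately show False using uncountable_om1 countable_subset by blast
qed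

lemma om1_seq_bdd: "\<exists>b. \<forall>n::nat. (f n :: om1) < b"
  using om1_bdd[of "range f"] by auto


lemma lt_om1: "lt {(a, b). a \<le> b} a b \<longleftrightarrow> a < (b :: om1)"
  by (auto simp: lt_def)

section \<open>Lower limits along a well-order\<close>

definition lb :: "('o \<times> 'o) set \<Rightarrow> 'o \<Rightarrow> ('o \<Rightarrow> nat) \<Rightarrow> nat \<Rightarrow> bool" where
  "lb r t f v \<longleftrightarrow> (\<exists>s. lt r s t \<and> (\<forall>q. (s, q) \<in> r \<and> lt r q t \<longrightarrow> v \<le> f q))"

definition cofv :: "('o \<times> 'o) set \<Rightarrow> 'o \<Rightarrow> ('o \<Rightarrow> nat) \<Rightarrow> nat \<Rightarrow> bool" where
  "cofv r t f v \<longleftrightarrow> cofinal_below r t {g. f g = v}"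

lemma liminf_below_cofv:
  "liminf_below r t f = (if \<exists>v. cofv r t f v then (LEAST v. cofv r t f v) else 0)"
  by (simp add: liminf_below_def cofv_def)

lemma cofv_alt: "cofv r t f v \<longleftrightarrow> (\<forall>s. lt r s t \<longrightarrow> (\<exists>q. (s, q) \<in> r \<and> lt r q t \<and> f q = v))"
  by (auto simp: cofv_def cofinal_below_def)

locale wor =
  fixes r :: "('o \<times> 'o) set"
  assumes wo: "well_order_on (Field r) r"
begin

lemma r_trans: "(a, b) \<in> r \<Longrightarrow> (b, c) \<in> r \<Longrightarrow> (a, c) \<in> r"
  using wo unfolding well_order_on_def linear_order_on_def partial_order_on_def preorder_on_def
  by (meson transD)

lemma r_antisym: "(a, b) \<in> r \<Longrightarrow> (b, a) \<in> r \<Longrightarrow> a = b"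
  using wo unfolding well_order_on_def linear_order_on_def partial_order_on_def
  by (meson antisymD)

lemma r_refl: "a \<in> Field r \<Longrightarrow> (a, a) \<in> r"
  using wo unfolding well_order_on_def linear_order_on_def partial_order_on_def preorder_on_def
  by (meson refl_onD)

lemma r_total: "a \<in> Field r \<Longrightarrow> b \<in> Field r \<Longrightarrow> (a, b) \<in> r \<or> lt r b a"
  using wo r_refl unfolding well_order_on_def linear_order_on_def lt_def
  by (metis total_on_def)

lemma lt_Field: "lt r a b \<Longrightarrow> a \<in> Field r \<and> b \<in> Field r"
  by (auto simp: lt_def Field_def)

lemma lt_le: "lt r a b \<Longrightarrow> (a, b) \<in> r" by (simp add: lt_def)

lemma lt_trans1: "lt r a b \<Longrightarrow> (b, c) \<in> r \<Longrightarrow> lt r a c"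
  unfolding lt_def using r_trans r_antisym by blast

lemma lt_trans2: "(a, b) \<in> r \<Longrightarrow> lt r b c \<Longrightarrow> lt r a c"
  unfolding lt_def using r_trans r_antisym by blast

lemma lt_tr: "lt r a b \<Longrightarrow> lt r b c \<Longrightarrow> lt r a c"
  using lt_trans1 lt_le by blast

lemma lt_irr: "\<not> lt r a a" by (simp add: lt_def)

lemma max2:
  assumes "lt r a t" "lt r b t"
  shows "\<exists>c. lt r c t \<and> (a, c) \<in> r \<and> (b, c) \<in> r"
  using assms r_total[of a b] lt_Field lt_le r_refl by metis

lemma max_fin:
  assumes "lt r s t" and "finite A" and "\<And>a. a \<in> A \<Longrightarrow> lt r (f a) t"
  shows "\<exists>c. lt r c t \<and> (s, c) \<in> r \<and> (\<forall>a\<in>A. (f a, c) \<in> r)"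
  using assms(2,3)
proof (induction A rule: finite_induct)
  case empty
  then show ?case using assms(1) r_refl lt_Field by blast
next
  case (insert a A)
  then obtain c where c: "lt r c t" "(s, c) \<in> r" "\<forall>a\<in>A. (f a, c) \<in> r" by auto
  obtain d where "lt r d t" "(c, d) \<in> r" "(f a, d) \<in> r"
    using max2[OF c(1), of "f a"] insert.prems by auto
  then show ?case using c r_trans by (metis insert_iff)
qed

text \<open>Each of the finitely many values below \<open>v\<close> is avoided from some time on,
  and the largest of these times works for all of them. The time \<open>s0\<close> only guarantees
  that there are times before \<open>t\<close>.\<close>

lemma lb_if_not_cofv:
  assumes "lt r s0 t"
  shows "(\<forall>w<v. \<not> cofv r t f w) \<Longrightarrow> lb r t f v"
proof (induction v)
  case 0
  then show ?case using assms by (auto simp: lb_def)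
next
  case (Suc v)
  then obtain s where s: "lt r s t" "\<And>q. (s, q) \<in> r \<Longrightarrow> lt r q t \<Longrightarrow> v \<le> f q"
    by (auto simp: lb_def)
  from Suc obtain s' where s': "lt r s' t" "\<And>q. (s', q) \<in> r \<Longrightarrow> lt r q t \<Longrightarrow> f q \<noteq> v"
    by (auto simp: cofv_alt)
  obtain c where c: "lt r c t" "(s, c) \<in> r" "(s', c) \<in> r" using max2[OF s(1) s'(1)] by blast
  have "Suc v \<le> f q" if "(c, q) \<in> r" "lt r q t" for q
    using s(2)[OF r_trans[OF c(2) that(1)] that(2)] s'(2)[OF r_trans[OF c(3) that(1)] that(2)] by simp
  then show ?case using c(1) by (auto simp: lb_def)
qed

lemma lb_cofv: "lb r t f v \<Longrightarrow> w < v \<Longrightarrow> \<not> cofv r t f w"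
  unfolding lb_def cofv_alt using max2 r_trans by (metis leD)

lemma liminf_cases:
  assumes "lt r s0 t"
  shows "(\<exists>v. lb r t f v \<and> cofv r t f v) \<or> (\<forall>v. lb r t f v)"
proof (cases "\<exists>v. cofv r t f v")
  case True
  then have "cofv r t f (LEAST v. cofv r t f v)" by (rule LeastI_ex)
  moreover have "lb r t f (LEAST v. cofv r t f v)"
    using lb_if_not_cofv[OF assms] not_less_Least by blast
  ultimately show ?thesis by blast
next
  case False
  then show ?thesis using lb_if_not_cofv[OF assms] by blast
qed

lemma liminf_fin: "lb r t f v \<Longrightarrow> cofv r t f v \<Longrightarrow> liminf_below r t f = v"
  unfolding liminf_below_cofv
  by (metis Least_equality lb_cofv not_le_imp_less)

lemma liminf_inf: "(\<And>v. lb r t f v) \<Longrightarrow> liminf_below r t f = 0"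
  unfolding liminf_below_cofv using lb_cofv lessI by (metis (full_types))

end

lemma wor_om1: "wor {(a, b). a \<le> (b :: om1)}"
proof
  have F: "Field {(a, b). a \<le> (b :: om1)} = UNIV" by (auto simp: Field_def)
  have "{(a, b). a \<le> (b :: om1)} - Id = {(a, b). a < b}" by auto
  moreover have "wf {(a, b :: om1). a < b}" using wf by auto
  moreover have "refl_on UNIV {(a, b). a \<le> (b :: om1)}" by (rule refl_onI) auto
  moreover have "trans {(a, b). a \<le> (b :: om1)}" by (rule transI) auto
  moreover have "antisym {(a, b). a \<le> (b :: om1)}" by (rule antisymI) auto
  moreover have "total_on UNIV {(a, b). a \<le> (b :: om1)}" by (auto simp: total_on_def)
  ultimately show "well_order_on (Field {(a, b). a \<le> (b :: om1)}) {(a, b). a \<le> b}"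
    unfolding F well_order_on_def linear_order_on_def partial_order_on_def preorder_on_def
    by (simp only: simp_thms) simp
qed

text \<open>Lower limit of a sequence of length \<omega>, with the same default \<open>0\<close> as
  \<open>liminf_below\<close>. It evaluates transfinite limits through a sequence of block
  minima.\<close>

definition slim :: "(nat \<Rightarrow> nat) \<Rightarrow> nat" where
  "slim g = (if \<exists>v. \<forall>n. \<exists>i\<ge>n. g i = v then (LEAST v. \<forall>n. \<exists>i\<ge>n. g i = v) else 0)"

lemma slim_fin:
  assumes "\<And>i. i \<ge> n \<Longrightarrow> v \<le> g i" and "\<And>n. \<exists>i\<ge>n. g i = v"
  shows "slim g = v"
proof -
  have "(LEAST v. \<forall>n. \<exists>i\<ge>n. g i = v) = v"
    using assms by (intro Least_equality) (auto, metis)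
  moreover have "\<exists>v. \<forall>n. \<exists>i\<ge>n. g i = v" using assms(2) by blast
  ultimately show ?thesis unfolding slim_def by (simp only: if_True)
qed

lemma slim_inf:
  assumes "\<And>v. \<exists>n. \<forall>i\<ge>n. v \<le> g i"
  shows "slim g = 0"
proof -
  have "\<not> (\<forall>n. \<exists>i\<ge>n. g i = v)" for v
    using assms[of "Suc v"] by (metis Suc_n_not_le_n)
  then have "\<not> (\<exists>v. \<forall>n. \<exists>i\<ge>n. g i = v)" by blast
  then show ?thesis unfolding slim_def by (simp only: if_False)
qed

lemma slim_cases:
  obtains (fin) v n where "\<And>i. i \<ge> n \<Longrightarrow> v \<le> g i" "\<And>n. \<exists>i\<ge>n. g i = v" "slim g = v"
  | (inf) "\<And>v. \<exists>n. \<forall>i\<ge>n. v \<le> g i" "slim g = 0"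
proof -
  have A: "(\<forall>w<v. \<not> (\<forall>n. \<exists>i\<ge>n. g i = w)) \<Longrightarrow> \<exists>n. \<forall>i\<ge>n. v \<le> g i" for v
  proof (induction v)
    case (Suc v)
    then obtain n where n: "\<forall>i\<ge>n. v \<le> g i" by auto
    obtain n' where "\<forall>i\<ge>n'. g i \<noteq> v" using Suc.prems by blast
    then have "\<forall>i\<ge>max n n'. Suc v \<le> g i" using n
      by (metis Suc_leI le_neq_implies_less max.bounded_iff)
    then show ?case by blast
  qed auto
  show thesis
  proof (cases "\<exists>v. \<forall>n. \<exists>i\<ge>n. g i = v")
    case True
    define v where "v = (LEAST v. \<forall>n. \<exists>i\<ge>n. g i = v)"
    have "\<forall>n. \<exists>i\<ge>n. g i = v" unfolding v_def using True by (rule LeastI_ex)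
    moreover obtain n where "\<forall>i\<ge>n. v \<le> g i" using A[of v] not_less_Least unfolding v_def by blast
    ultimately show thesis using fin[of n v] slim_fin[of n v g] by blast
  next
    case False
    then show thesis using inf A slim_inf by (metis (no_types, lifting))
  qed
qed

section \<open>Transfinite iteration along the countable ordinals\<close>

text \<open>A configuration is a single function: component \<open>0\<close> is the program counter, component \<open>Suc r\<close>
  the content of register \<open>r\<close>.\<close>

type_synonym cf = "nat \<Rightarrow> nat"

definition z0 :: om1 where "z0 = (LEAST t. True)"
definition sc :: "om1 \<Rightarrow> om1" where "sc s = (LEAST t. s < t)"
definition limo :: "om1 \<Rightarrow> bool" where
  "limo t \<longleftrightarrow> (\<exists>s. s < t) \<and> (\<forall>s<t. \<exists>q. s < q \<and> q < t)"
abbreviation Lim :: "om1 \<Rightarrow> (om1 \<Rightarrow> nat) \<Rightarrow> nat" where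
  "Lim \<equiv> liminf_below {(a, b). a \<le> b}"

lemma z0_le: "z0 \<le> t" unfolding z0_def by (simp add: Least_le)

lemma om1_ex_gt: "\<exists>t. s < (t :: om1)"
  using om1_seq_bdd[of "\<lambda>_. s"] by auto

lemma sc_gt: "s < sc s" unfolding sc_def using LeastI_ex[OF om1_ex_gt] .

lemma sc_le: "s < t \<Longrightarrow> sc s \<le> t" unfolding sc_def by (simp add: Least_le)

lemma less_sc: "q < sc s \<longleftrightarrow> q \<le> s"
  using sc_gt sc_le by (meson leD leI le_less_trans)

lemma sc_inj: "sc s = sc t \<longleftrightarrow> s = t"
  by (metis less_sc order.antisym order_refl)

lemma om1_cases:
  obtains "t = z0" | s where "t = sc s" | "limo t"
proof (cases "\<exists>s. s < t")
  case False
  then show ?thesis using that(1) z0_le[of t] by (metis le_less)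
next
  case True
  show ?thesis
  proof (cases "limo t")
    case False
    then obtain s where "s < t" "\<And>q. s < q \<Longrightarrow> \<not> q < t" using True by (auto simp: limo_def)
    then have "t = sc s" using sc_le[of s t] sc_gt[of s] by (metis le_less)
    then show ?thesis using that(2) by blast
  qed (use that(3) in blast)
qed

lemma not_limo_z0: "\<not> limo z0" using z0_le by (auto simp: limo_def leD)
lemma not_limo_sc: "\<not> limo (sc s)"
  using sc_gt[of s] by (auto simp: limo_def less_sc dest: leD)
lemma sc_neq_z0: "sc s \<noteq> z0" using sc_gt z0_le by (metis leD)
lemma limo_sc: "limo t \<Longrightarrow> s < t \<Longrightarrow> sc s < t"
  by (metis limo_def le_less_trans sc_le)

lemma om1_sup:
  assumes "\<And>i. s i < s (Suc i :: nat)"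
  obtains t :: om1 where "\<And>i. s i < t" "\<And>q. q < t \<Longrightarrow> \<exists>i. q < s i" "limo t"
proof -
  define t where "t = (LEAST b. \<forall>i. s i < b)"
  have a: "\<forall>i. s i < t" unfolding t_def by (rule LeastI_ex) (rule om1_seq_bdd)
  have b: "\<exists>i. q < s i" if q: "q < t" for q
  proof -
    have "\<not> (\<forall>i. s i < q)" using q not_less_Least unfolding t_def by blast
    then obtain i where "q \<le> s i" by (auto simp: not_less)
    then show ?thesis using assms[of i] by (meson le_less_trans)
  qed
  have "limo t" unfolding limo_def using a b by meson
  then show thesis using that a b by blast
qed

definition run :: "(cf \<Rightarrow> cf) \<Rightarrow> cf \<Rightarrow> om1 \<Rightarrow> cf" where
  "run F c = wfrec {(s, t). s < t} (\<lambda>f t. if t = z0 then c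
     else if \<exists>s. t = sc s then F (f (THE s. t = sc s))
     else (\<lambda>l. Lim t (\<lambda>s. f s l)))"

lemma Lim_cong: "(\<And>s. s < t \<Longrightarrow> f s = g s) \<Longrightarrow> Lim t f = Lim t g"
proof -
  assume a: "\<And>s. s < t \<Longrightarrow> f s = g s"
  have "cofv {(a, b). a \<le> b} t f v = cofv {(a, b). a \<le> b} t g v" for v
    unfolding cofv_alt lt_om1 using a by (intro all_cong imp_cong ex_cong1) auto
  then show ?thesis unfolding liminf_below_cofv by presburger
qed

lemma run_unfold: "run F c t = (if t = z0 then c
     else if \<exists>s. t = sc s then F (run F c (THE s. t = sc s))
     else (\<lambda>l. Lim t (\<lambda>s. run F c s l)))"
proof -
  have w: "wf {(s, t :: om1). s < t}" using wf by auto
  have T: "(THE s. t = sc s) < t" if "\<exists>s. t = sc s"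
    using that sc_gt by (auto simp: sc_inj)
  show ?thesis
    unfolding run_def
    by (subst wfrec[OF w]) (use T in \<open>auto simp: cut_apply cong: Lim_cong\<close>)
qed

lemma run_z0 [simp]: "run F c z0 = c" by (simp add: run_unfold)
lemma run_sc [simp]: "run F c (sc s) = F (run F c s)"
  by (subst run_unfold) (auto simp: sc_neq_z0 sc_inj)
lemma run_lim: "limo t \<Longrightarrow> run F c t l = Lim t (\<lambda>s. run F c s l)"
  by (subst run_unfold) (auto simp: not_limo_z0 not_limo_sc)

definition mn :: "(om1 \<Rightarrow> cf) \<Rightarrow> om1 \<Rightarrow> om1 \<Rightarrow> cf \<Rightarrow> bool" where
  "mn u s t m \<longleftrightarrow> (\<forall>l. (\<forall>q. s \<le> q \<and> q < t \<longrightarrow> m l \<le> u q l) \<and> (\<exists>q. s \<le> q \<and> q < t \<and> u q l = m l))"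

lemma mn_ex: assumes "s < t" shows "\<exists>m. mn u s t m"
proof
  show "mn u s t (\<lambda>l. LEAST v. \<exists>q. s \<le> q \<and> q < t \<and> u q l = v)"
    unfolding mn_def
  proof (intro allI conjI)
    fix l
    have "\<exists>v q. s \<le> q \<and> q < t \<and> u q l = v" using assms by auto
    from LeastI_ex[OF this]
    show "\<exists>q. s \<le> q \<and> q < t \<and> u q l = (LEAST v. \<exists>q. s \<le> q \<and> q < t \<and> u q l = v)" .
  qed (auto intro: Least_le)
qed

lemma mn_unique: "mn u s t m \<Longrightarrow> mn u s t m' \<Longrightarrow> m = m'"
  unfolding mn_def by (intro ext) (metis order.antisym)

lemma mn_comp: "mn u s t m \<Longrightarrow> mn u t q m' \<Longrightarrow> s < t \<Longrightarrow> t < q \<Longrightarrow> mn u s q (\<lambda>l. min (m l) (m' l))"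
  unfolding mn_def
proof (intro allI conjI impI)
  fix l p assume a: "\<forall>l. (\<forall>q. s \<le> q \<and> q < t \<longrightarrow> m l \<le> u q l) \<and> (\<exists>q. s \<le> q \<and> q < t \<and> u q l = m l)"
    "\<forall>l. (\<forall>p. t \<le> p \<and> p < q \<longrightarrow> m' l \<le> u p l) \<and> (\<exists>p. t \<le> p \<and> p < q \<and> u p l = m' l)" "s < t" "t < q"
  show "s \<le> p \<and> p < q \<Longrightarrow> min (m l) (m' l) \<le> u p l"
    using a by (cases "p < t") (auto simp: min_le_iff_disj not_less)
  show "\<exists>p. s \<le> p \<and> p < q \<and> u p l = min (m l) (m' l)"
    using a by (metis le_less_trans less_le_trans less_imp_le min_def order_trans)
qed

lemma mn_step: "mn u s (sc s) (u s)"
  unfolding mn_def less_sc by (metis order.antisym order_refl)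

lemma om1_block:
  assumes "\<And>i. s i < s (Suc i :: nat)" and "s 0 \<le> (q :: om1)" and "q < s n"
  shows "\<exists>i. s i \<le> q \<and> q < s (Suc i)"
  using assms(3)
proof (induction n)
  case 0
  then show ?case using assms(2) by simp
next
  case (Suc n)
  then show ?case by (cases "q < s n") (auto simp: not_less)
qed

lemma om1_seq_mono:
  assumes "\<And>i. s i < s (Suc i :: nat)" and "i \<le> j"
  shows "s i \<le> (s j :: om1)"
  using assms(1) assms(2) by (meson lift_Suc_mono_le less_imp_le)

text \<open>The blocks cover all times from \<open>s 0\<close> up to \<open>t\<close>, so an
  eventual lower bound of the minima is one of the run. Minima are attained inside their blocks, so
  a value recurring among them is taken cofinally.\<close>

lemma lim_blocks:
  assumes inc: "\<And>i. s i < s (Suc i :: nat)"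
    and t: "\<And>i. s i < t" "\<And>q. q < t \<Longrightarrow> \<exists>i. q < s i"
    and m: "\<And>i. mn u (s i) (s (Suc i)) (m i)"
  shows "Lim t (\<lambda>q. u q l) = slim (\<lambda>i. m i l)"
    and "mn u (s 0) t (\<lambda>l. LEAST v. \<exists>i. v = m i l)"
proof -
  interpret wor "{(a, b). a \<le> (b :: om1)}" by (rule wor_om1)
  have blk: "\<exists>i\<ge>n. s i \<le> q \<and> q < s (Suc i)" if "s n \<le> q" "q < t" for n q
  proof -
    obtain k where "q < s k" using t(2) \<open>q < t\<close> by blast
    moreover have "s 0 \<le> q" using om1_seq_mono[of s 0 n] inc that by (meson le0 order_trans)
    ultimately obtain i where i: "s i \<le> q" "q < s (Suc i)" using om1_block[of s q k] inc by blast
    have "n \<le> i"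
    proof (rule ccontr)
      assume "\<not> n \<le> i"
      then have "s (Suc i) \<le> s n" using om1_seq_mono[of s "Suc i" n] inc by auto
      then show False using i(2) that(1) by auto
    qed
    then show ?thesis using i by blast
  qed
  have lbI: "lb {(a, b). a \<le> b} t (\<lambda>q. u q l) v" if "\<And>i. i \<ge> n \<Longrightarrow> v \<le> m i l" for n v l
    unfolding lb_def lt_om1
  proof (intro exI[of _ "s n"] conjI allI impI)
    show "s n < t" by (rule t)
    fix q assume "(s n, q) \<in> {(a, b). a \<le> b} \<and> q < t"
    then obtain i where "i \<ge> n" "s i \<le> q" "q < s (Suc i)" using blk[of n q] by auto
    then show "v \<le> u q l" using that[of i] m[of i] unfolding mn_def by (meson order_trans)
  qed
  show "Lim t (\<lambda>q. u q l) = slim (\<lambda>i. m i l)"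
  proof (cases rule: slim_cases[of "\<lambda>i. m i l"])
    case (fin v n)
    have "cofv {(a, b). a \<le> b} t (\<lambda>q. u q l) v"
      unfolding cofv_alt lt_om1
    proof (intro allI impI)
      fix p assume "p < t"
      then obtain k where k: "p < s k" using t(2) by blast
      obtain i where i: "i \<ge> k" "m i l = v" using fin(2) by blast
      obtain q where q: "s i \<le> q" "q < s (Suc i)" "u q l = v" using m[of i] i unfolding mn_def by metis
      have "p \<le> q" using k q om1_seq_mono[of s k i] inc i
        by (meson less_imp_le order_trans)
      moreover have "q < t" using q t(1) less_trans by blast
      ultimately show "\<exists>q. (p, q) \<in> {(a, b). a \<le> b} \<and> q < t \<and> u q l = v" using q by auto
    qed
    then show ?thesis using liminf_fin[OF lbI[of n v l]] fin by simp
  next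
    case inf
    then show ?thesis using liminf_inf lbI by metis
  qed
  show "mn u (s 0) t (\<lambda>l. LEAST v. \<exists>i. v = m i l)"
    unfolding mn_def
  proof (intro allI conjI impI)
    fix l q assume "s 0 \<le> q \<and> q < t"
    then obtain i where "s i \<le> q" "q < s (Suc i)" using blk[of 0 q] by auto
    then have "m i l \<le> u q l" using m[of i] unfolding mn_def by auto
    moreover have "(LEAST v. \<exists>i. v = m i l) \<le> m i l" by (rule Least_le) auto
    ultimately show "(LEAST v. \<exists>i. v = m i l) \<le> u q l" by linarith
  next
    fix l
    have "\<exists>v i. v = m i l" by auto
    from LeastI_ex[OF this] obtain i where i: "(LEAST v. \<exists>i. v = m i l) = m i l" by auto
    obtain q where "s i \<le> q" "q < s (Suc i)" "u q l = m i l" using m[of i] unfolding mn_def by metis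
    then show "\<exists>q. s 0 \<le> q \<and> q < t \<and> u q l = (LEAST v. \<exists>i. v = m i l)"
      unfolding i using t(1) om1_seq_mono[of s 0 i] inc by (meson le0 order_trans less_trans)
  qed
qed

text \<open>In \<open>seg F c m d\<close> and \<open>mn u s t m\<close>, \<open>m\<close> is the componentwise minimum over the half-open stretch of the
  run that begins with \<open>c\<close> and ends before \<open>d\<close>; the minima of consecutive blocks determine the lower limit.\<close>

inductive seg :: "(cf \<Rightarrow> cf) \<Rightarrow> cf \<Rightarrow> cf \<Rightarrow> cf \<Rightarrow> bool" for F where
  seg_step: "seg F c c (F c)"
| seg_comp: "seg F c m d \<Longrightarrow> seg F d m' e \<Longrightarrow> seg F c (\<lambda>l. min (m l) (m' l)) e"
| seg_lim: "(\<And>i. seg F (c i) (m i) (c (Suc i))) \<Longrightarrow>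
    seg F (c 0) (\<lambda>l. LEAST v. \<exists>i. v = m i l) (\<lambda>l. slim (\<lambda>i. m i l))"

text \<open>The starting time \<open>s\<close> is arbitrary so that pieces can be put one after the
  other. In the limit case the end times of the pieces are chosen successively, and their supremum
  is again a countable ordinal.\<close>

lemma seg_run:
  assumes "seg F c m d" and "run F c0 s = c"
  shows "\<exists>t>s. run F c0 t = d \<and> mn (run F c0) s t m"
  using assms
proof (induction arbitrary: s rule: seg.induct)
  case (seg_step c)
  then show ?case using sc_gt mn_step run_sc by metis
next
  case (seg_comp c m d m' e)
  obtain t where t: "t > s" "run F c0 t = d" "mn (run F c0) s t m"
    using seg_comp.IH(1)[OF seg_comp.prems] by blast
  obtain q where q: "q > t" "run F c0 q = e" "mn (run F c0) t q m'"
    using seg_comp.IH(2)[OF t(2)] by blast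
  show ?case using mn_comp[OF t(3) q(3) t(1) q(1)] t(1) q(1,2) less_trans by blast
next
  case (seg_lim c m)
  have "\<exists>q. \<forall>n. run F c0 (q n) = c n \<and> (q 0 = s) \<and> (q n < q (Suc n) \<and> mn (run F c0) (q n) (q (Suc n)) (m n))"
  proof -
    have "\<exists>q. \<forall>n. (run F c0 (q n) = c n \<and> (n = 0 \<longrightarrow> q n = s)) \<and>
      (q n < q (Suc n) \<and> mn (run F c0) (q n) (q (Suc n)) (m n))"
    proof (rule dependent_nat_choice)
      show "\<exists>x. run F c0 x = c 0 \<and> (0 = (0::nat) \<longrightarrow> x = s)" using seg_lim.prems by auto
    next
      fix x and n :: nat
      assume "run F c0 x = c n \<and> (n = 0 \<longrightarrow> x = s)"
      then show "\<exists>y. (run F c0 y = c (Suc n) \<and> (Suc n = 0 \<longrightarrow> y = s)) \<and>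
        (x < y \<and> mn (run F c0) x y (m n))"
        using seg_lim.IH[of x n] by auto
    qed
    then show ?thesis by blast
  qed
  then obtain q where q: "\<And>n. run F c0 (q n) = c n" "q 0 = s" "\<And>n. q n < q (Suc n)"
    "\<And>n. mn (run F c0) (q n) (q (Suc n)) (m n)" by blast
  obtain t where t: "\<And>i. q i < t" "\<And>p. p < t \<Longrightarrow> \<exists>i. p < q i" "limo t" using om1_sup[of q] q(3) by blast
  have "run F c0 t = (\<lambda>l. slim (\<lambda>i. m i l))"
    using lim_blocks(1)[OF q(3) t(1,2) q(4)] run_lim[OF t(3)] by auto
  moreover have "mn (run F c0) s t (\<lambda>l. LEAST v. \<exists>i. v = m i l)"
    using lim_blocks(2)[OF q(3) t(1,2) q(4)] q(2) by simp
  ultimately show ?case using t(1)[of 0] q(2) by auto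
qed


section \<open>Runs along arbitrary well-orders decompose into segments\<close>

context wor
begin

lemma least_ex: "A \<subseteq> Field r \<Longrightarrow> A \<noteq> {} \<Longrightarrow> \<exists>a\<in>A. \<forall>b. lt r b a \<longrightarrow> b \<notin> A"
proof -
  assume A: "A \<subseteq> Field r" "A \<noteq> {}"
  have "wf (r - Id)" using wo by (simp add: well_order_on_def)
  then obtain a where "a \<in> A" "\<And>b. (b, a) \<in> r - Id \<Longrightarrow> b \<notin> A"
    using A(2) by (meson ex_in_conv wfE_min)
  then show ?thesis by (auto simp: lt_def)
qed

lemma wor_induct [consumes 1, case_names less]:
  assumes "a \<in> Field r" and "\<And>a. a \<in> Field r \<Longrightarrow> (\<And>b. lt r b a \<Longrightarrow> Q b) \<Longrightarrow> Q a"
  shows "Q a"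
proof (rule ccontr)
  assume "\<not> Q a"
  then obtain b where "b \<in> {b \<in> Field r. \<not> Q b}" "\<And>c. lt r c b \<Longrightarrow> c \<notin> {b \<in> Field r. \<not> Q b}"
    using least_ex[of "{b \<in> Field r. \<not> Q b}"] assms(1) by blast
  then show False using assms(2)[of b] lt_Field by blast
qed

definition mnr :: "('o \<Rightarrow> cf) \<Rightarrow> 'o \<Rightarrow> 'o \<Rightarrow> cf \<Rightarrow> bool" where
  "mnr u a b m \<longleftrightarrow> (\<forall>l. (\<forall>q. (a, q) \<in> r \<and> lt r q b \<longrightarrow> m l \<le> u q l) \<and>
     (\<exists>q. (a, q) \<in> r \<and> lt r q b \<and> u q l = m l))"

lemma mnr_comp:
  assumes "mnr u a b m" "mnr u b c m'" "lt r a b" "lt r b c"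
  shows "mnr u a c (\<lambda>l. min (m l) (m' l))"
  unfolding mnr_def
proof (intro allI conjI impI)
  fix l q assume q: "(a, q) \<in> r \<and> lt r q c"
  show "min (m l) (m' l) \<le> u q l"
  proof (cases "lt r q b")
    case True
    then show ?thesis using assms(1) q unfolding mnr_def by (meson min.coboundedI1)
  next
    case False
    then have "(b, q) \<in> r" using r_total[of b q] assms(3) q lt_Field by blast
    then show ?thesis using assms(2) q unfolding mnr_def by (meson min.coboundedI2)
  qed
next
  fix l
  obtain q1 where "(a, q1) \<in> r" "lt r q1 b" "u q1 l = m l" using assms(1) unfolding mnr_def by metis
  moreover obtain q2 where "(b, q2) \<in> r" "lt r q2 c" "u q2 l = m' l" using assms(2) unfolding mnr_def by metis
  ultimately show "\<exists>q. (a, q) \<in> r \<and> lt r q c \<and> u q l = min (m l) (m' l)"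
    using assms(3,4) lt_tr lt_le r_trans by (metis min_def)
qed

lemma block:
  assumes "\<And>i. lt r (s i) (s (Suc i :: nat))" and "(s 0, q) \<in> r" and "lt r q (s n)"
  shows "\<exists>i. (s i, q) \<in> r \<and> lt r q (s (Suc i))"
  using assms(3)
proof (induction n)
  case 0
  then show ?case using assms(2) lt_trans2 lt_irr by blast
next
  case (Suc n)
  show ?case
  proof (cases "lt r q (s n)")
    case False
    then have "(s n, q) \<in> r" using r_total[of "s n" q] assms lt_Field Suc by blast
    then show ?thesis using Suc by blast
  qed (use Suc in blast)
qed

text \<open>At a limit time \<open>b\<close> of uncountable cofinality the blocks chosen below have a supremum smaller than \<open>b\<close>.
  Then no component overflows at \<open>b\<close>, and the configuration at the supremum is the one at \<open>b\<close>.\<close>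

lemma segments_of_run:
  fixes u :: "'o \<Rightarrow> cf"
  assumes suc: "\<And>a b. immediate_succ r a b \<Longrightarrow> u b = F (u a)"
    and lim: "\<And>b l. is_limit r b \<Longrightarrow> u b l = liminf_below r b (\<lambda>q. u q l)"
    and supp: "\<And>a l. a \<in> Field r \<Longrightarrow> K \<le> l \<Longrightarrow> u a l = 0"
    and b: "b \<in> Field r"
  shows "\<forall>a. lt r a b \<longrightarrow> (\<exists>m. seg F (u a) m (u b) \<and> mnr u a b m)"
  using b
proof (induction b rule: wor_induct)
  case (less b)
  show ?case
  proof (intro allI impI)
    fix a assume ab: "lt r a b"
    show "\<exists>m. seg F (u a) m (u b) \<and> mnr u a b m"
    proof (cases "\<exists>p. immediate_succ r p b")
      case True
      then obtain p where p: "immediate_succ r p b" by blast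
      then have pb: "lt r p b" and no: "\<And>g. lt r p g \<Longrightarrow> \<not> lt r g b" by (auto simp: immediate_succ_def)
      have 1: "seg F (u p) (u p) (u b)" using seg_step[of F "u p"] suc[OF p] by simp
      have pp: "q = p" if "(p, q) \<in> r" "lt r q b" for q
        using that no[of q] by (auto simp: lt_def)
      have 2: "mnr u p b (u p)"
        unfolding mnr_def using pp pb r_refl lt_Field by (metis order_refl)
      show ?thesis
      proof (cases "a = p")
        case False
        then have "lt r a p" using ab no[of a] r_total[of p a] lt_Field[OF ab] lt_Field[OF pb] by (auto simp: lt_def)
        then obtain m where "seg F (u a) m (u p)" "mnr u a p m" using less.IH[OF pb] by blast
        then show ?thesis using seg_comp[OF _ 1] mnr_comp[OF _ 2 \<open>lt r a p\<close> pb] by blast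
      qed (use 1 2 in blast)
    next
      case False
      then have il: "is_limit r b" using ab by (auto simp: is_limit_def)
      have dens: "\<exists>q. lt r s q \<and> lt r q b" if "lt r s b" for s
        using that False by (auto simp: immediate_succ_def)
      define fin where "fin l \<longleftrightarrow> (\<exists>v. lb r b (\<lambda>q. u q l) v \<and> cofv r b (\<lambda>q. u q l) v)" for l
      have fin1: "lb r b (\<lambda>q. u q l) (u b l)" "cofv r b (\<lambda>q. u q l) (u b l)" if "fin l" for l
        using that liminf_fin lim[OF il] unfolding fin_def by metis+
      have inf1: "lb r b (\<lambda>q. u q l) v" "u b l = 0" if "\<not> fin l" for l v
        using that liminf_cases[OF ab, of "\<lambda>q. u q l"] liminf_inf[of b "\<lambda>q. u q l"] lim[OF il, of l]
        unfolding fin_def by auto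
      have finK: "fin l" if "K \<le> l" for l
        unfolding fin_def
      proof (intro exI conjI)
        show "lb r b (\<lambda>q. u q l) 0" unfolding lb_def using ab by auto
        show "cofv r b (\<lambda>q. u q l) 0" unfolding cofv_alt using supp that r_refl lt_Field by metis
      qed
      have "\<forall>l. \<exists>s. fin l \<longrightarrow> lt r s b \<and> (\<forall>q. (s, q) \<in> r \<and> lt r q b \<longrightarrow> u b l \<le> u q l)"
        using fin1(1) unfolding lb_def by blast
      then obtain f where f: "\<And>l. fin l \<Longrightarrow> lt r (f l) b \<and> (\<forall>q. (f l, q) \<in> r \<and> lt r q b \<longrightarrow> u b l \<le> u q l)"
        by metis
      obtain s0 where s0: "lt r s0 b" "(a, s0) \<in> r" "\<And>l. l < K \<Longrightarrow> fin l \<Longrightarrow> (f l, s0) \<in> r"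
        using max_fin[OF ab, of "{l. l < K \<and> fin l}" f] f by auto
      have lo: "u b l \<le> u q l" if "fin l" "(s0, q) \<in> r" "lt r q b" for l q
      proof (cases "l < K")
        case True
        then show ?thesis using f[OF that(1)] that s0(3) r_trans by blast
      next
        case False
        then show ?thesis using supp lt_Field[OF ab] by simp
      qed
      \<comment> \<open>The next block must be long enough for every component with a finite limit
        to attain it inside the block, and must end so late that every other component stays at
        least \<open>n\<close>. Only components below \<open>K\<close> count, so finitely many times
        have to be exceeded.\<close>
      have nxt: "\<exists>s'. lt r s s' \<and> lt r s' b \<and> (\<forall>l<K. fin l \<longrightarrow> (\<exists>q. (s, q) \<in> r \<and> lt r q s' \<and> u q l = u b l))
          \<and> (\<forall>l<K. \<not> fin l \<longrightarrow> (\<forall>q. (s', q) \<in> r \<and> lt r q b \<longrightarrow> n \<le> u q l))"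
        if s: "lt r s b" for s and n :: nat
      proof -
        have "\<forall>l. \<exists>p. lt r p b \<and> (fin l \<longrightarrow> (s, p) \<in> r \<and> u p l = u b l)
            \<and> (\<not> fin l \<longrightarrow> (\<forall>q. (p, q) \<in> r \<and> lt r q b \<longrightarrow> n \<le> u q l))"
        proof
          fix l
          show "\<exists>p. lt r p b \<and> (fin l \<longrightarrow> (s, p) \<in> r \<and> u p l = u b l)
            \<and> (\<not> fin l \<longrightarrow> (\<forall>q. (p, q) \<in> r \<and> lt r q b \<longrightarrow> n \<le> u q l))"
          proof (cases "fin l")
            case True
            then show ?thesis using fin1(2)[OF True] s unfolding cofv_alt by blast
          next
            case False
            then show ?thesis using inf1(1)[OF False, of n] unfolding lb_def by blast
          qed
        qed
        then obtain g where g: "\<And>l. lt r (g l) b" "\<And>l. fin l \<Longrightarrow> (s, g l) \<in> r \<and> u (g l) l = u b l"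
          "\<And>l q. \<not> fin l \<Longrightarrow> (g l, q) \<in> r \<Longrightarrow> lt r q b \<Longrightarrow> n \<le> u q l" by metis
        obtain c where c: "lt r c b" "(s, c) \<in> r" "\<And>l. l < K \<Longrightarrow> (g l, c) \<in> r"
          using max_fin[OF s, of "{..<K}" g] g(1) by auto
        obtain s' where s': "lt r c s'" "lt r s' b" using dens[OF c(1)] by blast
        have "lt r (g l) s'" if "l < K" for l using c(3)[OF that] s'(1) lt_trans2 by blast
        moreover have "lt r s s'" using c(2) s'(1) lt_trans2 by blast
        ultimately show ?thesis using g s' lt_le r_trans by (metis (no_types, lifting))
      qed
      have "\<exists>S. \<forall>n. (lt r (S n) b \<and> (n = 0 \<longrightarrow> S n = s0)) \<and> (lt r (S n) (S (Suc n)) \<and>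
          (\<forall>l<K. fin l \<longrightarrow> (\<exists>q. (S n, q) \<in> r \<and> lt r q (S (Suc n)) \<and> u q l = u b l))
          \<and> (\<forall>l<K. \<not> fin l \<longrightarrow> (\<forall>q. (S (Suc n), q) \<in> r \<and> lt r q b \<longrightarrow> n \<le> u q l)))"
      proof (rule dependent_nat_choice)
        show "\<exists>x. lt r x b \<and> (0 = (0::nat) \<longrightarrow> x = s0)" using s0 by blast
      next
        fix x and n :: nat
        assume "lt r x b \<and> (n = 0 \<longrightarrow> x = s0)"
        then show "\<exists>y. (lt r y b \<and> (Suc n = 0 \<longrightarrow> y = s0)) \<and> lt r x y \<and>
          (\<forall>l<K. fin l \<longrightarrow> (\<exists>q. (x, q) \<in> r \<and> lt r q y \<and> u q l = u b l))
          \<and> (\<forall>l<K. \<not> fin l \<longrightarrow> (\<forall>q. (y, q) \<in> r \<and> lt r q b \<longrightarrow> n \<le> u q l))"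
          using nxt[of x n] by blast
      qed
      then obtain S where S: "\<And>n. lt r (S n) b" "S 0 = s0" "\<And>n. lt r (S n) (S (Suc n))"
        "\<And>n l. l < K \<Longrightarrow> fin l \<Longrightarrow> \<exists>q. (S n, q) \<in> r \<and> lt r q (S (Suc n)) \<and> u q l = u b l"
        "\<And>n l q. l < K \<Longrightarrow> \<not> fin l \<Longrightarrow> (S (Suc n), q) \<in> r \<Longrightarrow> lt r q b \<Longrightarrow> n \<le> u q l" by metis
      have S0: "(s0, S n) \<in> r" for n
        by (induction n) (use S r_refl lt_Field lt_le r_trans in blast)+
      have "\<forall>i. \<exists>m. seg F (u (S i)) m (u (S (Suc i))) \<and> mnr u (S i) (S (Suc i)) m"
        using less.IH[OF S(1)] S(3) by blast
      then obtain m where m: "\<And>i. seg F (u (S i)) (m i) (u (S (Suc i)))" "\<And>i. mnr u (S i) (S (Suc i)) (m i)"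
        by metis
      have mfin: "m i l = u b l" if "fin l" for i l
      proof (rule order.antisym)
        obtain q where q: "(S i, q) \<in> r" "lt r q (S (Suc i))" "u q l = m i l"
          using m(2)[of i] unfolding mnr_def by metis
        then show "u b l \<le> m i l" using lo[OF that, of q] S0[of i] r_trans lt_tr S(1) by metis
        show "m i l \<le> u b l"
        proof (cases "l < K")
          case True
          then show ?thesis using S(4)[OF True that, of i] m(2)[of i] unfolding mnr_def by metis
        next
          case False
          then have "u q l = 0" using supp lt_Field[OF q(2)] by simp
          then show ?thesis using q by simp
        qed
      qed
      \<comment> \<open>The bound \<open>n\<close> is only guaranteed from \<open>S (Suc n)\<close>
        on, hence the index shift.\<close>
      have minf: "i \<le> m (Suc i) l" if nf: "\<not> fin l" for i l
      proof -
        obtain q where q: "(S (Suc i), q) \<in> r" "lt r q (S (Suc (Suc i)))" "u q l = m (Suc i) l"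
          using m(2)[of "Suc i"] unfolding mnr_def by metis
        have "l < K" using finK nf not_less by blast
        then show ?thesis using S(5)[OF _ nf q(1)] q S(1) lt_tr by metis
      qed
      have sl: "(\<lambda>l. slim (\<lambda>i. m i l)) = u b"
      proof
        fix l
        show "slim (\<lambda>i. m i l) = u b l"
        proof (cases "fin l")
          case True
          then show ?thesis using mfin by (intro slim_fin[of 0]) auto
        next
          case False
          have "\<exists>n. \<forall>i\<ge>n. v \<le> m i l" for v
            using minf[OF False] by (metis Suc_le_D Suc_le_mono order_trans)
          then show ?thesis using slim_inf inf1(2)[OF False] by metis
        qed
      qed
      let ?m = "\<lambda>l. LEAST v. \<exists>i. v = m i l"
      have segm: "seg F (u s0) ?m (u b)"
        using seg_lim[of F "\<lambda>i. u (S i)" m, OF m(1)] sl S(2) by simp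
      have mb: "mnr u s0 b ?m"
        unfolding mnr_def
      proof (intro allI conjI impI)
        fix l q assume q: "(s0, q) \<in> r \<and> lt r q b"
        show "?m l \<le> u q l"
        proof (cases "fin l")
          case True
          have "?m l = u b l" using mfin[OF True] by (intro Least_equality) auto
          then show ?thesis using lo[OF True] q by simp
        next
          case False
          have "l < K" using finK False not_less by blast
          \<comment> \<open>The blocks need not exhaust the times below \<open>b\<close>. From this
            block on, however, a component without finite limit is at least
            \<open>Suc (u q l)\<close>, so \<open>q\<close> comes earlier and lies in some
            block.\<close>
          have "\<not> (S (Suc (Suc (u q l))), q) \<in> r"
            using S(5)[OF \<open>l < K\<close> False, of "Suc (u q l)" q] q by auto
          then have "lt r q (S (Suc (Suc (u q l))))" using r_total[of "S (Suc (Suc (u q l)))" q] q S(1) lt_Field by blast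
          then obtain i where i: "(S i, q) \<in> r" "lt r q (S (Suc i))"
            using block[of S q, OF S(3)] q S(2) by blast
          have "?m l \<le> m i l" by (rule Least_le) auto
          also have "m i l \<le> u q l" using m(2)[of i] i unfolding mnr_def by blast
          finally show ?thesis .
        qed
      next
        fix l
        have "\<exists>v i. v = m i l" by auto
        from LeastI_ex[OF this] obtain i where i: "?m l = m i l" by auto
        obtain q where "(S i, q) \<in> r" "lt r q (S (Suc i))" "u q l = m i l"
          using m(2)[of i] unfolding mnr_def by metis
        then show "\<exists>q. (s0, q) \<in> r \<and> lt r q b \<and> u q l = ?m l"
          unfolding i using S0 S(1) r_trans lt_tr by metis
      qed
      show ?thesis
      proof (cases "a = s0")
        case False
        then have "lt r a s0" using s0(2) by (simp add: lt_def)
        then obtain m' where "seg F (u a) m' (u s0)" "mnr u a s0 m'" using less.IH[OF s0(1)] by blast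
        then show ?thesis using seg_comp[OF _ segm] mnr_comp[OF _ mb \<open>lt r a s0\<close> s0(1)] by blast
      qed (use segm mb in blast)
    qed
  qed
qed

end

section \<open>Halting computations\<close>

text \<open>Halted configurations are made fixed points. The run is then defined at all countable
  times, and halting can be read off at any sufficiently late one.\<close>

definition stp :: "prog \<Rightarrow> nat set \<Rightarrow> cf \<Rightarrow> cf" where
  "stp P x k = (if k 0 < length P
     then case_nat (fst (step P x (k 0, \<lambda>r. k (Suc r)))) (snd (step P x (k 0, \<lambda>r. k (Suc r)))) else k)"

lemma stp_halted: "length P \<le> k 0 \<Longrightarrow> stp P x k = k"
  by (simp add: stp_def)

lemma stp_go: "k 0 < length P \<Longrightarrow> stp P x k =
    case_nat (fst (step P x (k 0, \<lambda>r. k (Suc r)))) (snd (step P x (k 0, \<lambda>r. k (Suc r))))"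
  by (simp add: stp_def)

definition supp :: "nat \<Rightarrow> cf \<Rightarrow> bool" where
  "supp K k \<longleftrightarrow> (\<forall>l\<ge>K. k l = 0)"

fun wreg :: "instr \<Rightarrow> nat" where
  "wreg (Zero i) = i"
| "wreg (Inc i) = i"
| "wreg (Copy i j) = j"
| "wreg (JumpEq i j l) = 0"
| "wreg (OracleJump i l) = 0"

lemma exec_other: "wreg I \<noteq> l \<Longrightarrow> snd (exec x I (pc, R)) l = R l"
  by (cases I) auto

lemma stp_supp: "\<exists>K\<ge>2. \<forall>x k. supp K k \<longrightarrow> supp K (stp P x k)"
proof -
  obtain N where N: "\<And>I. I \<in> set P \<Longrightarrow> wreg I < N"
    using finite_nat_set_iff_bounded[of "wreg ` set P"] by auto
  have "supp (N + 2) (stp P x k)" if "supp (N + 2) k" for x k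
    unfolding supp_def
  proof (intro allI impI)
    fix l assume l: "N + 2 \<le> l"
    then obtain l' where l': "l = Suc l'" "N \<le> l'" by (metis Suc_le_D add_2_eq_Suc' Suc_leD Suc_le_mono)
    show "stp P x k l = 0"
    proof (cases "k 0 < length P")
      case True
      then have "wreg (P ! k 0) \<noteq> l'" using N[of "P ! k 0"] l'(2) by auto
      then show ?thesis using True that l l'(1) exec_other[of "P ! k 0" l' x "k 0"]
        by (simp add: stp_def step_def supp_def)
    qed (use that l in \<open>simp add: stp_def supp_def\<close>)
  qed
  then show ?thesis by (intro exI[of _ "N + 2"]) auto
qed

text \<open>\<open>halts_with\<close> admits uncountable times. A run along any well-order is a
  segment up to its last time, and segments are realized at countable times, so nothing is lost by
  iterating along \<omega>_1.\<close>

lemma halts_with_run: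
  assumes "halts_with P x i"
  shows "\<exists>t. length P \<le> run (stp P x) (\<lambda>_. 0) t 0 \<and> run (stp P x) (\<lambda>_. 0) t (Suc 0) = i"
proof -
  obtain r :: "(nat set \<times> nat set) set" and c m where
    wo: "well_order_on (Field r) r" and m: "m \<in> Field r" "\<And>a. a \<in> Field r \<Longrightarrow> (a, m) \<in> r"
    and isr: "is_run r P x c" and nh: "\<And>a. a \<in> Field r \<Longrightarrow> a \<noteq> m \<Longrightarrow> fst (c a) < length P"
    and h: "length P \<le> fst (c m)" "snd (c m) 0 = i"
    using assms unfolding halts_with_def by blast
  interpret wor r by (rule wor.intro) (rule wo)
  define u where "u a = case_nat (fst (c a)) (snd (c a))" for a
  obtain K where K: "K \<ge> 2" "\<And>k. supp K k \<Longrightarrow> supp K (stp P x k)" using stp_supp by blast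
  have suc: "u b = stp P x (u a)" if "immediate_succ r a b" for a b
  proof -
    have ab: "lt r a b" using that by (simp add: immediate_succ_def)
    have "a \<noteq> m" using ab m(2)[of b] lt_Field lt_trans1 lt_irr by blast
    then have "fst (c a) < length P" using nh lt_Field[OF ab] by blast
    moreover have "c b = step P x (c a)" using isr that lt_Field[OF ab] unfolding is_run_def by blast
    ultimately show ?thesis by (simp add: u_def stp_def)
  qed
  have lim: "u b l = liminf_below r b (\<lambda>q. u q l)" if "is_limit r b" for b l
  proof -
    have "b \<in> Field r" using that lt_Field unfolding is_limit_def by blast
    then have "c b = (liminf_below r b (\<lambda>g. fst (c g)), \<lambda>k. liminf_below r b (\<lambda>g. snd (c g) k))"
      using isr that unfolding is_run_def by blast
    then show ?thesis by (cases l) (auto simp: u_def)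
  qed
  have ini: "u a = (\<lambda>_. 0)" if "a \<in> Field r" "\<And>b. \<not> lt r b a" for a
  proof -
    have "c a = (0, \<lambda>_. 0)" using isr that unfolding is_run_def by blast
    then show ?thesis by (auto simp: u_def split: nat.split)
  qed
  have sp: "supp K (u a)" if "a \<in> Field r" for a
    using that
  proof (induction a rule: wor_induct)
    case (less a)
    consider "\<And>b. \<not> lt r b a" | p where "immediate_succ r p a" | "is_limit r a"
      unfolding is_limit_def by blast
    then show ?case
    proof cases
      case 1
      then show ?thesis using ini less by (simp add: supp_def)
    next
      case (2 p)
      then show ?thesis using suc[OF 2] K(2) less by (simp add: immediate_succ_def)
    next
      case 3
      obtain s where s: "lt r s a" using 3 by (auto simp: is_limit_def)
      have "liminf_below r a (\<lambda>q. u q l) = 0" if "K \<le> l" for l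
      proof (rule liminf_fin)
        show "lb r a (\<lambda>q. u q l) 0" using s by (auto simp: lb_def)
        show "cofv r a (\<lambda>q. u q l) 0" unfolding cofv_alt
          using less.IH that r_refl lt_Field unfolding supp_def by metis
      qed
      then show ?thesis using lim[OF 3] by (simp add: supp_def)
    qed
  qed
  obtain a where a: "a \<in> Field r" "\<And>b. \<not> lt r b a"
    using least_ex[of "Field r"] m(1) lt_Field by blast
  have "\<exists>t. run (stp P x) (\<lambda>_. 0) t = u m"
  proof (cases "a = m")
    case True
    then show ?thesis using ini[OF a] run_z0 by metis
  next
    case False
    then have "lt r a m" using m(2) a(1) by (simp add: lt_def)
    then obtain mm where "seg (stp P x) (u a) mm (u m)"
      using segments_of_run[of u "stp P x" K m] suc lim sp m(1) unfolding supp_def by blast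
    then show ?thesis using seg_run[of "stp P x" "u a" mm "u m" "\<lambda>_. 0" z0] ini[OF a] by auto
  qed
  then show ?thesis using h by (metis (no_types, lifting) old.nat.simps(4,5) u_def)
qed

lemma run_halted:
  assumes "length P \<le> run (stp P x) c t 0" and "t \<le> s"
  shows "run (stp P x) c s = run (stp P x) c t"
  using assms(2)
proof (induction s rule: less_induct)
  case (less s)
  show ?case
  proof (cases "t = s")
    case False
    then have ts: "t < s" using less.prems by simp
    show ?thesis
    proof (cases s rule: om1_cases)
      case 1
      then show ?thesis using ts z0_le leD by blast
    next
      case (2 p)
      then have "run (stp P x) c p = run (stp P x) c t" using less.IH[of p] ts sc_gt by (simp add: less_sc)
      then show ?thesis using assms(1) by (simp add: 2 stp_halted)
    next
      case 3
      interpret wor "{(a, b). a \<le> (b :: om1)}" by (rule wor_om1)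
      have eq: "run (stp P x) c q = run (stp P x) c t" if "t \<le> q" "q < s" for q using less.IH that by blast
      show ?thesis
      proof
        fix l
        have "Lim s (\<lambda>q. run (stp P x) c q l) = run (stp P x) c t l"
        proof (rule liminf_fin)
          show "lb {(a, b). a \<le> b} s (\<lambda>q. run (stp P x) c q l) (run (stp P x) c t l)"
            unfolding lb_def lt_om1
          proof (intro exI[of _ t] conjI allI impI)
            show "t < s" by (rule ts)
            fix q assume "(t, q) \<in> {(a, b). a \<le> b} \<and> q < s"
            then have "run (stp P x) c q l = run (stp P x) c t l" using eq[of q] by simp
            then show "run (stp P x) c t l \<le> run (stp P x) c q l" by simp
          qed
          show "cofv {(a, b). a \<le> b} s (\<lambda>q. run (stp P x) c q l) (run (stp P x) c t l)"
            unfolding cofv_alt lt_om1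
          proof (intro allI impI)
            fix p assume "p < s"
            then have m: "max p t < s" using ts by simp
            have "(p, max p t) \<in> {(a, b). a \<le> b}" by simp
            then show "\<exists>q. (p, q) \<in> {(a, b). a \<le> b} \<and> q < s \<and> run (stp P x) c q l = run (stp P x) c t l"
              using m fun_cong[OF eq[OF max.cobounded2 m], of l] by blast
          qed
        qed
        then show "run (stp P x) c s l = run (stp P x) c t l" using run_lim[OF 3] by simp
      qed
    qed
  qed simp
qed

text \<open>The run is cut at its first halting time, and the times up to there are carried over to
  sets of naturals by \<open>Rep_om1\<close>.\<close>

lemma run_halts_with:
  assumes "length P \<le> run (stp P x) (\<lambda>_. 0) t0 0" and "run (stp P x) (\<lambda>_. 0) t0 (Suc 0) = i"
  shows "halts_with P x i"
proof -
  let ?u = "run (stp P x) (\<lambda>_. 0)"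
  define t where "t = (LEAST t. length P \<le> ?u t 0)"
  have t: "length P \<le> ?u t 0" unfolding t_def using assms(1) by (rule LeastI)
  have nt: "?u s 0 < length P" if "s < t" for s
    using that not_less_Least unfolding t_def by (metis not_le)
  have "t \<le> t0" unfolding t_def using assms(1) by (rule Least_le)
  then have ti: "?u t (Suc 0) = i" using run_halted[OF t] assms(2) by metis
  define r where "r = {(Rep_om1 a, Rep_om1 b) | a b. a \<le> b \<and> b \<le> t}"
  define c where "c s = (?u (Abs_om1 s) 0, \<lambda>k. ?u (Abs_om1 s) (Suc k))" for s
  have inr: "(Rep_om1 a, Rep_om1 b) \<in> r \<longleftrightarrow> a \<le> b \<and> b \<le> t" for a b
    by (auto simp: r_def Rep_om1_inject)
  have F: "Field r = Rep_om1 ` {..t}"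
    unfolding Field_def by (auto simp: r_def Domain_iff Range_iff)
  have ltr: "lt r (Rep_om1 a) (Rep_om1 b) \<longleftrightarrow> a < b \<and> b \<le> t" for a b
    by (auto simp: lt_def inr Rep_om1_inject)
  have ltE: "\<exists>a'. a = Rep_om1 a' \<and> a' < b \<and> b \<le> t" if "lt r a (Rep_om1 b)" for a b
  proof -
    have "(a, Rep_om1 b) \<in> r" using that by (simp add: lt_def)
    then obtain a' where "a = Rep_om1 a'" unfolding r_def by blast
    then show ?thesis using that ltr by auto
  qed
  have cR: "c (Rep_om1 a) = (?u a 0, \<lambda>k. ?u a (Suc k))" for a
    by (simp add: c_def Rep_om1_inverse)
  have wo: "well_order_on (Field r) r"
    unfolding well_order_on_def linear_order_on_def partial_order_on_def preorder_on_def
  proof (intro conjI)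
    show "r \<subseteq> Field r \<times> Field r" by (auto simp: Field_def)
    show "refl_on (Field r) r" unfolding F by (rule refl_onI) (auto simp: inr)
    show "trans r" by (rule transI) (auto simp: r_def Rep_om1_inject)
    show "antisym r" by (rule antisymI) (auto simp: r_def Rep_om1_inject)
    show "total_on (Field r) r" unfolding F total_on_def by (auto simp: inr)
    show "wf (r - Id)"
    proof (rule wf_subset)
      show "wf (inv_image {(a, b). a < b} Abs_om1)" by (rule wf_inv_image) (use wf in auto)
      show "r - Id \<subseteq> inv_image {(a, b). a < b} Abs_om1"
        by (auto simp: r_def inv_image_def Rep_om1_inverse)
    qed
  qed
  have isr: "is_run r P x c"
    unfolding is_run_def F
  proof (intro conjI ballI impI; (elim imageE)?; hypsubst?)
    fix a assume a: "a \<in> {..t}" "\<forall>b. \<not> lt r b (Rep_om1 a)"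
    have "\<not> z0 < a" using a ltr[of z0 a] by auto
    then have "a = z0" using z0_le[of a] by auto
    then show "c (Rep_om1 a) = (0, \<lambda>_. 0)" by (simp add: cR)
  next
    fix a b assume ab: "a \<in> {..t}" "b \<in> {..t}" "immediate_succ r (Rep_om1 a) (Rep_om1 b)"
    then have "a < b" and no: "\<And>g. a < g \<Longrightarrow> \<not> g < b"
      by (auto simp: immediate_succ_def ltr) (meson ltr atMost_iff less_imp_le order_trans)
    then have b: "b = sc a" using sc_le[of a b] sc_gt[of a] by (metis le_less)
    have "a < t" using \<open>a < b\<close> ab by auto
    then show "c (Rep_om1 b) = step P x (c (Rep_om1 a))"
      using nt[of a] unfolding cR by (simp add: b stp_def)
  next
    fix b assume b: "b \<in> {..t}" "is_limit r (Rep_om1 b)"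
    have "limo b"
      unfolding limo_def
    proof (intro conjI allI impI)
      show "\<exists>s. s < b" using b ltE unfolding is_limit_def by blast
      fix s assume "s < b"
      then have "lt r (Rep_om1 s) (Rep_om1 b)" using b by (simp add: ltr)
      then obtain g where "lt r (Rep_om1 s) g" "lt r g (Rep_om1 b)"
        using b unfolding is_limit_def immediate_succ_def by blast
      then show "\<exists>q>s. q < b" using ltE ltr by metis
    qed
    moreover have L: "liminf_below r (Rep_om1 b) (\<lambda>g. f (Abs_om1 g)) = Lim b f" for f
    proof -
      have "cofv r (Rep_om1 b) (\<lambda>g. f (Abs_om1 g)) v = cofv {(a, b). a \<le> b} b f v" for v
      proof
        assume c: "cofv r (Rep_om1 b) (\<lambda>g. f (Abs_om1 g)) v"
        show "cofv {(a, b). a \<le> b} b f v"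
          unfolding cofv_alt lt_om1
        proof (intro allI impI)
          fix s assume "s < b"
          then obtain q where q: "(Rep_om1 s, q) \<in> r" "lt r q (Rep_om1 b)" "f (Abs_om1 q) = v"
            using c b unfolding cofv_alt ltr[symmetric] by (metis atMost_iff ltr)
          then obtain q' where "q = Rep_om1 q'" "q' < b" using ltE by blast
          then show "\<exists>q. (s, q) \<in> {(a, b). a \<le> b} \<and> q < b \<and> f q = v"
            using q inr by (auto simp: Rep_om1_inverse)
        qed
      next
        assume c: "cofv {(a, b). a \<le> b} b f v"
        show "cofv r (Rep_om1 b) (\<lambda>g. f (Abs_om1 g)) v"
          unfolding cofv_alt
        proof (intro allI impI)
          fix s assume "lt r s (Rep_om1 b)"
          then obtain s' where s': "s = Rep_om1 s'" "s' < b" using ltE by blast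
          obtain q where "s' \<le> q" "q < b" "f q = v" using c s'(2) unfolding cofv_alt lt_om1 by auto
          then show "\<exists>q. (s, q) \<in> r \<and> lt r q (Rep_om1 b) \<and> f (Abs_om1 q) = v"
            using s' b inr ltr by (intro exI[of _ "Rep_om1 q"]) (auto simp: Rep_om1_inverse)
        qed
      qed
      then show ?thesis unfolding liminf_below_cofv by presburger
    qed
    ultimately show "c (Rep_om1 b) = (liminf_below r (Rep_om1 b) (\<lambda>g. fst (c g)),
        \<lambda>k. liminf_below r (Rep_om1 b) (\<lambda>g. snd (c g) k))"
      unfolding cR by (simp add: c_def run_lim L[of "\<lambda>g. ?u g _"])
  qed
  show ?thesis
    unfolding halts_with_def
  proof (intro exI conjI ballI impI)
    show "well_order_on (Field r) r" by (rule wo)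
    show "Rep_om1 t \<in> Field r" by (simp add: F)
    show "is_run r P x c" by (rule isr)
    show "length P \<le> fst (c (Rep_om1 t))" "snd (c (Rep_om1 t)) 0 = i"
      using t ti by (simp_all add: cR)
    fix a assume "a \<in> Field r"
    then obtain a' where a': "a = Rep_om1 a'" "a' \<le> t" by (auto simp: F)
    then show "(a, Rep_om1 t) \<in> r" by (simp add: inr)
    assume "a \<noteq> Rep_om1 t"
    then have "a' < t" using a' by auto
    then show "fst (c a) < length P" using nt a' by (simp add: cR)
  qed
qed

lemma halts_with_iff:
  "halts_with P x i \<longleftrightarrow>
     (\<exists>t. length P \<le> run (stp P x) (\<lambda>_. 0) t 0 \<and> run (stp P x) (\<lambda>_. 0) t (Suc 0) = i)"
  using halts_with_run run_halts_with by blast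

lemma halts_with_unique: "halts_with P x i \<Longrightarrow> halts_with P x j \<Longrightarrow> i = j"
  unfolding halts_with_iff using run_halted by (metis linear)

section \<open>Relocatable program fragments\<close>

abbreviation cfg :: "nat \<Rightarrow> (nat \<Rightarrow> nat) \<Rightarrow> cf" where "cfg b R \<equiv> case_nat b R"

fun shiftI :: "nat \<Rightarrow> instr \<Rightarrow> instr" where
  "shiftI b (JumpEq i j l) = JumpEq i j (b + l)"
| "shiftI b (OracleJump i l) = OracleJump i (b + l)"
| "shiftI b I = I"

lemma shiftI_shiftI: "shiftI a (shiftI b I) = shiftI (a + b) I" by (cases I) auto

text \<open>Base and offset are separate because jump targets are relative to the base
  \<open>b\<close> of a whole fragment, whereas a part of the fragment begins \<open>n\<close> lines
  further.\<close>

definition pl :: "prog \<Rightarrow> nat \<Rightarrow> nat \<Rightarrow> prog \<Rightarrow> bool" where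
  "pl Q b n p \<longleftrightarrow> (\<forall>k<length p. b + n + k < length Q \<and> Q ! (b + n + k) = shiftI b (p ! k))"

abbreviation placed :: "prog \<Rightarrow> nat \<Rightarrow> prog \<Rightarrow> bool" where "placed Q b p \<equiv> pl Q b 0 p"

definition mv :: "prog \<Rightarrow> nat \<Rightarrow> prog" where "mv p n = map (shiftI n) p"

lemma length_mv [simp]: "length (mv p n) = length p" by (simp add: mv_def)

lemma pl_append: "pl Q b n (p @ q) \<longleftrightarrow> pl Q b n p \<and> pl Q b (n + length p) q"
proof
  assume a: "pl Q b n (p @ q)"
  have "pl Q b n p" unfolding pl_def
  proof (intro allI impI)
    fix k assume "k < length p"
    then show "b + n + k < length Q \<and> Q ! (b + n + k) = shiftI b (p ! k)"
      using a[unfolded pl_def, rule_format, of k] by (simp add: nth_append)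
  qed
  moreover have "pl Q b (n + length p) q" unfolding pl_def
  proof (intro allI impI)
    fix k assume "k < length q"
    then show "b + (n + length p) + k < length Q \<and> Q ! (b + (n + length p) + k) = shiftI b (q ! k)"
      using a[unfolded pl_def, rule_format, of "length p + k"] by (simp add: nth_append add.assoc)
  qed
  ultimately show "pl Q b n p \<and> pl Q b (n + length p) q" by simp
next
  assume a: "pl Q b n p \<and> pl Q b (n + length p) q"
  show "pl Q b n (p @ q)" unfolding pl_def
  proof (intro allI impI)
    fix k assume k: "k < length (p @ q)"
    show "b + n + k < length Q \<and> Q ! (b + n + k) = shiftI b ((p @ q) ! k)"
    proof (cases "k < length p")
      case True
      then show ?thesis using a unfolding pl_def by (simp add: nth_append)
    next
      case False
      then show ?thesis using a[THEN conjunct2, unfolded pl_def, rule_format, of "k - length p"] k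
        by (simp add: nth_append add.assoc)
    qed
  qed
qed

lemma pl_mv: "pl Q b n (mv p n) \<longleftrightarrow> placed Q (b + n) p"
  unfolding pl_def mv_def by (simp add: shiftI_shiftI)

lemma pl_single: "pl Q b n [I] \<longleftrightarrow> b + n < length Q \<and> Q ! (b + n) = shiftI b I"
  by (auto simp: pl_def)

text \<open>Input-output behaviour alone would not suffice, since an enclosing transfinite loop
  takes lower limits over intermediate configurations too. So the program counter never falls below
  the base, and protected registers never fall below the value that they have at both ends.\<close>

definition pseg :: "prog \<Rightarrow> nat set \<Rightarrow> nat \<Rightarrow> nat \<Rightarrow> cf \<Rightarrow> cf \<Rightarrow> bool" where
  "pseg Q x v b c d \<longleftrightarrow> (\<exists>m. seg (stp Q x) c m d \<and> b \<le> m 0 \<and>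
     (\<forall>r<v. m (Suc r) = c (Suc r) \<and> d (Suc r) = c (Suc r)))"

lemma pseg_trans [trans]: "pseg Q x v b c d \<Longrightarrow> pseg Q x v b d e \<Longrightarrow> pseg Q x v b c e"
  unfolding pseg_def
proof (elim exE conjE)
  fix m m' assume "seg (stp Q x) c m d" "seg (stp Q x) d m' e" "b \<le> m 0" "b \<le> m' 0"
    "\<forall>r<v. m (Suc r) = c (Suc r) \<and> d (Suc r) = c (Suc r)"
    "\<forall>r<v. m' (Suc r) = d (Suc r) \<and> e (Suc r) = d (Suc r)"
  then show "\<exists>m. seg (stp Q x) c m e \<and> b \<le> m 0 \<and> (\<forall>r<v. m (Suc r) = c (Suc r) \<and> e (Suc r) = c (Suc r))"
    by (intro exI[of _ "\<lambda>l. min (m l) (m' l)"]) (auto intro: seg_comp)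
qed

lemma pseg_weak: "pseg Q x v b c d \<Longrightarrow> v' \<le> v \<Longrightarrow> b' \<le> b \<Longrightarrow> pseg Q x v' b' c d"
  unfolding pseg_def by (meson le_trans less_le_trans)

lemma seg_exec:
  assumes "k < length Q"
  shows "seg (stp Q x) (cfg k R) (cfg k R) (cfg (fst (exec x (Q ! k) (k, R))) (snd (exec x (Q ! k) (k, R))))"
  using seg_step[of "stp Q x" "cfg k R"] assms by (simp add: stp_go step_def)

lemma pseg_exec:
  assumes "k < length Q" "b \<le> k" "\<And>r. r < v \<Longrightarrow> snd (exec x (Q ! k) (k, R)) r = R r"
  shows "pseg Q x v b (cfg k R) (cfg (fst (exec x (Q ! k) (k, R))) (snd (exec x (Q ! k) (k, R))))"
  unfolding pseg_def using seg_exec[OF assms(1), of x R] assms(2,3)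
  by (intro exI[of _ "cfg k R"]) auto

lemma pseg_Zero: "pl Q b n [Zero i] \<Longrightarrow> b' \<le> b + n \<Longrightarrow> v \<le> i \<Longrightarrow>
    pseg Q x v b' (cfg (b + n) R) (cfg (Suc (b + n)) (R(i := 0)))"
  using pseg_exec[of "b + n" Q b' v x R] by (simp add: pl_single)

lemma pseg_Inc: "pl Q b n [Inc i] \<Longrightarrow> b' \<le> b + n \<Longrightarrow> v \<le> i \<Longrightarrow>
    pseg Q x v b' (cfg (b + n) R) (cfg (Suc (b + n)) (R(i := Suc (R i))))"
  using pseg_exec[of "b + n" Q b' v x R] by (simp add: pl_single)

lemma pseg_Copy: "pl Q b n [Copy i j] \<Longrightarrow> b' \<le> b + n \<Longrightarrow> v \<le> j \<Longrightarrow>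
    pseg Q x v b' (cfg (b + n) R) (cfg (Suc (b + n)) (R(j := R i)))"
  using pseg_exec[of "b + n" Q b' v x R] by (simp add: pl_single)

lemma pseg_Jump: "pl Q b n [JumpEq i j l] \<Longrightarrow> b' \<le> b + n \<Longrightarrow>
    pseg Q x v b' (cfg (b + n) R) (cfg (if R i = R j then b + l else Suc (b + n)) R)"
  using pseg_exec[of "b + n" Q b' v x R] by (cases "R i = R j") (simp_all add: pl_single)

lemma pseg_Oracle: "pl Q b n [OracleJump i l] \<Longrightarrow> b' \<le> b + n \<Longrightarrow>
    pseg Q x v b' (cfg (b + n) R) (cfg (if R i \<in> x then b + l else Suc (b + n)) R)"
  using pseg_exec[of "b + n" Q b' v x R] by (cases "R i \<in> x") (simp_all add: pl_single)

definition hoare :: "nat \<Rightarrow> prog \<Rightarrow> nat set \<Rightarrow> (nat \<Rightarrow> nat) \<Rightarrow> ((nat \<Rightarrow> nat) \<Rightarrow> bool) \<Rightarrow> bool" where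
  "hoare v p x R Post \<longleftrightarrow> (\<forall>Q b. placed Q b p \<longrightarrow>
     (\<exists>R'. pseg Q x v b (cfg b R) (cfg (b + length p) R') \<and> Post R'))"

lemma pseg_prot: "pseg Q x v b (cfg n R) (cfg n' R') \<Longrightarrow> r < v \<Longrightarrow> R' r = R r"
  by (auto simp: pseg_def)

lemma hoare_conseq:
  assumes "hoare v p x R P1" and "\<And>R'. (\<And>r. r < v' \<Longrightarrow> R' r = R r) \<Longrightarrow> P1 R' \<Longrightarrow> P2 R'" and "v' \<le> v"
  shows "hoare v' p x R P2"
  unfolding hoare_def
proof (intro allI impI)
  fix Q b assume "placed Q b p"
  then obtain R' where R': "pseg Q x v b (cfg b R) (cfg (b + length p) R')" "P1 R'"
    using assms(1) unfolding hoare_def by blast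
  have "pseg Q x v' b (cfg b R) (cfg (b + length p) R')" using pseg_weak[OF R'(1) assms(3)] by simp
  then show "\<exists>R'. pseg Q x v' b (cfg b R) (cfg (b + length p) R') \<and> P2 R'"
    using assms(2)[of R'] pseg_prot R'(2) by blast
qed

definition sq :: "prog \<Rightarrow> prog \<Rightarrow> prog" (infixr ";;" 60) where "p ;; q = p @ mv q (length p)"

lemma hoare_Zero: "v \<le> i \<Longrightarrow> Post (R(i := 0)) \<Longrightarrow> hoare v [Zero i] x R Post"
  unfolding hoare_def using pseg_Zero[of _ _ 0] by fastforce
lemma hoare_Inc: "v \<le> i \<Longrightarrow> Post (R(i := Suc (R i))) \<Longrightarrow> hoare v [Inc i] x R Post"
  unfolding hoare_def using pseg_Inc[of _ _ 0] by fastforce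
lemma hoare_Copy: "v \<le> j \<Longrightarrow> Post (R(j := R i)) \<Longrightarrow> hoare v [Copy i j] x R Post"
  unfolding hoare_def using pseg_Copy[of _ _ 0] by fastforce

lemma hoare_sq:
  assumes "hoare v p x R (\<lambda>R'. hoare v q x R' Post)"
  shows "hoare v (p ;; q) x R Post"
  unfolding hoare_def
proof (intro allI impI)
  fix Q b assume "placed Q b (p ;; q)"
  then have p: "placed Q b p" and q: "placed Q (b + length p) q"
    by (simp_all add: sq_def pl_append pl_mv)
  obtain R1 where R1: "pseg Q x v b (cfg b R) (cfg (b + length p) R1)" "hoare v q x R1 Post"
    using assms p unfolding hoare_def by blast
  obtain R2 where R2: "pseg Q x v (b + length p) (cfg (b + length p) R1) (cfg (b + length p + length q) R2)" "Post R2"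
    using R1(2) q unfolding hoare_def by blast
  have "pseg Q x v b (cfg b R) (cfg (b + length p + length q) R2)"
    using pseg_trans[OF R1(1) pseg_weak[OF R2(1)]] by simp
  then show "\<exists>R'. pseg Q x v b (cfg b R) (cfg (b + length (p ;; q)) R') \<and> Post R'"
    using R2(2) by (auto simp: sq_def add.assoc)
qed

text \<open>The else-branch \<open>q\<close> comes first; comparing register \<open>0\<close> with
  itself is the unconditional jump. The two jumps account for the constant \<open>2\<close>.\<close>

definition ifj :: "(nat \<Rightarrow> instr) \<Rightarrow> prog \<Rightarrow> prog \<Rightarrow> prog" where
  "ifj J p q = [J (length q + 2)] @ mv q 1 @ [JumpEq 0 0 (length q + 2 + length p)] @ mv p (length q + 2)"

lemma hoare_ifj:
  assumes J: "\<And>Q b n l. pl Q b n [J l] \<Longrightarrow>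
      pseg Q x v b (cfg (b + n) R) (cfg (if C then b + l else Suc (b + n)) R)"
    and p: "C \<Longrightarrow> hoare v p x R Post" and q: "\<not> C \<Longrightarrow> hoare v q x R Post"
  shows "hoare v (ifj J p q) x R Post"
  unfolding hoare_def
proof (intro allI impI)
  fix Q b assume "placed Q b (ifj J p q)"
  then have 1: "pl Q b 0 [J (length q + 2)]" and 2: "placed Q (b + 1) q"
    and 3: "pl Q b (length q + 1) [JumpEq 0 0 (length q + 2 + length p)]"
    and 4: "placed Q (b + (length q + 2)) p"
    using pl_mv[of Q b 1 q] pl_mv[of Q b "length q + 2" p] by (simp_all add: ifj_def pl_append flip: append_Cons)
  have len: "length (ifj J p q) = length q + 2 + length p" by (simp add: ifj_def)
  show "\<exists>R'. pseg Q x v b (cfg b R) (cfg (b + length (ifj J p q)) R') \<and> Post R'"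
  proof (cases C)
    case True
    obtain R' where R': "pseg Q x v (b + (length q + 2)) (cfg (b + (length q + 2)) R) (cfg (b + (length q + 2) + length p) R')" "Post R'"
      using p[OF True] 4 unfolding hoare_def by blast
    have "pseg Q x v b (cfg b R) (cfg (b + (length q + 2)) R)" using J[OF 1] True by simp
    from pseg_trans[OF this pseg_weak[OF R'(1)]]
    show ?thesis using R'(2) by (auto simp: len add.assoc)
  next
    case False
    obtain R' where R': "pseg Q x v (b + 1) (cfg (b + 1) R) (cfg (b + 1 + length q) R')" "Post R'"
      using q[OF False] 2 unfolding hoare_def by blast
    have a: "pseg Q x v b (cfg b R) (cfg (b + 1) R)" using J[OF 1] False by simp
    have c: "pseg Q x v b (cfg (b + 1 + length q) R') (cfg (b + length (ifj J p q)) R')"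
      using pseg_Jump[OF 3, of b x v R'] by (simp add: len add_ac)
    have "pseg Q x v b (cfg (b + 1) R) (cfg (b + 1 + length q) R')" using pseg_weak[OF R'(1)] by simp
    from pseg_trans[OF pseg_trans[OF a this] c]
    show ?thesis using R'(2) by blast
  qed
qed

abbreviation ifeq :: "nat \<Rightarrow> nat \<Rightarrow> prog \<Rightarrow> prog \<Rightarrow> prog" where "ifeq i j \<equiv> ifj (JumpEq i j)"
abbreviation ifmem :: "nat \<Rightarrow> prog \<Rightarrow> prog \<Rightarrow> prog" where "ifmem i \<equiv> ifj (OracleJump i)"

lemma hoare_ifeq: "(R i = R j \<Longrightarrow> hoare v p x R Post) \<Longrightarrow> (R i \<noteq> R j \<Longrightarrow> hoare v q x R Post)
    \<Longrightarrow> hoare v (ifeq i j p q) x R Post"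
  by (rule hoare_ifj[where C = "R i = R j"]) (use pseg_Jump in auto)

lemma hoare_ifmem: "(R i \<in> x \<Longrightarrow> hoare v p x R Post) \<Longrightarrow> (R i \<notin> x \<Longrightarrow> hoare v q x R Post)
    \<Longrightarrow> hoare v (ifmem i p q) x R Post"
  by (rule hoare_ifj[where C = "R i \<in> x"]) (use pseg_Oracle in auto)

definition wh :: "nat \<Rightarrow> nat \<Rightarrow> prog \<Rightarrow> prog" where
  "wh i j p = [JumpEq i j (length p + 2)] @ mv p 1 @ [JumpEq 0 0 0]"

lemma hoare_wh:
  fixes n :: nat
  assumes I: "I n R"
    and fin: "\<And>n R. I n R \<Longrightarrow> R i = R j \<Longrightarrow> Post R"
    and body: "\<And>n R. I n R \<Longrightarrow> R i \<noteq> R j \<Longrightarrow> hoare v p x R (\<lambda>R'. \<exists>n'<n. I n' R')"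
  shows "hoare v (wh i j p) x R Post"
  unfolding hoare_def
proof (intro allI impI)
  fix Q b assume "placed Q b (wh i j p)"
  then have 1: "pl Q b 0 [JumpEq i j (length p + 2)]" and 2: "placed Q (b + 1) p"
    and 3: "pl Q b (length p + 1) [JumpEq 0 0 0]"
    using pl_mv[of Q b 1 p] by (simp_all add: wh_def pl_append flip: append_Cons)
  have len: "length (wh i j p) = length p + 2" by (simp add: wh_def)
  show "\<exists>R'. pseg Q x v b (cfg b R) (cfg (b + length (wh i j p)) R') \<and> Post R'"
    using I
  proof (induction n arbitrary: R rule: less_induct)
    case (less n)
    show ?case
    proof (cases "R i = R j")
      case True
      then have "pseg Q x v b (cfg b R) (cfg (b + length (wh i j p)) R)"
        using pseg_Jump[OF 1, of b x v R] by (simp add: len)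
      then show ?thesis using fin[OF less.prems True] by blast
    next
      case False
      obtain R1 n' where R1: "pseg Q x v (b + 1) (cfg (b + 1) R) (cfg (b + 1 + length p) R1)" "n' < n" "I n' R1"
        using body[OF less.prems False] 2 unfolding hoare_def by blast
      have a: "pseg Q x v b (cfg b R) (cfg (b + 1) R)" using pseg_Jump[OF 1, of b x v R] False by simp
      have c: "pseg Q x v b (cfg (b + 1 + length p) R1) (cfg b R1)"
        using pseg_Jump[OF 3, of b x v R1] by (simp add: add_ac)
      obtain R2 where R2: "pseg Q x v b (cfg b R1) (cfg (b + length (wh i j p)) R2)" "Post R2"
        using less.IH[OF R1(2,3)] by blast
      have "pseg Q x v b (cfg b R) (cfg (b + length (wh i j p)) R2)"
        using pseg_trans[OF pseg_trans[OF pseg_trans[OF a pseg_weak[OF R1(1)]] c] R2(1)] by simp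
      then show ?thesis using R2(2) by blast
    qed
  qed
qed

section \<open>Computable functions\<close>

definition addf :: "nat \<Rightarrow> nat \<Rightarrow> nat \<Rightarrow> prog" where
  "addf r t u = [Zero u] ;; wh u t ([Inc r] ;; [Inc u])"

lemma hoare_addf:
  assumes "v \<le> r" "v \<le> u" "r \<noteq> t" "r \<noteq> u" "t \<noteq> u" and P: "Post (R(r := R r + R t, u := R t))"
  shows "hoare v (addf r t u) x R Post"
  unfolding addf_def
proof (intro hoare_sq hoare_Zero assms)
  let ?I = "\<lambda>n R'. \<exists>k. k + n = R t \<and> R' = R(r := R r + k, u := k)"
  show "hoare v (wh u t ([Inc r] ;; [Inc u])) x (R(u := 0)) Post"
  proof (rule hoare_wh[where I = ?I and n = "R t"])
    show "?I (R t) (R(u := 0))" using assms by (intro exI[of _ 0]) auto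
  next
    fix n R' assume "?I n R'" "R' u = R' t"
    then show "Post R'" using P assms by auto
  next
    fix n R' assume "?I n R'" "R' u \<noteq> R' t"
    then obtain k where k: "k + n = R t" "R' = R(r := R r + k, u := k)" by blast
    then have "k \<noteq> R t" using \<open>R' u \<noteq> R' t\<close> assms by auto
    then obtain n' where n': "n = Suc n'" using k by (cases n) auto
    show "hoare v ([Inc r] ;; [Inc u]) x R' (\<lambda>R'. \<exists>n'<n. ?I n' R')"
      using assms(1-5) k n'
      by (intro hoare_sq hoare_Inc exI[of _ n'] exI[of _ "Suc k"] conjI) (auto simp: fun_eq_iff)
  qed
qed

definition trif :: "nat \<Rightarrow> nat \<Rightarrow> nat \<Rightarrow> nat \<Rightarrow> prog" where
  "trif z s s' u = [Zero z] ;; [Zero s'] ;; wh s' s ([Inc s'] ;; addf z s' u)"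

lemma hoare_trif:
  assumes "v \<le> z" "v \<le> s'" "v \<le> u" "distinct [z, s, s', u]"
    and P: "\<And>y. Post (R(z := triangle (R s), s' := R s, u := y))"
  shows "hoare v (trif z s s' u) x R Post"
  unfolding trif_def
proof (intro hoare_sq hoare_Zero assms)
  let ?I = "\<lambda>n R'. \<exists>k y. k + n = R s \<and> R' = R(z := triangle k, s' := k, u := y)"
  show "hoare v (wh s' s ([Inc s'] ;; addf z s' u)) x (R(z := 0, s' := 0)) Post"
  proof (rule hoare_wh[where I = ?I and n = "R s"])
    show "?I (R s) (R(z := 0, s' := 0))"
      using assms by (intro exI[of _ 0] exI[of _ "R u"]) (auto simp: fun_eq_iff)
  next
    fix n R' assume "?I n R'" "R' s' = R' s"
    then show "Post R'" using P assms by auto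
  next
    fix n R' assume "?I n R'" "R' s' \<noteq> R' s"
    then obtain k y where k: "k + n = R s" "R' = R(z := triangle k, s' := k, u := y)" by blast
    then have "k \<noteq> R s" using \<open>R' s' \<noteq> R' s\<close> assms by auto
    then obtain n' where n': "n = Suc n'" using k by (cases n) auto
    show "hoare v ([Inc s'] ;; addf z s' u) x R' (\<lambda>R'. \<exists>n'<n. ?I n' R')"
      using assms(1-4) k n'
      by (intro hoare_sq hoare_Inc hoare_addf exI[of _ n'] exI[of _ "Suc k"] exI[of _ "Suc k"] conjI)
        (auto simp: fun_eq_iff)
  qed
qed

abbreviation p1 :: "nat \<Rightarrow> nat" where "p1 z \<equiv> fst (prod_decode z)"
abbreviation p2 :: "nat \<Rightarrow> nat" where "p2 z \<equiv> snd (prod_decode z)"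
abbreviation pr :: "nat \<Rightarrow> nat \<Rightarrow> nat" where "pr a b \<equiv> prod_encode (a, b)"

text \<open>Along a diagonal of Cantor's pairing the first component grows, and the diagonal ends
  when the second is \<open>0\<close>. A machine can thus decode a number by counting up to it,
  which is what \<open>decf\<close> does.\<close>

lemma prod_decode_Suc:
  "prod_decode (Suc k) = (if p2 k = 0 then (0, Suc (p1 k)) else (Suc (p1 k), p2 k - 1))"
proof -
  obtain m n where mn: "prod_decode k = (m, n)" by force
  then have k: "k = pr m n" using prod_decode_inverse by metis
  show ?thesis
  proof (cases n)
    case 0
    then have "Suc k = pr 0 (Suc m)" using k by (simp add: prod_encode_def)
    then show ?thesis using mn 0 by simp
  next
    case (Suc n')
    then have "Suc k = pr (Suc m) n'" using k by (simp add: prod_encode_def)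
    then show ?thesis using mn Suc by simp
  qed
qed

definition decf :: "nat \<Rightarrow> nat \<Rightarrow> nat \<Rightarrow> nat \<Rightarrow> prog" where
  "decf t m s z = [Zero m] ;; [Zero s] ;; [Zero z] ;;
     wh z t (ifeq m s ([Inc s] ;; [Zero m]) ([Inc m]) ;; [Inc z])"

lemma hoare_decf:
  assumes "v \<le> m" "v \<le> s" "v \<le> z" "distinct [t, m, s, z]"
    and P: "Post (R(m := p1 (R t), s := p1 (R t) + p2 (R t), z := R t))"
  shows "hoare v (decf t m s z) x R Post"
  unfolding decf_def
proof (intro hoare_sq hoare_Zero assms)
  let ?I = "\<lambda>n R'. \<exists>k. k + n = R t \<and> R' = R(m := p1 k, s := p1 k + p2 k, z := k)"
  show "hoare v (wh z t (ifeq m s ([Inc s] ;; [Zero m]) ([Inc m]) ;; [Inc z])) x (R(m := 0, s := 0, z := 0)) Post"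
  proof (rule hoare_wh[where I = ?I and n = "R t"])
    have "prod_decode 0 = (0, 0)" using prod_encode_inverse[of "(0, 0)"] by (simp add: prod_encode_def)
    then show "?I (R t) (R(m := 0, s := 0, z := 0))" by (intro exI[of _ 0]) auto
  next
    fix n R' assume "?I n R'" "R' z = R' t"
    then show "Post R'" using P assms by auto
  next
    fix n R' assume "?I n R'" "R' z \<noteq> R' t"
    then obtain k where k: "k + n = R t" "R' = R(m := p1 k, s := p1 k + p2 k, z := k)" by blast
    then have "k \<noteq> R t" using \<open>R' z \<noteq> R' t\<close> assms by auto
    then obtain n' where n': "n = Suc n'" using k by (cases n) auto
    show "hoare v (ifeq m s ([Inc s] ;; [Zero m]) ([Inc m]) ;; [Inc z]) x R' (\<lambda>R'. \<exists>n'<n. ?I n' R')"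
      using assms(1-4) k n'
      by (intro hoare_sq hoare_ifeq hoare_Inc hoare_Zero exI[of _ n'] exI[of _ "Suc k"] conjI)
        (auto simp: fun_eq_iff prod_decode_Suc)
  qed
qed

definition subf :: "nat \<Rightarrow> nat \<Rightarrow> nat \<Rightarrow> prog" where
  "subf m s n = [Zero n] ;; wh m s ([Inc m] ;; [Inc n])"

lemma hoare_subf:
  assumes "v \<le> m" "v \<le> n" "distinct [m, s, n]" "R m \<le> R s"
    and P: "Post (R(m := R s, n := R s - R m))"
  shows "hoare v (subf m s n) x R Post"
  unfolding subf_def
proof (intro hoare_sq hoare_Zero assms)
  let ?I = "\<lambda>j R'. \<exists>k. R m + k + j = R s \<and> R' = R(m := R m + k, n := k)"
  show "hoare v (wh m s ([Inc m] ;; [Inc n])) x (R(n := 0)) Post"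
  proof (rule hoare_wh[where I = ?I and n = "R s - R m"])
    show "?I (R s - R m) (R(n := 0))" using assms by (intro exI[of _ 0]) (auto simp: fun_eq_iff)
  next
    fix j R' assume "?I j R'" "R' m = R' s"
    then obtain k where k: "R m + k + j = R s" "R' = R(m := R m + k, n := k)" by blast
    then have "k = R s - R m" "R m + k = R s" using \<open>R' m = R' s\<close> assms by auto
    then show "Post R'" using P k by simp
  next
    fix j R' assume "?I j R'" "R' m \<noteq> R' s"
    then obtain k where k: "R m + k + j = R s" "R' = R(m := R m + k, n := k)" by blast
    then have "R m + k \<noteq> R s" using \<open>R' m \<noteq> R' s\<close> assms by auto
    then obtain j' where j': "j = Suc j'" using k by (cases j) auto
    show "hoare v ([Inc m] ;; [Inc n]) x R' (\<lambda>R'. \<exists>j'<j. ?I j' R')"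
      using assms(1-3) k j'
      by (intro hoare_sq hoare_Inc exI[of _ j'] exI[of _ "Suc k"] conjI) (auto simp: fun_eq_iff)
  qed
qed

text \<open>Computability by ITRMs: the programs may use transfinite time. What is fixed is the
  calling convention, with the argument in any register below \<open>v\<close>, the result in
  \<open>v\<close>, and the registers from \<open>v\<close> on as working space.\<close>

definition computable :: "(nat set \<Rightarrow> nat \<Rightarrow> nat) \<Rightarrow> bool" where
  "computable f \<longleftrightarrow> (\<forall>v i. i < v \<longrightarrow> (\<exists>p. \<forall>x R. hoare v p x R (\<lambda>R'. R' v = f x (R i))))"

lemma computableE:
  assumes "computable f" "i < v"
  obtains p where "\<And>x R. hoare v p x R (\<lambda>R'. R' v = f x (R i))"
  using assms unfolding computable_def by blast

lemma computable_id: "computable (\<lambda>x a. a)"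
  unfolding computable_def by (metis (mono_tags, lifting) fun_upd_same hoare_Copy order_refl)

lemma computable_const: "computable (\<lambda>x a. n)"
  unfolding computable_def
proof (intro allI impI)
  fix v i :: nat
  have "\<exists>p. \<forall>x R. hoare v p x R (\<lambda>R'. R' v = n)"
  proof (induction n)
    case 0
    show ?case by (intro exI[of _ "[Zero v]"] allI hoare_Zero) auto
  next
    case (Suc n)
    then obtain p where p: "\<And>x R. hoare v p x R (\<lambda>R'. R' v = n)" by blast
    have "hoare v (p ;; [Inc v]) x R (\<lambda>R'. R' v = Suc n)" for x R
      by (rule hoare_sq, rule hoare_conseq[OF p]) (auto intro!: hoare_Inc)
    then show ?case by blast
  qed
  then show "\<exists>p. \<forall>x R. hoare v p x R (\<lambda>R'. R' v = n)" .
qed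

lemma computable_comp:
  assumes "computable f" "computable g"
  shows "computable (\<lambda>x a. g x (f x a))"
  unfolding computable_def
proof (intro allI impI)
  fix v i :: nat assume i: "i < v"
  obtain p where p: "\<And>x R. hoare v p x R (\<lambda>R'. R' v = f x (R i))" using computableE[OF assms(1) i] by blast
  obtain q where q: "\<And>x R. hoare (Suc v) q x R (\<lambda>R'. R' (Suc v) = g x (R v))"
    using computableE[OF assms(2), of v "Suc v"] by auto
  have "hoare v (p ;; q ;; [Copy (Suc v) v]) x R (\<lambda>R'. R' v = g x (f x (R i)))" for x R
    by (rule hoare_sq, rule hoare_conseq[OF p], rule hoare_sq, rule hoare_conseq[OF q])
      (auto intro!: hoare_Copy)
  then show "\<exists>p. \<forall>x R. hoare v p x R (\<lambda>R'. R' v = g x (f x (R i)))" by blast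
qed

lemma computable_basic:
  assumes "\<And>v. \<exists>p. \<forall>x R. hoare (Suc v) p x R (\<lambda>R'. R' (Suc v) = g x (R v))" and "computable f"
  shows "computable (\<lambda>x a. g x (f x a))"
  unfolding computable_def
proof (intro allI impI)
  fix v i :: nat assume i: "i < v"
  obtain p where p: "\<And>x R. hoare v p x R (\<lambda>R'. R' v = f x (R i))" using computableE[OF assms(2) i] by blast
  obtain q where q: "\<And>x R. hoare (Suc v) q x R (\<lambda>R'. R' (Suc v) = g x (R v))" using assms(1) by blast
  have "hoare v (p ;; q ;; [Copy (Suc v) v]) x R (\<lambda>R'. R' v = g x (f x (R i)))" for x R
    by (rule hoare_sq, rule hoare_conseq[OF p], rule hoare_sq, rule hoare_conseq[OF q])
      (auto intro!: hoare_Copy)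
  then show "\<exists>p. \<forall>x R. hoare v p x R (\<lambda>R'. R' v = g x (f x (R i)))" by blast
qed

lemma computable_Suc: "computable f \<Longrightarrow> computable (\<lambda>x a. Suc (f x a))"
proof (rule computable_basic[where g = "\<lambda>x a. Suc a"])
  fix v
  show "\<exists>p. \<forall>x R. hoare (Suc v) p x R (\<lambda>R'. R' (Suc v) = Suc (R v))"
    by (intro exI[of _ "[Copy v (Suc v)] ;; [Inc (Suc v)]"] allI hoare_sq hoare_Copy hoare_Inc) auto
qed

lemma computable_pred: "computable f \<Longrightarrow> computable (\<lambda>x a. f x a - 1)"
proof (rule computable_basic[where g = "\<lambda>x a. a - 1"])
  fix v
  let ?a = "Suc v" and ?b = "Suc (Suc v)"
  let ?p = "[Zero ?a] ;; [Zero ?b] ;; ifeq ?a v [Zero ?a] ([Inc ?b] ;; subf ?b v ?a)"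
  have "hoare (Suc v) ?p x R (\<lambda>R'. R' (Suc v) = R v - 1)" for x R
    by (intro hoare_sq hoare_Zero hoare_ifeq hoare_Inc hoare_subf) auto
  then show "\<exists>p. \<forall>x R. hoare (Suc v) p x R (\<lambda>R'. R' (Suc v) = R v - 1)" by blast
qed

lemma computable_p1: "computable f \<Longrightarrow> computable (\<lambda>x a. p1 (f x a))"
proof (rule computable_basic[where g = "\<lambda>x a. p1 a"])
  fix v
  have "hoare (Suc v) (decf v (v + 1) (v + 2) (v + 3)) x R (\<lambda>R'. R' (Suc v) = p1 (R v))" for x R
    by (intro hoare_decf) auto
  then show "\<exists>p. \<forall>x R. hoare (Suc v) p x R (\<lambda>R'. R' (Suc v) = p1 (R v))" by blast
qed

lemma computable_p2: "computable f \<Longrightarrow> computable (\<lambda>x a. p2 (f x a))"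
proof (rule computable_basic[where g = "\<lambda>x a. p2 a"])
  fix v
  have "hoare (Suc v) (decf v (v + 4) (v + 2) (v + 3) ;; subf (v + 4) (v + 2) (v + 1)) x R (\<lambda>R'. R' (Suc v) = p2 (R v))" for x R
    by (intro hoare_sq hoare_decf hoare_subf) auto
  then show "\<exists>p. \<forall>x R. hoare (Suc v) p x R (\<lambda>R'. R' (Suc v) = p2 (R v))" by blast
qed

lemma computable_binary:
  assumes "\<And>v. \<exists>p. \<forall>x R. hoare v p x R (\<lambda>R'. R' v = g (R v) (R (Suc v)))" and "computable f" "computable f'"
  shows "computable (\<lambda>x a. g (f x a) (f' x a))"
  unfolding computable_def
proof (intro allI impI)
  fix v i :: nat assume i: "i < v"
  obtain p where p: "\<And>x R. hoare v p x R (\<lambda>R'. R' v = f x (R i))" using computableE[OF assms(2) i] by blast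
  obtain p' where p': "\<And>x R. hoare (Suc v) p' x R (\<lambda>R'. R' (Suc v) = f' x (R i))"
    using computableE[OF assms(3), of i "Suc v"] i by auto
  obtain q where q: "\<And>x R. hoare v q x R (\<lambda>R'. R' v = g (R v) (R (Suc v)))" using assms(1) by blast
  have "hoare v (p ;; p' ;; q) x R (\<lambda>R'. R' v = g (f x (R i)) (f' x (R i)))" for x R
  proof (rule hoare_sq, rule hoare_conseq[OF p])
    fix R1 assume R1: "\<And>r. r < v \<Longrightarrow> R1 r = R r" "R1 v = f x (R i)"
    show "hoare v (p' ;; q) x R1 (\<lambda>R'. R' v = g (f x (R i)) (f' x (R i)))"
    proof (rule hoare_sq, rule hoare_conseq[where v = "Suc v", OF hoare_conseq[OF p' _ order_refl]])
      show "(\<And>r. r < Suc v \<Longrightarrow> R' r = R1 r) \<Longrightarrow> R' (Suc v) = f' x (R1 i) \<Longrightarrow>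
        R' v = f x (R i) \<and> R' (Suc v) = f' x (R i)" for R'
        using R1 i by simp
      show "R' v = f x (R i) \<and> R' (Suc v) = f' x (R i) \<Longrightarrow> hoare v q x R' (\<lambda>R'. R' v = g (f x (R i)) (f' x (R i)))" for R'
        using q[of x R'] by simp
    qed simp
  qed simp
  then show "\<exists>p. \<forall>x R. hoare v p x R (\<lambda>R'. R' v = g (f x (R i)) (f' x (R i)))" by blast
qed

lemma computable_pr: "computable f \<Longrightarrow> computable g \<Longrightarrow> computable (\<lambda>x a. pr (f x a) (g x a))"
proof (rule computable_binary[where g = pr])
  fix v
  let ?p = "[Copy v (v + 2)] ;; addf (v + 2) (v + 1) (v + 3) ;; trif (v + 5) (v + 2) (v + 4) (v + 3)
    ;; addf (v + 5) v (v + 3) ;; [Copy (v + 5) v]"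
  have "hoare v ?p x R (\<lambda>R'. R' v = pr (R v) (R (Suc v)))" for x R
    by (intro hoare_sq hoare_Copy hoare_addf hoare_trif) (auto simp: prod_encode_def)
  then show "\<exists>p. \<forall>x R. hoare v p x R (\<lambda>R'. R' v = pr (R v) (R (Suc v)))" by blast
qed

lemma computable_eq: "computable f \<Longrightarrow> computable g \<Longrightarrow> computable (\<lambda>x a. of_bool (f x a = g x a))"
proof (rule computable_binary[where g = "\<lambda>a b. of_bool (a = b)"])
  fix v
  let ?p = "ifeq v (v + 1) ([Zero v] ;; [Inc v]) [Zero v]"
  have "hoare v ?p x R (\<lambda>R'. R' v = of_bool (R v = R (Suc v)))" for x R
    by (intro hoare_ifeq hoare_sq hoare_Inc hoare_Zero) auto
  then show "\<exists>p. \<forall>x R. hoare v p x R (\<lambda>R'. R' v = of_bool (R v = R (Suc v)))" by blast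
qed

lemma computable_mem: "computable f \<Longrightarrow> computable (\<lambda>x a. of_bool (f x a \<in> x))"
proof (rule computable_basic[where g = "\<lambda>x a. of_bool (a \<in> x)"])
  fix v
  let ?p = "ifmem v ([Zero (v + 1)] ;; [Inc (v + 1)]) [Zero (v + 1)]"
  have "hoare (Suc v) ?p x R (\<lambda>R'. R' (Suc v) = of_bool (R v \<in> x))" for x R
    by (intro hoare_ifmem hoare_sq hoare_Inc hoare_Zero) auto
  then show "\<exists>p. \<forall>x R. hoare (Suc v) p x R (\<lambda>R'. R' (Suc v) = of_bool (R v \<in> x))" by blast
qed

lemma computable_cong: "computable f \<Longrightarrow> (\<And>x a. f x a = g x a) \<Longrightarrow> computable g"
  by (metis ext)

lemma computable_not: "computable (\<lambda>x a. of_bool (A x a)) \<Longrightarrow> computable (\<lambda>x a. of_bool (\<not> A x a))"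
  by (rule computable_cong[OF computable_eq[OF _ computable_const[of 0]]]) auto

lemma computable_and:
  assumes "computable (\<lambda>x a. of_bool (A x a))" "computable (\<lambda>x a. of_bool (B x a))"
  shows "computable (\<lambda>x a. of_bool (A x a \<and> B x a))"
  by (rule computable_cong[OF computable_eq[OF computable_pr[OF assms] computable_const[of "pr 1 1"]]]) auto

section \<open>Depth-first search for an infinite path\<close>

text \<open>The \<open>Suc\<close> reserves \<open>0\<close> for the empty list and makes codes
  strictly larger when a list grows at its head, as the search for infinite paths requires.\<close>

fun cdl :: "nat list \<Rightarrow> nat" where
  "cdl [] = 0"
| "cdl (x # xs) = pr (Suc x) (cdl xs)"

lemma cdl_less: "cdl l < cdl (x # l)"
proof -
  have "cdl l < triangle (Suc x + cdl l) + Suc x" by (simp add: triangle_def)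
  then show ?thesis by (simp add: prod_encode_def)
qed

lemma cdl_eq_0: "cdl l = 0 \<longleftrightarrow> l = []"
  by (cases l) (auto simp: prod_encode_def)

lemma cdl_inj: "cdl l = cdl l' \<longleftrightarrow> l = l'"
proof (induction l arbitrary: l')
  case Nil
  then show ?case using cdl_eq_0[of l'] by auto
next
  case (Cons x l)
  then show ?case using cdl_eq_0[of "x # l"] by (cases l') auto
qed

lemma length_le_cdl: "length l \<le> cdl l"
proof (induction l)
  case (Cons x l)
  then show ?case using cdl_less[of l x] by (simp del: cdl.simps)
qed simp

lemma seg_le_start: "seg F c m d \<Longrightarrow> m l \<le> c l"
proof (induction rule: seg.induct)
  case (seg_lim c m)
  have "(LEAST v. \<exists>i. v = m i l) \<le> m 0 l" by (rule Least_le) auto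
  then show ?case using seg_lim.IH[of 0] by linarith
qed auto

text \<open>Register \<open>v\<close> holds the current node, coded as a list together with its ancestors, \<open>v + 1\<close> a flag,
  \<open>v + 2\<close> the root and \<open>v + 3\<close> zero. Every pass through the loop sets the flag to \<open>0\<close> and back to \<open>1\<close>,
  so line \<open>0\<close> meets the flag \<open>0\<close> exactly at limit times. Codes increase along branches and the search
  returns to the parent between two of its children. Hence at a limit time register \<open>v\<close> either
  holds a node all of whose children have been refuted, or it has overflown to \<open>0\<close> along an infinite path.\<close>

locale dfs =
  fixes Q :: prog and x :: "nat set" and b v :: nat and \<rho> :: "nat \<Rightarrow> nat" and a :: nat
    and A :: "nat \<Rightarrow> bool" and pT pC pS pP :: prog
  assumes T: "\<And>R. hoare (v + 4) pT x R (\<lambda>R'. R' (v + 4) = of_bool (p2 (R v) = 0 \<or>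
      A (pr (p1 (p2 (R v)) - 1) (p1 (R v) - 1))))"
    and C: "\<And>R. hoare (v + 4) pC x R (\<lambda>R'. R' (v + 4) = pr 1 (R v))"
    and S: "\<And>R. hoare (v + 4) pS x R (\<lambda>R'. R' (v + 4) = pr (Suc (p1 (R v))) (p2 (R v)))"
    and P: "\<And>R. hoare (v + 5) pP x R (\<lambda>R'. R' (v + 5) = p2 (R v))"
begin

definition "aT = (3::nat)"
definition "aC = 4 + length pT"
definition "aLIM = aC + length pC + 2"
definition "aREF = aLIM + 2"
definition "aS = aREF + 1"
definition "aP = aS + length pS"
definition "aFND = aP + length pP + 3"
definition "aNOT = aFND + 3"
definition "aEND = aNOT + 1"

definition prg :: prog where
  "prg = [JumpEq (v + 1) (v + 3) aLIM, Zero (v + 1), Inc (v + 1)] @ mv pT aT @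
     [JumpEq (v + 4) (v + 3) aREF] @ mv pC aC @ [Copy (v + 4) v, JumpEq 0 0 0] @
     [Inc (v + 1), JumpEq v (v + 3) aFND] @ [JumpEq v (v + 2) aNOT] @ mv pS aS @ mv pP aP @
     [Copy (v + 5) v, Copy (v + 4) v, JumpEq 0 0 0] @ [Zero v, Inc v, JumpEq 0 0 aEND] @ [Zero v]"

lemma length_prg: "length prg = aEND"
  by (simp add: prg_def aT_def aC_def aLIM_def aREF_def aS_def aP_def aFND_def aNOT_def aEND_def)

text \<open>Components are shifted by one against registers: component \<open>v + 3\<close> is
  register \<open>v + 2\<close>, the root, and component \<open>v + 4\<close> is register
  \<open>v + 3\<close>, the constant zero.\<close>

definition G :: "cf \<Rightarrow> cf \<Rightarrow> cf \<Rightarrow> bool" where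
  "G c m d \<longleftrightarrow> seg (stp Q x) c m d \<and> b \<le> m 0 \<and> (\<forall>r<v. m (Suc r) = \<rho> r) \<and>
     m (v + 3) = cdl [a] \<and> m (v + 4) = 0"

definition St :: "nat \<Rightarrow> nat \<Rightarrow> (nat \<Rightarrow> nat) \<Rightarrow> bool" where
  "St s f R \<longleftrightarrow> R v = s \<and> R (v + 1) = f \<and> R (v + 2) = cdl [a] \<and> R (v + 3) = 0 \<and> (\<forall>r<v. R r = \<rho> r)"

text \<open>The first three arguments of \<open>H\<close> bound the minimum of register \<open>v\<close> from below and above, and tell
  whether the flag was \<open>0\<close> at some time.\<close>

definition H :: "nat \<Rightarrow> nat \<Rightarrow> bool \<Rightarrow> cf \<Rightarrow> cf \<Rightarrow> bool" where
  "H lo up z c d \<longleftrightarrow> (\<exists>m. G c m d \<and> lo \<le> m (v + 1) \<and> m (v + 1) \<le> up \<and> (z \<longrightarrow> m (v + 2) = 0))"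

lemma H_trans:
  assumes "H lo up z c d" "H lo up' z' d e"
  shows "H lo (min up up') (z \<or> z') c e"
proof -
  obtain m m' where "G c m d" "lo \<le> m (v + 1)" "m (v + 1) \<le> up" "z \<longrightarrow> m (v + 2) = 0"
    "G d m' e" "lo \<le> m' (v + 1)" "m' (v + 1) \<le> up'" "z' \<longrightarrow> m' (v + 2) = 0"
    using assms unfolding H_def by blast
  then show ?thesis unfolding H_def G_def
    by (intro exI[of _ "\<lambda>l. min (m l) (m' l)"]) (auto intro: seg_comp)
qed

lemma H_weak: "H lo up z c d \<Longrightarrow> lo' \<le> lo \<Longrightarrow> up \<le> up' \<Longrightarrow> (z' \<longrightarrow> z) \<Longrightarrow> H lo' up' z' c d"
  unfolding H_def by (meson le_trans)

lemma H_comp: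
  assumes "H lo1 up1 z1 c d" "H lo2 up2 z2 d e" "lo \<le> lo1" "lo \<le> lo2" "min up1 up2 \<le> up" "z \<longrightarrow> z1 \<or> z2"
  shows "H lo up z c e"
  using H_weak[OF H_trans[OF H_weak[OF assms(1) assms(3) order_refl, of z1] H_weak[OF assms(2) assms(4) order_refl, of z2]]]
    assms(5,6) by auto

lemma H_same: "H s s z c d \<Longrightarrow> H s s z' d e \<Longrightarrow> H s s (z \<or> z') c e"
  using H_trans[of s s z c d s z' e] by simp

lemma H_instr:
  assumes "pl Q b n [I]" "St s f R"
  shows "H s s (f = 0) (cfg (b + n) R)
    (cfg (fst (exec x (shiftI b I) (b + n, R))) (snd (exec x (shiftI b I) (b + n, R))))"
  unfolding H_def G_def
  using seg_exec[of "b + n" Q x R] assms unfolding pl_single St_def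
  by (intro exI[of _ "cfg (b + n) R"]) (auto simp: numeral_eq_Suc)

lemma H_frag:
  assumes "hoare (v + 4) p x R Post" "placed Q (b + n) p" "St s f R"
  obtains R' where "H s s (f = 0) (cfg (b + n) R) (cfg (b + n + length p) R')" "St s f R'" "Post R'"
    "\<And>r. r < v + 4 \<Longrightarrow> R' r = R r"
proof -
  obtain R' where R': "pseg Q x (v + 4) (b + n) (cfg (b + n) R) (cfg (b + n + length p) R')" "Post R'"
    using assms(1,2) unfolding hoare_def by blast
  then obtain m where m: "seg (stp Q x) (cfg (b + n) R) m (cfg (b + n + length p) R')" "b + n \<le> m 0"
    "\<And>r. r < v + 4 \<Longrightarrow> m (Suc r) = R r" "\<And>r. r < v + 4 \<Longrightarrow> R' r = R r" unfolding pseg_def by auto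
  have "H s s (f = 0) (cfg (b + n) R) (cfg (b + n + length p) R')"
    unfolding H_def G_def using m(1,2) m(3)[of v] m(3)[of "v + 1"] m(3)[of "v + 2"] m(3)[of "v + 3"] m(3) assms(3)
    by (intro exI[of _ m]) (auto simp: St_def numeral_eq_Suc)
  moreover have "St s f R'" using assms(3) m(4) by (simp add: St_def)
  ultimately show thesis using that R'(2) m(4) by blast
qed

context
  assumes Q: "placed Q b prg"
begin

lemma pls:
  "pl Q b 0 [JumpEq (v + 1) (v + 3) aLIM]" "pl Q b 1 [Zero (v + 1)]" "pl Q b 2 [Inc (v + 1)]"
  "placed Q (b + aT) pT" "pl Q b (aT + length pT) [JumpEq (v + 4) (v + 3) aREF]"
  "placed Q (b + aC) pC" "pl Q b (aC + length pC) [Copy (v + 4) v]" "pl Q b (aC + length pC + 1) [JumpEq 0 0 0]"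
  "pl Q b aLIM [Inc (v + 1)]" "pl Q b (aLIM + 1) [JumpEq v (v + 3) aFND]"
  "pl Q b aREF [JumpEq v (v + 2) aNOT]" "placed Q (b + aS) pS" "placed Q (b + aP) pP"
  "pl Q b (aP + length pP) [Copy (v + 5) v]" "pl Q b (aP + length pP + 1) [Copy (v + 4) v]"
  "pl Q b (aP + length pP + 2) [JumpEq 0 0 0]"
  "pl Q b aFND [Zero v]" "pl Q b (aFND + 1) [Inc v]" "pl Q b (aFND + 2) [JumpEq 0 0 aEND]"
  "pl Q b aNOT [Zero v]"
proof -
  have e: "pl Q b n [I, J] = pl Q b n ([I] @ [J])" "pl Q b n [I, J, K] = pl Q b n ([I] @ [J] @ [K])" for n I J K
    by simp_all
  have a: "3 = aT" "aT + length pT + 1 = aC" "aC + length pC + 2 = aLIM" "aLIM + 2 = aREF" "aREF + 1 = aS"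
    "aS + length pS = aP" "aP + length pP + 3 = aFND" "aFND + 3 = aNOT"
    by (simp_all add: aT_def aC_def aLIM_def aREF_def aS_def aP_def aFND_def aNOT_def)
  have "pl Q b 0 ([JumpEq (v + 1) (v + 3) aLIM, Zero (v + 1), Inc (v + 1)]) \<and> pl Q b aT (mv pT aT) \<and>
     pl Q b (aT + length pT) [JumpEq (v + 4) (v + 3) aREF] \<and> pl Q b aC (mv pC aC) \<and>
     pl Q b (aC + length pC) [Copy (v + 4) v, JumpEq 0 0 0] \<and>
     pl Q b aLIM [Inc (v + 1), JumpEq v (v + 3) aFND] \<and> pl Q b aREF [JumpEq v (v + 2) aNOT] \<and>
     pl Q b aS (mv pS aS) \<and> pl Q b aP (mv pP aP) \<and>
     pl Q b (aP + length pP) [Copy (v + 5) v, Copy (v + 4) v, JumpEq 0 0 0] \<and>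
     pl Q b aFND [Zero v, Inc v, JumpEq 0 0 aEND] \<and> pl Q b aNOT [Zero v]"
    using Q unfolding prg_def pl_append length_mv
    by (simp add: aT_def aC_def aLIM_def aREF_def aS_def aP_def aFND_def aNOT_def numeral_eq_Suc)
  then show "pl Q b 0 [JumpEq (v + 1) (v + 3) aLIM]" "pl Q b 1 [Zero (v + 1)]" "pl Q b 2 [Inc (v + 1)]"
    "placed Q (b + aT) pT" "pl Q b (aT + length pT) [JumpEq (v + 4) (v + 3) aREF]"
    "placed Q (b + aC) pC" "pl Q b (aC + length pC) [Copy (v + 4) v]" "pl Q b (aC + length pC + 1) [JumpEq 0 0 0]"
    "pl Q b aLIM [Inc (v + 1)]" "pl Q b (aLIM + 1) [JumpEq v (v + 3) aFND]"
    "pl Q b aREF [JumpEq v (v + 2) aNOT]" "placed Q (b + aS) pS" "placed Q (b + aP) pP"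
    "pl Q b (aP + length pP) [Copy (v + 5) v]" "pl Q b (aP + length pP + 1) [Copy (v + 4) v]"
    "pl Q b (aP + length pP + 2) [JumpEq 0 0 0]"
    "pl Q b aFND [Zero v]" "pl Q b (aFND + 1) [Inc v]" "pl Q b (aFND + 2) [JumpEq 0 0 aEND]"
    "pl Q b aNOT [Zero v]"
    unfolding e pl_append pl_mv by (simp_all add: numeral_2_eq_2)
qed

text \<open>\<open>p2 s\<close> codes the parent of the node \<open>s\<close>; it is
  \<open>0\<close> for the root, which is always accepted. Otherwise the edge from the head of the
  parent to the head of the node is tested. Heads are stored increased by one, hence the
  subtractions.\<close>

definition node_ok :: "nat \<Rightarrow> bool" where "node_ok s \<longleftrightarrow> p2 s = 0 \<or> A (pr (p1 (p2 s) - 1) (p1 s - 1))"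

lemma test:
  assumes "St s 1 R"
  obtains R' where "H s s True (cfg b R) (cfg (b + (aT + length pT)) R')" "St s 1 R'" "R' (v + 4) = of_bool (node_ok s)"
proof -
  have 1: "H s s False (cfg b R) (cfg (b + 1) R)"
    using H_instr[OF pls(1) assms] assms by (simp add: St_def)
  have 2: "H s s False (cfg (b + 1) R) (cfg (b + 2) (R(v + 1 := 0)))"
    using H_instr[OF pls(2) assms] by simp
  have s2: "St s 0 (R(v + 1 := 0))" using assms by (auto simp: St_def)
  have 3: "H s s True (cfg (b + 2) (R(v + 1 := 0))) (cfg (b + 3) (R(v + 1 := 1)))"
    using H_instr[OF pls(3) s2] by (simp add: numeral_eq_Suc)
  have s3: "St s 1 (R(v + 1 := 1))" using assms by (auto simp: St_def)
  obtain R' where R': "H s s (1 = (0::nat)) (cfg (b + aT) (R(v + 1 := 1))) (cfg (b + aT + length pT) R')" "St s 1 R'"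
    "R' (v + 4) = of_bool (p2 ((R(v + 1 := 1)) v) = 0 \<or>
      A (pr (p1 (p2 ((R(v + 1 := 1)) v)) - 1) (p1 ((R(v + 1 := 1)) v) - 1)))"
    using H_frag[OF T pls(4) s3] by metis
  have "H s s True (cfg b R) (cfg (b + (aT + length pT)) R')"
    using H_same[OF H_same[OF H_same[OF 1 2] 3] R'(1)[unfolded aT_def]]
    by (simp add: aT_def add.assoc)
  moreover have "R' (v + 4) = of_bool (node_ok s)" using R'(3) s3 by (simp add: node_ok_def St_def)
  ultimately show thesis using that R'(2) by blast
qed

lemma test_fails:
  assumes "St s 1 R" "\<not> node_ok s"
  obtains R' where "H s s True (cfg b R) (cfg (b + aREF) R')" "St s 1 R'"
proof -
  obtain R' where R': "H s s True (cfg b R) (cfg (b + (aT + length pT)) R')" "St s 1 R'" "R' (v + 4) = of_bool (node_ok s)"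
    using test[OF assms(1)] .
  have "H s s False (cfg (b + (aT + length pT)) R') (cfg (b + aREF) R')"
    using H_instr[OF pls(5) R'(2)] R'(2,3) assms(2) by (simp add: St_def)
  from H_same[OF R'(1) this] show thesis using that[of R'] R'(2) by simp
qed

lemma descend:
  assumes "St s 1 R" "node_ok s"
  obtains R' where "H s s True (cfg b R) (cfg b R')" "St (pr 1 s) 1 R'"
proof -
  obtain R1 where R1: "H s s True (cfg b R) (cfg (b + (aT + length pT)) R1)" "St s 1 R1" "R1 (v + 4) = of_bool (node_ok s)"
    using test[OF assms(1)] .
  have 2: "H s s False (cfg (b + (aT + length pT)) R1) (cfg (b + aC) R1)"
    using H_instr[OF pls(5) R1(2)] R1(2,3) assms(2) by (simp add: St_def aC_def aT_def add_ac)
  obtain R2 where R2: "H s s (1 = (0::nat)) (cfg (b + aC) R1) (cfg (b + aC + length pC) R2)" "St s 1 R2"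
    "R2 (v + 4) = pr 1 (R1 v)"
    using H_frag[OF C pls(6) R1(2)] by metis
  let ?R = "R2(v := R2 (v + 4))"
  have 3: "H s s False (cfg (b + (aC + length pC)) R2) (cfg (b + (aC + length pC + 1)) ?R)"
    using H_instr[OF pls(7) R2(2)] by simp
  have s3: "St (pr 1 s) 1 ?R" using R2(2,3) R1(2) by (auto simp: St_def)
  have "s \<le> pr 1 s" by (rule le_prod_encode_2)
  have 4: "H s (pr 1 s) False (cfg (b + (aC + length pC + 1)) ?R) (cfg b ?R)"
    using H_weak[OF H_instr[OF pls(8) s3], of s "pr 1 s" False] \<open>s \<le> pr 1 s\<close> by simp
  have "H s s True (cfg b R) (cfg b ?R)"
    using H_comp[OF H_same[OF H_same[OF H_same[OF R1(1) 2] R2(1)[unfolded add.assoc]] 3] 4] by simp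
  then show thesis using that s3 by blast
qed

lemma sibling:
  assumes "St s 1 R" "s \<noteq> cdl [a]"
  obtains R' where "H (p2 s) (p2 s) False (cfg (b + aREF) R) (cfg b R')" "St (pr (Suc (p1 s)) (p2 s)) 1 R'"
proof -
  let ?s' = "pr (Suc (p1 s)) (p2 s)"
  have le: "p2 s \<le> s" by (metis le_prod_encode_2 prod.collapse prod_decode_inverse)
  have le': "p2 s \<le> ?s'" by (rule le_prod_encode_2)
  have 1: "H s s False (cfg (b + aREF) R) (cfg (b + aS) R)"
    using H_instr[OF pls(11) assms(1)] assms by (simp add: St_def aS_def)
  obtain R1 where R1: "H s s (1 = (0::nat)) (cfg (b + aS) R) (cfg (b + aS + length pS) R1)" "St s 1 R1"
    "R1 (v + 4) = pr (Suc (p1 (R v))) (p2 (R v))"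
    using H_frag[OF S pls(12) assms(1)] by metis
  have "hoare (v + 5) pP x R1 (\<lambda>R'. R' (v + 5) = p2 (R1 v) \<and> R' (v + 4) = R1 (v + 4))"
    by (rule hoare_conseq[OF P]) auto
  then have h: "hoare (v + 4) pP x R1 (\<lambda>R'. R' (v + 5) = p2 (R1 v) \<and> R' (v + 4) = R1 (v + 4))"
    by (rule hoare_conseq) auto
  obtain R2 where R2: "H s s (1 = (0::nat)) (cfg (b + aP) R1) (cfg (b + aP + length pP) R2)" "St s 1 R2"
    "R2 (v + 5) = p2 (R1 v) \<and> R2 (v + 4) = R1 (v + 4)"
    using H_frag[OF h pls(13) R1(2)] by metis
  let ?R3 = "R2(v := R2 (v + 5))"
  have 3: "H s s False (cfg (b + (aP + length pP)) R2) (cfg (b + (aP + length pP + 1)) ?R3)"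
    using H_instr[OF pls(14) R2(2)] by simp
  have s3: "St (p2 s) 1 ?R3" using R2(2,3) R1(2) by (auto simp: St_def)
  let ?R4 = "?R3(v := ?R3 (v + 4))"
  have 4: "H (p2 s) (p2 s) False (cfg (b + (aP + length pP + 1)) ?R3) (cfg (b + (aP + length pP + 2)) ?R4)"
    using H_instr[OF pls(15) s3] by simp
  have s4: "St ?s' 1 ?R4" using R2(2,3) R1(2,3) assms(1) by (auto simp: St_def)
  have 5: "H (p2 s) ?s' False (cfg (b + (aP + length pP + 2)) ?R4) (cfg b ?R4)"
    using H_weak[OF H_instr[OF pls(16) s4], of "p2 s" ?s' False] le' by simp
  have 6: "H s s False (cfg (b + aREF) R) (cfg (b + (aP + length pP + 1)) ?R3)"
    using H_same[OF H_same[OF H_same[OF 1 R1(1)] R2(1)[unfolded aP_def add.assoc[symmetric]]] 3[unfolded aP_def add.assoc[symmetric]]]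
    by (simp add: aP_def add.assoc)
  have "H (p2 s) (p2 s) False (cfg (b + aREF) R) (cfg b ?R4)"
    using H_comp[OF H_comp[OF 6 4, of "p2 s" "p2 s" False] 5, of "p2 s" "p2 s" False] le le' by simp
  then show thesis using that s4 by blast
qed

lemma exhausted:
  assumes "St s 0 R" "s \<noteq> 0"
  obtains R' where "H s s True (cfg b R) (cfg (b + aREF) R')" "St s 1 R'"
proof -
  have 1: "H s s True (cfg b R) (cfg (b + aLIM) R)"
    using H_instr[OF pls(1) assms(1)] assms(1) by (simp add: St_def)
  let ?R = "R(v + 1 := 1)"
  have 2: "H s s True (cfg (b + aLIM) R) (cfg (b + (aLIM + 1)) ?R)"
    using H_instr[OF pls(9) assms(1)] assms(1) by (simp add: St_def)
  have s2: "St s 1 ?R" using assms(1) by (auto simp: St_def)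
  have 3: "H s s False (cfg (b + (aLIM + 1)) ?R) (cfg (b + aREF) ?R)"
    using H_instr[OF pls(10) s2] s2 assms(2) by (simp add: St_def aREF_def)
  show thesis using that[OF _ s2] H_same[OF H_same[OF 1 2] 3] by simp
qed

lemma found:
  assumes "St 0 0 R"
  obtains R' where "H 0 0 True (cfg b R) (cfg (b + aEND) R')" "R' v = 1" "\<forall>r<v. R' r = \<rho> r"
proof -
  have 1: "H 0 0 True (cfg b R) (cfg (b + aLIM) R)"
    using H_instr[OF pls(1) assms(1)] assms(1) by (simp add: St_def)
  let ?R = "R(v + 1 := 1)"
  have 2: "H 0 0 True (cfg (b + aLIM) R) (cfg (b + (aLIM + 1)) ?R)"
    using H_instr[OF pls(9) assms(1)] assms(1) by (simp add: St_def)
  have s2: "St 0 1 ?R" using assms(1) by (auto simp: St_def)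
  have 3: "H 0 0 False (cfg (b + (aLIM + 1)) ?R) (cfg (b + aFND) ?R)"
    using H_instr[OF pls(10) s2] s2 by (simp add: St_def aREF_def)
  have 4: "H 0 0 False (cfg (b + aFND) ?R) (cfg (b + (aFND + 1)) (?R(v := 0)))"
    using H_instr[OF pls(17) s2] by simp
  have s4: "St 0 1 (?R(v := 0))" using s2 by (auto simp: St_def)
  have 5: "H 0 0 False (cfg (b + (aFND + 1)) (?R(v := 0))) (cfg (b + (aFND + 2)) (?R(v := 1)))"
    using H_instr[OF pls(18) s4] by simp
  have s5: "St 1 1 (?R(v := 1))" using s2 by (auto simp: St_def)
  have 6: "H 0 1 False (cfg (b + (aFND + 2)) (?R(v := 1))) (cfg (b + aEND) (?R(v := 1)))"
    using H_weak[OF H_instr[OF pls(19) s5], of 0 1 False] by simp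
  have "H 0 0 True (cfg b R) (cfg (b + aEND) (?R(v := 1)))"
    using H_comp[OF H_same[OF H_same[OF H_same[OF H_same[OF 1 2] 3] 4] 5] 6, of 0 0 True] by simp
  then show thesis using that s5 by (auto simp: St_def)
qed

lemma not_found:
  assumes "St (cdl [a]) 1 R"
  obtains R' where "H 0 (cdl [a]) False (cfg (b + aREF) R) (cfg (b + aEND) R')" "R' v = 0" "\<forall>r<v. R' r = \<rho> r"
proof -
  have 1: "H (cdl [a]) (cdl [a]) False (cfg (b + aREF) R) (cfg (b + aNOT) R)"
    using H_instr[OF pls(11) assms(1)] assms by (simp add: St_def del: cdl.simps)
  have 2: "H (cdl [a]) (cdl [a]) False (cfg (b + aNOT) R) (cfg (b + aEND) (R(v := 0)))"
    using H_instr[OF pls(20) assms(1)] by (simp add: aEND_def del: cdl.simps)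
  show thesis using that[OF H_comp[OF 1 2]] assms by (auto simp: St_def)
qed

text \<open>Each pass starts in line \<open>b\<close> and never goes below it, so the program
  counter returns to \<open>b\<close> at the limit. Each pass also brings the flag down to
  \<open>0\<close>, so the limit sees flag \<open>0\<close>. The node register is constant in the
  minima or unbounded, which gives the two cases.\<close>

lemma limit:
  assumes St: "\<And>i. St (\<sigma> i) 1 (R i)" and H: "\<And>i. H (lo i) (up i) True (cfg b (R i)) (cfg b (R (Suc i)))"
  shows limit_stay: "(\<And>i. lo i = k \<and> up i = k) \<Longrightarrow> \<exists>R'. H k k True (cfg b (R 0)) (cfg b R') \<and> St k 0 R'"
    and limit_esc: "(\<And>i. i \<le> lo i) \<Longrightarrow> \<exists>R'. H 0 (\<sigma> 0) True (cfg b (R 0)) (cfg b R') \<and> St 0 0 R'"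
proof -
  obtain m where m: "\<And>i. G (cfg b (R i)) (m i) (cfg b (R (Suc i)))" "\<And>i. lo i \<le> m i (v + 1)"
    "\<And>i. m i (v + 1) \<le> up i" "\<And>i. m i (v + 2) = 0"
    using H unfolding H_def by metis
  have segm: "\<And>i. seg (stp Q x) (cfg b (R i)) (m i) (cfg b (R (Suc i)))" and m0: "\<And>i. b \<le> m i 0"
    and mr: "\<And>i r. r < v \<Longrightarrow> m i (Suc r) = \<rho> r" and mrt: "\<And>i. m i (v + 3) = cdl [a]" and mz: "\<And>i. m i (v + 4) = 0"
    using m(1) unfolding G_def by auto
  have m0': "m i 0 = b" for i using m0[of i] seg_le_start[OF segm, of i 0] by simp
  let ?d = "\<lambda>l. slim (\<lambda>i. m i l)" and ?M = "\<lambda>l. LEAST v. \<exists>i. v = m i l"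
  have seg: "seg (stp Q x) (cfg b (R 0)) ?M ?d" using seg_lim[of "stp Q x" "\<lambda>i. cfg b (R i)" m, OF segm] .
  have cs: "?d l = k \<and> ?M l = k" if "\<And>i. m i l = k" for l k
    using that slim_fin[of 0 k "\<lambda>i. m i l"] by (auto intro!: Least_equality)
  have d: "?d = cfg b (\<lambda>r. ?d (Suc r))" using cs[OF m0'] by (auto split: nat.split)
  have St': "St (?d (v + 1)) 0 (\<lambda>r. ?d (Suc r))"
    unfolding St_def using cs[OF m(4)] cs[OF mrt] cs[OF mz] cs[OF mr] by (auto simp: numeral_eq_Suc)
  have G: "G (cfg b (R 0)) ?M ?d"
    unfolding G_def using seg cs[OF m0'] cs[OF mr] cs[OF mrt] cs[OF mz] by auto
  {
    assume "\<And>i. lo i = k \<and> up i = k"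
    then have "m i (v + 1) = k" for i using m(2,3)[of i] by (metis order.antisym)
    note e = cs[of "v + 1", OF this]
    have "H k k True (cfg b (R 0)) ?d"
      unfolding H_def using G e cs[OF m(4)] by (intro exI[of _ ?M]) auto
    then show "\<exists>R'. H k k True (cfg b (R 0)) (cfg b R') \<and> St k 0 R'"
      using St' d e by metis
  next
    assume lo: "\<And>i. i \<le> lo i"
    have "?d (v + 1) = 0"
    proof (rule slim_inf)
      fix w show "\<exists>n. \<forall>i\<ge>n. w \<le> m i (v + 1)" using lo m(2) by (meson le_trans)
    qed
    moreover have "?M (v + 1) \<le> \<sigma> 0"
      using seg_le_start[OF seg, of "v + 1"] St[of 0] by (simp add: St_def)
    then have "H 0 (\<sigma> 0) True (cfg b (R 0)) ?d"
      unfolding H_def using G cs[OF m(4)] by (intro exI[of _ ?M]) auto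
    ultimately show "\<exists>R'. H 0 (\<sigma> 0) True (cfg b (R 0)) (cfg b R') \<and> St 0 0 R'"
      using St' d by metis
  }
qed

text \<open>Well-foundedness of the tree above \<open>l\<close>. The inductive form allows the
  transfinite refuting run to be built by induction on the tree.\<close>

inductive refuted :: "nat list \<Rightarrow> bool" where
  "(node_ok (cdl l) \<Longrightarrow> \<forall>j. refuted (j # l)) \<Longrightarrow> refuted l"

lemma next_child:
  assumes l: "l \<noteq> []" and R: "St (cdl (j # l)) 1 R"
    and IH: "\<exists>R'. H (cdl (j # l)) (cdl (j # l)) True (cfg b R) (cfg (b + aREF) R') \<and> St (cdl (j # l)) 1 R'"
  shows "\<exists>R'. H (cdl l) (cdl l) True (cfg b R) (cfg b R') \<and> St (cdl (Suc j # l)) 1 R'"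
proof -
  obtain R1 where R1: "H (cdl (j # l)) (cdl (j # l)) True (cfg b R) (cfg (b + aREF) R1)" "St (cdl (j # l)) 1 R1"
    using IH by blast
  have "cdl (j # l) \<noteq> cdl [a]" using l by (simp only: cdl_inj) simp
  then obtain R2 where R2: "H (p2 (cdl (j # l))) (p2 (cdl (j # l))) False (cfg (b + aREF) R1) (cfg b R2)"
    "St (pr (Suc (p1 (cdl (j # l)))) (p2 (cdl (j # l)))) 1 R2"
    using sibling[OF R1(2)] by blast
  have "p2 (cdl (j # l)) = cdl l" "pr (Suc (p1 (cdl (j # l)))) (p2 (cdl (j # l))) = cdl (Suc j # l)" by simp_all
  then have R2': "H (cdl l) (cdl l) False (cfg (b + aREF) R1) (cfg b R2)" "St (cdl (Suc j # l)) 1 R2"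
    using R2 by (simp_all only:)
  have "H (cdl l) (cdl l) True (cfg b R) (cfg b R2)"
    using H_comp[OF R1(1) R2'(1), of "cdl l" "cdl l" True] cdl_less[of l j] by simp
  then show ?thesis using R2'(2) by blast
qed

lemma refuted_run:
  assumes "refuted l" "l \<noteq> []" "St (cdl l) 1 R"
  shows "\<exists>R'. H (cdl l) (cdl l) True (cfg b R) (cfg (b + aREF) R') \<and> St (cdl l) 1 R'"
  using assms
proof (induction arbitrary: R rule: refuted.induct)
  case (1 l)
  show ?case
  proof (cases "node_ok (cdl l)")
    case False
    then show ?thesis using test_fails[OF 1(3)] by blast
  next
    case True
    obtain R0 where R0: "H (cdl l) (cdl l) True (cfg b R) (cfg b R0)" "St (pr 1 (cdl l)) 1 R0"
      using descend[OF 1(3) True] .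
    have "\<exists>S. \<forall>n. (St (cdl (n # l)) 1 (S n) \<and> (n = 0 \<longrightarrow> S n = R0)) \<and>
        H (cdl l) (cdl l) True (cfg b (S n)) (cfg b (S (Suc n)))"
    proof (rule dependent_nat_choice)
      show "\<exists>x. St (cdl (0 # l)) 1 x \<and> (0 = (0::nat) \<longrightarrow> x = R0)" using R0(2) by simp
    next
      fix x n assume "St (cdl (n # l)) 1 x \<and> (n = 0 \<longrightarrow> x = R0)"
      then have "\<exists>R'. H (cdl l) (cdl l) True (cfg b x) (cfg b R') \<and> St (cdl (Suc n # l)) 1 R'"
        using next_child[OF \<open>l \<noteq> []\<close>, of n x] 1(1)[OF True] by blast
      then show "\<exists>y. (St (cdl (Suc n # l)) 1 y \<and> (Suc n = 0 \<longrightarrow> y = R0)) \<and>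
        H (cdl l) (cdl l) True (cfg b x) (cfg b y)" by blast
    qed
    then obtain S where S: "\<And>n. St (cdl (n # l)) 1 (S n)" "S 0 = R0"
      "\<And>n. H (cdl l) (cdl l) True (cfg b (S n)) (cfg b (S (Suc n)))" by blast
    \<comment> \<open>Each child has been refuted in a stretch whose minimum in the node register is
      exactly \<open>cdl l\<close>. After \<omega> children the limit is therefore the parent
      itself, marked by flag \<open>0\<close>.\<close>
    obtain R1 where R1: "H (cdl l) (cdl l) True (cfg b R0) (cfg b R1)" "St (cdl l) 0 R1"
      using limit_stay[of "\<lambda>n. cdl (n # l)" S "\<lambda>_. cdl l" "\<lambda>_. cdl l" "cdl l", OF S(1) S(3)] S(2) by auto
    have "cdl l \<noteq> 0" using \<open>l \<noteq> []\<close> by (simp add: cdl_eq_0)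
    then obtain R2 where "H (cdl l) (cdl l) True (cfg b R1) (cfg (b + aREF) R2)" "St (cdl l) 1 R2"
      using exhausted[OF R1(2)] by blast
    then show ?thesis using H_same[OF H_same[OF R0(1) R1(1)]] by fastforce
  qed
qed

lemma not_refuted: "\<not> refuted l \<Longrightarrow> node_ok (cdl l) \<and> (\<exists>j. \<not> refuted (j # l))"
  using refuted.intros by blast

text \<open>The children before the least non-refuted one are refuted one by one, and the node
  register never falls below the current node. Iterated, this follows the leftmost infinite
  branch.\<close>

lemma not_refuted_run:
  assumes nr: "\<not> refuted l" and l: "l \<noteq> []" and R: "St (cdl l) 1 R"
  shows "\<exists>j R'. \<not> refuted (j # l) \<and> H (cdl l) (cdl l) True (cfg b R) (cfg b R') \<and> St (cdl (j # l)) 1 R'"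
proof -
  have "node_ok (cdl l)" using not_refuted[OF nr] by blast
  then obtain R0 where R0: "H (cdl l) (cdl l) True (cfg b R) (cfg b R0)" "St (pr 1 (cdl l)) 1 R0"
    using descend[OF R] by blast
  define j where "j = (LEAST j. \<not> refuted (j # l))"
  have j: "\<not> refuted (j # l)" unfolding j_def by (rule LeastI_ex) (use not_refuted[OF nr] in blast)
  have lt: "refuted (k # l)" if "k < j" for k using that not_less_Least unfolding j_def by blast
  have "\<exists>R'. H (cdl l) (cdl l) True (cfg b R) (cfg b R') \<and> St (cdl (k # l)) 1 R'" if "k \<le> j" for k
    using that
  proof (induction k)
    case 0
    then show ?case using R0 by auto
  next
    case (Suc k)
    then obtain R' where R': "H (cdl l) (cdl l) True (cfg b R) (cfg b R')" "St (cdl (k # l)) 1 R'" by auto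
    obtain R2 where "H (cdl l) (cdl l) True (cfg b R') (cfg b R2)" "St (cdl (Suc k # l)) 1 R2"
      using next_child[OF l R'(2)] refuted_run[OF lt _ R'(2)] Suc.prems by auto
    then show ?case using H_same[OF R'(1)] by fastforce
  qed
  then show ?thesis using j by blast
qed

lemma refuted_iff: "\<not> refuted [a] \<longleftrightarrow> (\<exists>f. f 0 = a \<and> (\<forall>n. A (pr (f n) (f (Suc n)))))"
proof
  assume nr: "\<not> refuted [a]"
  have "\<exists>g. \<forall>n. (\<not> refuted (g n) \<and> g n \<noteq> [] \<and> (n = 0 \<longrightarrow> g n = [a])) \<and> (\<exists>j. g (Suc n) = j # g n)"
  proof (rule dependent_nat_choice)
    show "\<exists>g. \<not> refuted g \<and> g \<noteq> [] \<and> (0 = (0::nat) \<longrightarrow> g = [a])" using nr by blast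
  next
    fix g and n :: nat assume "\<not> refuted g \<and> g \<noteq> [] \<and> (n = 0 \<longrightarrow> g = [a])"
    then obtain j where "\<not> refuted (j # g)" using not_refuted by blast
    then show "\<exists>g'. (\<not> refuted g' \<and> g' \<noteq> [] \<and> (Suc n = 0 \<longrightarrow> g' = [a])) \<and> (\<exists>j. g' = j # g)" by blast
  qed
  then obtain g where g: "\<And>n. \<not> refuted (g n)" "\<And>n. g n \<noteq> []" "g 0 = [a]" "\<And>n. \<exists>j. g (Suc n) = j # g n" by metis
  define f where "f n = hd (g n)" for n
  have gS: "g (Suc n) = f (Suc n) # g n" for n using g(4)[of n] by (auto simp: f_def)
  have "A (pr (f n) (f (Suc n)))" for n
  proof -
    have t: "node_ok (cdl (g (Suc n)))" using not_refuted[OF g(1)] by blast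
    obtain ys where ys: "g n = f n # ys" using g(2)[of n] by (metis f_def list.exhaust_sel)
    have "cdl (g n) \<noteq> 0" using g(2)[of n] by (simp add: cdl_eq_0)
    then show ?thesis using t unfolding node_ok_def gS by (simp add: ys)
  qed
  moreover have "f 0 = a" using g(3) by (simp add: f_def)
  ultimately show "\<exists>f. f 0 = a \<and> (\<forall>n. A (pr (f n) (f (Suc n))))" by blast
next
  assume "\<exists>f. f 0 = a \<and> (\<forall>n. A (pr (f n) (f (Suc n))))"
  then obtain f where f: "f 0 = a" "\<And>n. A (pr (f n) (f (Suc n)))" by blast
  define g where "g = rec_nat [a] (\<lambda>n l. f (Suc n) # l)"
  have g: "g 0 = [a]" "\<And>n. g (Suc n) = f (Suc n) # g n" by (simp_all add: g_def)
  have hd: "\<exists>ys. g n = f n # ys" for n by (cases n) (simp_all add: g f(1))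
  have t: "node_ok (cdl (g n))" for n
  proof (cases n)
    case 0
    then show ?thesis by (simp add: g node_ok_def)
  next
    case (Suc k)
    obtain ys where "g k = f k # ys" using hd by blast
    then show ?thesis using f(2)[of k] by (simp add: Suc g node_ok_def)
  qed
  have "refuted l \<Longrightarrow> \<forall>n. l \<noteq> g n" for l
  proof (induction rule: refuted.induct)
    case (1 l)
    then show ?case using t g(2) by metis
  qed
  then show "\<not> refuted [a]" using g(1) by metis
qed

lemma prg_correct:
  assumes R: "St (cdl [a]) 1 R"
  shows "\<exists>R'. H 0 (cdl [a]) False (cfg b R) (cfg (b + aEND) R') \<and> (\<forall>r<v. R' r = \<rho> r) \<and>
    R' v = of_bool (\<exists>f. f 0 = a \<and> (\<forall>n. A (pr (f n) (f (Suc n)))))"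
proof (cases "refuted [a]")
  case True
  obtain R1 where R1: "H (cdl [a]) (cdl [a]) True (cfg b R) (cfg (b + aREF) R1)" "St (cdl [a]) 1 R1"
    using refuted_run[OF True _ R] by blast
  obtain R2 where R2: "H 0 (cdl [a]) False (cfg (b + aREF) R1) (cfg (b + aEND) R2)" "R2 v = 0" "\<forall>r<v. R2 r = \<rho> r"
    using not_found[OF R1(2)] .
  have "H 0 (cdl [a]) False (cfg b R) (cfg (b + aEND) R2)"
    using H_comp[OF R1(1) R2(1), of 0 "cdl [a]" False] by (simp del: cdl.simps)
  then show ?thesis using True R2 refuted_iff by auto
next
  case False
  have "\<exists>S. \<forall>n. (\<not> refuted (fst (S n)) \<and> n < length (fst (S n)) \<and> St (cdl (fst (S n))) 1 (snd (S n)) \<and> (n = 0 \<longrightarrow> S n = ([a], R)))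
      \<and> H (cdl (fst (S n))) (cdl (fst (S n))) True (cfg b (snd (S n))) (cfg b (snd (S (Suc n))))"
  proof (rule dependent_nat_choice)
    show "\<exists>S. \<not> refuted (fst S) \<and> 0 < length (fst S) \<and> St (cdl (fst S)) 1 (snd S) \<and> (0 = (0::nat) \<longrightarrow> S = ([a], R))"
      using False R by (intro exI[of _ "([a], R)"]) (simp del: cdl.simps)
  next
    fix S n assume S: "\<not> refuted (fst S) \<and> n < length (fst S) \<and> St (cdl (fst S)) 1 (snd S) \<and> (n = 0 \<longrightarrow> S = ([a], R))"
    then have "fst S \<noteq> []" by auto
    from not_refuted_run[OF conjunct1[OF S] this, of "snd S"] S
    obtain j R' where "\<not> refuted (j # fst S)" "H (cdl (fst S)) (cdl (fst S)) True (cfg b (snd S)) (cfg b R')" "St (cdl (j # fst S)) 1 R'"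
      by blast
    then show "\<exists>S'. (\<not> refuted (fst S') \<and> Suc n < length (fst S') \<and> St (cdl (fst S')) 1 (snd S') \<and> (Suc n = 0 \<longrightarrow> S' = ([a], R)))
      \<and> H (cdl (fst S)) (cdl (fst S)) True (cfg b (snd S)) (cfg b (snd S'))"
      using S by (intro exI[of _ "(j # fst S, R')"]) (simp del: cdl.simps)
  qed
  then obtain S where S: "\<And>n. n < length (fst (S n))" "\<And>n. St (cdl (fst (S n))) 1 (snd (S n))" "S 0 = ([a], R)"
    "\<And>n. H (cdl (fst (S n))) (cdl (fst (S n))) True (cfg b (snd (S n))) (cfg b (snd (S (Suc n))))" by blast
  \<comment> \<open>Nodes get longer along the branch and a code is at least the length of its list,
    so the node register tends to infinity and is reset to \<open>0\<close> at the limit.\<close>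
  have "n \<le> cdl (fst (S n))" for n using S(1)[of n] length_le_cdl[of "fst (S n)"] by linarith
  then obtain R1 where R1: "H 0 (cdl [a]) True (cfg b R) (cfg b R1)" "St 0 0 R1"
    using limit_esc[of "\<lambda>n. cdl (fst (S n))" "\<lambda>n. snd (S n)", OF S(2) S(4)] S(3) by (auto simp del: cdl.simps)
  obtain R2 where R2: "H 0 0 True (cfg b R1) (cfg (b + aEND) R2)" "R2 v = 1" "\<forall>r<v. R2 r = \<rho> r"
    using found[OF R1(2)] .
  have "H 0 (cdl [a]) False (cfg b R) (cfg (b + aEND) R2)"
    using H_comp[OF R1(1) R2(1), of 0 "cdl [a]" False] by (simp del: cdl.simps)
  then show ?thesis using False R2 refuted_iff by auto
qed

end

end

lemma computable_path:
  assumes A: "computable (\<lambda>x a. of_bool (A x a))"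
  shows "computable (\<lambda>x a. of_bool (\<exists>f. f 0 = a \<and> (\<forall>n. A x (pr (f n) (f (Suc n))))))"
  unfolding computable_def
proof (intro allI impI)
  fix v i :: nat assume i: "i < v"
  have "computable (\<lambda>x s. of_bool (\<not> (\<not> p2 s = 0 \<and> \<not> A x (pr (p1 (p2 s) - 1) (p1 s - 1)))))"
    by (intro computable_not computable_and computable_eq computable_p1 computable_p2 computable_id computable_const
        computable_comp[OF _ A] computable_pr computable_pred)
  then have "computable (\<lambda>x s. of_bool (p2 s = 0 \<or> A x (pr (p1 (p2 s) - 1) (p1 s - 1))))" by simp
  then obtain pT where T: "\<And>x R. hoare (v + 4) pT x R (\<lambda>R'. R' (v + 4) = of_bool (p2 (R v) = 0 \<or>
      A x (pr (p1 (p2 (R v)) - 1) (p1 (R v) - 1))))"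
    using computableE[of _ v "v + 4"] by auto
  have "computable (\<lambda>x s. pr 1 s)" by (intro computable_pr computable_const computable_id)
  then obtain pC where C: "\<And>x R. hoare (v + 4) pC x R (\<lambda>R'. R' (v + 4) = pr 1 (R v))"
    using computableE[of _ v "v + 4"] by auto
  have "computable (\<lambda>x s. pr (Suc (p1 s)) (p2 s))" by (intro computable_pr computable_Suc computable_p1 computable_p2 computable_id)
  then obtain pS where S: "\<And>x R. hoare (v + 4) pS x R (\<lambda>R'. R' (v + 4) = pr (Suc (p1 (R v))) (p2 (R v)))"
    using computableE[of _ v "v + 4"] by auto
  obtain pP where P: "\<And>x R. hoare (v + 5) pP x R (\<lambda>R'. R' (v + 5) = p2 (R v))"
    using computableE[OF computable_p2[OF computable_id], of v "v + 5"] by auto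
  \<comment> \<open>\<open>pr (Suc a) 0\<close> is \<open>cdl [a]\<close>, the root of the
    search.\<close>
  have "computable (\<lambda>x s. pr (Suc s) 0)" by (intro computable_pr computable_const computable_id computable_Suc)
  then obtain pI where I: "\<And>x R. hoare (v + 4) pI x R (\<lambda>R'. R' (v + 4) = pr (Suc (R i)) 0)"
    using computableE[of _ i "v + 4"] i by auto
  let ?L = "dfs.prg v pT pC pS pP"
  let ?p = "pI ;; [Copy (v + 4) v] ;; [Copy (v + 4) (v + 2)] ;; [Zero (v + 1)] ;; [Inc (v + 1)] ;; [Zero (v + 3)] ;; ?L"
  let ?E = "\<lambda>x a. \<exists>f. f 0 = a \<and> (\<forall>n. A x (pr (f n) (f (Suc n))))"
  have dfs: "dfs x v (A x) pT pC pS pP" for x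
    by (rule dfs.intro) (use T C S P in auto)
  have L: "hoare v ?L x R (\<lambda>R'. R' v = of_bool (?E x a))" if St: "dfs.St v R a (cdl [a]) 1 R" for x R a
    unfolding hoare_def
  proof (intro allI impI)
    fix Q b assume Q: "placed Q b ?L"
    interpret dfs Q x b v R a "A x" pT pC pS pP by (rule dfs)
    obtain R' m where G: "G (cfg b R) m (cfg (b + aEND) R')" and R': "\<forall>r<v. R' r = R r" "R' v = of_bool (?E x a)"
      using prg_correct[OF Q St] unfolding H_def by blast
    have "seg (stp Q x) (cfg b R) m (cfg (b + length ?L) R')" "b \<le> m 0" "\<forall>r<v. m (Suc r) = R r"
      using G unfolding G_def length_prg by simp_all
    then have "pseg Q x v b (cfg b R) (cfg (b + length ?L) R')"
      unfolding pseg_def using R'(1) by (intro exI[of _ m]) simp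
    then show "\<exists>R'. pseg Q x v b (cfg b R) (cfg (b + length ?L) R') \<and> R' v = of_bool (?E x a)"
      using R'(2) by blast
  qed
  have "hoare v ?p x R (\<lambda>R'. R' v = of_bool (?E x (R i)))" for x R
  proof (rule hoare_sq, rule hoare_conseq[OF I])
    fix R1 assume R1: "\<And>r. r < v \<Longrightarrow> R1 r = R r" "R1 (v + 4) = pr (Suc (R i)) 0"
    show "hoare v ([Copy (v + 4) v] ;; [Copy (v + 4) (v + 2)] ;; [Zero (v + 1)] ;; [Inc (v + 1)] ;; [Zero (v + 3)] ;; ?L)
        x R1 (\<lambda>R'. R' v = of_bool (?E x (R i)))"
      by (intro hoare_sq hoare_Copy hoare_Zero hoare_Inc L)
        (use R1 dfs.St_def[OF dfs] in auto)
  qed simp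
  then show "\<exists>p. \<forall>x R. hoare v p x R (\<lambda>R'. R' v = of_bool (?E x (R i)))" by blast
qed

section \<open>Classes of relations closed under infinite-path quantification\<close>

text \<open>A small syntax of substitutions that suffices for rearranging coded tuples and that the
  machine can compute.\<close>

inductive basic :: "(nat \<Rightarrow> nat) \<Rightarrow> bool" where
  basic_id: "basic (\<lambda>a. a)"
| basic_const: "basic (\<lambda>a. n)"
| basic_Suc: "basic f \<Longrightarrow> basic (\<lambda>a. Suc (f a))"
| basic_pred: "basic f \<Longrightarrow> basic (\<lambda>a. f a - 1)"
| basic_p1: "basic f \<Longrightarrow> basic (\<lambda>a. p1 (f a))"
| basic_p2: "basic f \<Longrightarrow> basic (\<lambda>a. p2 (f a))"
| basic_pr: "basic f \<Longrightarrow> basic g \<Longrightarrow> basic (\<lambda>a. pr (f a) (g a))"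

lemma basic_comp:
  assumes "basic g" "basic f"
  shows "basic (\<lambda>a. g (f a))"
  using assms(1) by (induction rule: basic.induct) (intro basic.intros assms(2); assumption)+

lemma pr_eqI: "p1 q = a \<Longrightarrow> p2 q = b \<Longrightarrow> q = pr a b"
  by auto

lemma basic_funpow: "basic f \<Longrightarrow> basic (\<lambda>a. (p2 ^^ n) (f a))"
  by (induction n) (auto intro: basic_p2)

locale path_class =
  fixes C :: "(nat set \<Rightarrow> nat \<Rightarrow> bool) \<Rightarrow> bool"
  assumes C_eq: "basic f \<Longrightarrow> basic g \<Longrightarrow> C (\<lambda>x a. f a = g a)"
    and C_mem: "basic f \<Longrightarrow> C (\<lambda>x a. f a \<in> x)"
    and C_not: "C A \<Longrightarrow> C (\<lambda>x a. \<not> A x a)"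
    and C_conj: "C A \<Longrightarrow> C B \<Longrightarrow> C (\<lambda>x a. A x a \<and> B x a)"
    and C_sub: "C A \<Longrightarrow> basic f \<Longrightarrow> C (\<lambda>x a. A x (f a))"
    and C_path: "C A \<Longrightarrow> C (\<lambda>x a. \<exists>f. f 0 = a \<and> (\<forall>n. A x (pr (f n) (f (Suc n)))))"
begin

lemma C_cong: "C A \<Longrightarrow> (\<And>x a. A x a \<longleftrightarrow> B x a) \<Longrightarrow> C B"
proof -
  assume "C A" and "\<And>x a. A x a \<longleftrightarrow> B x a"
  then have "A = B" by blast
  then show ?thesis using \<open>C A\<close> by simp
qed

lemma C_disj: "C A \<Longrightarrow> C B \<Longrightarrow> C (\<lambda>x a. A x a \<or> B x a)"
  by (rule C_cong[OF C_not[OF C_conj[OF C_not C_not]]]) auto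

lemma C_imp: "C A \<Longrightarrow> C B \<Longrightarrow> C (\<lambda>x a. A x a \<longrightarrow> B x a)"
  by (rule C_cong[OF C_disj[OF C_not]]) auto

lemma C_iff: "C A \<Longrightarrow> C B \<Longrightarrow> C (\<lambda>x a. A x a \<longleftrightarrow> B x a)"
  by (rule C_cong[OF C_conj[OF C_imp[of A B] C_imp[of B A]]]) auto

lemma C_const: "C (\<lambda>x a. c)"
proof (cases c)
  case True
  then show ?thesis using C_cong[OF C_eq[OF basic_id basic_id]] by simp
next
  case False
  then show ?thesis using C_cong[OF C_eq[OF basic_const[of 0] basic_const[of 1]]] by simp
qed

lemma C_path_from: "C (\<lambda>x p. A x (p1 p) (p2 p)) \<Longrightarrow> basic s \<Longrightarrow>
    C (\<lambda>x a. \<exists>f. f 0 = s a \<and> (\<forall>n. A x (f n) (f (Suc n))))"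
  using C_sub[OF C_path[of "\<lambda>x p. A x (p1 p) (p2 p)"]] by simp

text \<open>A path guesses \<open>k\<close> in its first step and afterwards can only stand still,
  which is allowed iff \<open>A x a k\<close>. The tags \<open>0\<close> and \<open>1\<close>
  separate the two phases.\<close>

lemma C_ex:
  assumes "C (\<lambda>x p. A x (p1 p) (p2 p))"
  shows "C (\<lambda>x a. \<exists>k. A x a k)"
proof -
  let ?D = "\<lambda>x u w. (p1 u = 0 \<and> p1 w = 1 \<and> p1 (p2 w) = p2 u) \<or>
    (p1 u = 1 \<and> w = u \<and> A x (p1 (p2 u)) (p2 (p2 u)))"
  have A: "C (\<lambda>x q. A x (p1 (p2 (p1 q))) (p2 (p2 (p1 q))))"
    using C_sub[OF assms, of "\<lambda>q. p2 (p1 q)"] by (simp add: basic.intros)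
  have "C (\<lambda>x q. ?D x (p1 q) (p2 q))"
    by (intro C_disj C_conj C_eq A basic.intros)
  then have "C (\<lambda>x a. \<exists>f. f 0 = pr 0 a \<and> (\<forall>n. ?D x (f n) (f (Suc n))))"
    by (rule C_path_from) (intro basic.intros)
  then show ?thesis
  proof (rule C_cong)
    fix x a
    show "(\<exists>f. f 0 = pr 0 a \<and> (\<forall>n. ?D x (f n) (f (Suc n)))) \<longleftrightarrow> (\<exists>k. A x a k)"
    proof
      assume "\<exists>f. f 0 = pr 0 a \<and> (\<forall>n. ?D x (f n) (f (Suc n)))"
      then obtain f where f: "f 0 = pr 0 a" "\<And>n. ?D x (f n) (f (Suc n))" by blast
      have "p1 (f 1) = 1" "p1 (p2 (f 1)) = a" using f(2)[of 0] f(1) by auto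
      then show "\<exists>k. A x a k" using f(2)[of 1] by auto
    next
      assume "\<exists>k. A x a k"
      then obtain k where "A x a k" by blast
      then show "\<exists>f. f 0 = pr 0 a \<and> (\<forall>n. ?D x (f n) (f (Suc n)))"
        by (intro exI[of _ "\<lambda>n. if n = 0 then pr 0 a else pr 1 (pr a k)"]) auto
    qed
  qed
qed

lemma C_all: "C (\<lambda>x p. A x (p1 p) (p2 p)) \<Longrightarrow> C (\<lambda>x a. \<forall>k. A x a k)"
  by (rule C_cong[OF C_not[OF C_ex[of "\<lambda>x a k. \<not> A x a k"]]]) (auto intro: C_not)

text \<open>The path counts both numbers down together, requires the second to be nonzero
  throughout, and stands still once the first has reached \<open>0\<close>.\<close>

lemma C_less:
  assumes "basic f" "basic g"
  shows "C (\<lambda>x a. f a < g a)"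
proof -
  let ?D = "\<lambda>x u w. p2 u \<noteq> 0 \<and> ((p1 u = 0 \<and> w = u) \<or> (p1 u \<noteq> 0 \<and> w = pr (p1 u - 1) (p2 u - 1)))"
  have "C (\<lambda>x q. ?D x (p1 q) (p2 q))"
    by (intro C_disj C_conj C_eq C_not basic.intros)
  then have "C (\<lambda>x a. \<exists>h. h 0 = pr (f a) (g a) \<and> (\<forall>n. ?D x (h n) (h (Suc n))))"
    by (rule C_path_from) (intro basic.intros assms)
  then show ?thesis
  proof (rule C_cong)
    fix x a
    have 1: "k < l" if "h 0 = pr k l" "\<And>n. ?D x (h n) (h (Suc n))" for h :: "nat \<Rightarrow> nat" and k l
      using that
    proof (induction k arbitrary: h l)
      case 0
      then show ?case using 0(2)[of 0] by simp
    next
      case (Suc k)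
      have "h (Suc 0) = pr k (l - 1)" "l \<noteq> 0" using Suc.prems(2)[of 0] Suc.prems(1) by auto
      then have "k < l - 1" using Suc.IH[of "\<lambda>n. h (Suc n)" "l - 1"] Suc.prems(2) by auto
      then show ?case by simp
    qed
    have 2: "\<exists>h. h 0 = pr k l \<and> (\<forall>n. ?D x (h n) (h (Suc n)))" if "k < l" for k l
      using that by (intro exI[of _ "\<lambda>n. pr (k - n) (l - min n k)"]) (auto simp: min_def)
    show "(\<exists>h. h 0 = pr (f a) (g a) \<and> (\<forall>n. ?D x (h n) (h (Suc n)))) \<longleftrightarrow> f a < g a"
      using 1 2 by blast
  qed
qed

text \<open>Search for \<open>p1 u\<close> in the list coded by \<open>p2 u\<close>: stand still
  when it is the head, otherwise drop the head. The path dies at the empty list, so success is again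
  the existence of an infinite path.\<close>

definition scstep :: "nat \<Rightarrow> nat \<Rightarrow> bool" where
  "scstep u w \<longleftrightarrow> p2 u \<noteq> 0 \<and> ((p1 (p2 u) = Suc (p1 u) \<and> w = u) \<or>
     (p1 (p2 u) \<noteq> Suc (p1 u) \<and> w = pr (p1 u) (p2 (p2 u))))"

definition scan :: "nat \<Rightarrow> nat \<Rightarrow> bool" where
  "scan e s \<longleftrightarrow> (\<exists>h. h 0 = pr e s \<and> (\<forall>n. scstep (h n) (h (Suc n))))"

lemma scan_Nil: "\<not> scan e 0"
  unfolding scan_def scstep_def by (metis prod_encode_inverse snd_conv)

lemma scan_Cons: "scan e (cdl (y # l)) \<longleftrightarrow> e = y \<or> scan e (cdl l)"
proof -
  have n0: "cdl (y # l) \<noteq> 0" by (simp only: cdl_eq_0) simp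
  show ?thesis
  proof (cases "e = y")
    case True
    have "scan e (cdl (y # l))" unfolding scan_def scstep_def using True n0
      by (intro exI[of _ "\<lambda>n. pr e (cdl (y # l))"]) simp
    then show ?thesis using True by simp
  next
    case False
    show ?thesis
    proof
      assume "scan e (cdl (y # l))"
      then obtain h where h: "h 0 = pr e (cdl (y # l))" "\<And>n. scstep (h n) (h (Suc n))" unfolding scan_def by blast
      have "h (Suc 0) = pr e (cdl l)" using h(2)[of 0] h(1) False by (simp add: scstep_def)
      then have "scan e (cdl l)" unfolding scan_def using h(2) by (intro exI[of _ "\<lambda>n. h (Suc n)"]) blast
      then show "e = y \<or> scan e (cdl l)" by simp
    next
      assume "e = y \<or> scan e (cdl l)"
      then obtain h where h: "h 0 = pr e (cdl l)" "\<And>n. scstep (h n) (h (Suc n))"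
        using False unfolding scan_def by blast
      have "scstep (pr e (cdl (y # l))) (h 0)" using h(1) False n0 by (simp add: scstep_def)
      then show "scan e (cdl (y # l))" unfolding scan_def using h(2)
        by (intro exI[of _ "\<lambda>n. case n of 0 \<Rightarrow> pr e (cdl (y # l)) | Suc n \<Rightarrow> h n"]) (simp split: nat.split)
    qed
  qed
qed

lemma scan_cdl: "scan e (cdl l) \<longleftrightarrow> e \<in> set l"
  by (induction l) (simp_all add: scan_Nil scan_Cons del: cdl.simps(2))

lemma C_scan: assumes "basic f" "basic g" shows "C (\<lambda>x a. scan (f a) (g a))"
  unfolding scan_def
proof (rule C_path_from[where A = "\<lambda>x. scstep" and s = "\<lambda>a. pr (f a) (g a)"])
  show "C (\<lambda>x p. scstep (p1 p) (p2 p))"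
    unfolding scstep_def by (intro C_disj C_conj C_eq C_not basic.intros)
qed (intro basic.intros assms)

text \<open>The path lists longer and longer initial parts of the graph of \<open>g\<close> and
  checks \<open>B\<close> for all choices of entries listed so far. Five is the number of values
  that \<open>sim_check\<close> inspects at once.\<close>

lemma C_so:
  assumes "C (\<lambda>x p. B x (p1 p) (p1 (p2 p)) (p1 (p2 (p2 p))) (p1 (p2 (p2 (p2 p))))
    (p1 (p2 (p2 (p2 (p2 p))))) (p2 (p2 (p2 (p2 (p2 p))))))"
  shows "C (\<lambda>x a. \<exists>g. \<forall>k1 k2 k3 k4 k5. B x a (pr k1 (g k1)) (pr k2 (g k2)) (pr k3 (g k3))
    (pr k4 (g k4)) (pr k5 (g k5)))"
proof -
  let ?ok = "\<lambda>x u. \<forall>e1 e2 e3 e4 e5. scan e1 (p2 u) \<and> scan e2 (p2 u) \<and> scan e3 (p2 u) \<and>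
    scan e4 (p2 u) \<and> scan e5 (p2 u) \<longrightarrow> B x (p1 (p1 u)) e1 e2 e3 e4 e5"
  let ?D = "\<lambda>x u w. p1 (p1 w) = p1 (p1 u) \<and> p2 (p1 w) = Suc (p2 (p1 u)) \<and> p2 (p2 w) = p2 u \<and>
    p1 (p2 w) \<noteq> 0 \<and> p1 (p1 (p2 w) - 1) = p2 (p1 u) \<and> ?ok x u"
  have sub: "C (\<lambda>x p. B x (f0 p) (f1 p) (f2 p) (f3 p) (f4 p) (f5 p))"
    if "basic f0" "basic f1" "basic f2" "basic f3" "basic f4" "basic f5" for f0 f1 f2 f3 f4 f5
    using C_sub[OF assms, of "\<lambda>p. pr (f0 p) (pr (f1 p) (pr (f2 p) (pr (f3 p) (pr (f4 p) (f5 p)))))"] that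
    by (simp add: basic.intros)
  have "C (\<lambda>x q. ?D x (p1 q) (p2 q))"
    by (intro C_conj C_not C_eq C_all C_imp C_scan sub basic.intros)
  then have "C (\<lambda>x a. \<exists>h. h 0 = pr (pr a 0) 0 \<and> (\<forall>n. ?D x (h n) (h (Suc n))))"
    by (rule C_path_from) (intro basic.intros)
  then show ?thesis
  proof (rule C_cong)
    fix x a
    show "(\<exists>h. h 0 = pr (pr a 0) 0 \<and> (\<forall>n. ?D x (h n) (h (Suc n)))) \<longleftrightarrow>
      (\<exists>g. \<forall>k1 k2 k3 k4 k5. B x a (pr k1 (g k1)) (pr k2 (g k2)) (pr k3 (g k3)) (pr k4 (g k4)) (pr k5 (g k5)))"
    proof
      assume "\<exists>h. h 0 = pr (pr a 0) 0 \<and> (\<forall>n. ?D x (h n) (h (Suc n)))"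
      then obtain h where h: "h 0 = pr (pr a 0) 0" "\<And>n. ?D x (h n) (h (Suc n))" by blast
      define g where "g k = p2 (p1 (p2 (h (Suc k))) - 1)" for k
      have hn: "h n = pr (pr a n) (cdl (rev (map (\<lambda>k. pr k (g k)) [0..<n])))" for n
      proof (induction n)
        case 0
        then show ?case using h(1) by simp
      next
        case (Suc n)
        let ?w = "h (Suc n)"
        have "?D x (h n) ?w" by (rule h(2))
        then have d: "p1 (p1 ?w) = p1 (p1 (h n))" "p2 (p1 ?w) = Suc (p2 (p1 (h n)))" "p2 (p2 ?w) = p2 (h n)"
          "p1 (p2 ?w) \<noteq> 0" "p1 (p1 (p2 ?w) - 1) = p2 (p1 (h n))" by blast+
        have pe: "q = pr (p1 q) (p2 q)" for q by simp
        have 1: "p1 ?w = pr a (Suc n)" using pe[of "p1 ?w"] d(1,2) Suc by simp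
        have "p1 (p2 ?w) - 1 = pr n (g n)" using d(5) Suc unfolding g_def by (intro pr_eqI) simp_all
        then have 2: "p1 (p2 ?w) = Suc (pr n (g n))" using d(4) by linarith
        have "p2 ?w = cdl (rev (map (\<lambda>k. pr k (g k)) [0..<Suc n]))"
          using pe[of "p2 ?w"] 2 d(3) Suc by simp
        then show ?case using 1 pe[of ?w] by simp
      qed
      have "B x a (pr k1 (g k1)) (pr k2 (g k2)) (pr k3 (g k3)) (pr k4 (g k4)) (pr k5 (g k5))" for k1 k2 k3 k4 k5
      proof -
        define N where "N = Suc (max k1 (max k2 (max k3 (max k4 k5))))"
        have N: "k1 < N" "k2 < N" "k3 < N" "k4 < N" "k5 < N" unfolding N_def by auto
        have "scan (pr k (g k)) (p2 (h N))" if "k < N" for k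
          unfolding hn[of N] using that by (auto simp: scan_cdl)
        moreover have "p1 (p1 (h N)) = a" by (simp add: hn)
        ultimately show ?thesis using h(2)[of N] N by metis
      qed
      then show "\<exists>g. \<forall>k1 k2 k3 k4 k5. B x a (pr k1 (g k1)) (pr k2 (g k2)) (pr k3 (g k3)) (pr k4 (g k4)) (pr k5 (g k5))"
        by blast
    next
      assume "\<exists>g. \<forall>k1 k2 k3 k4 k5. B x a (pr k1 (g k1)) (pr k2 (g k2)) (pr k3 (g k3)) (pr k4 (g k4)) (pr k5 (g k5))"
      then obtain g where g: "\<And>k1 k2 k3 k4 k5. B x a (pr k1 (g k1)) (pr k2 (g k2)) (pr k3 (g k3)) (pr k4 (g k4)) (pr k5 (g k5))"
        by blast
      define h where "h n = pr (pr a n) (cdl (rev (map (\<lambda>k. pr k (g k)) [0..<n])))" for n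
      have sc: "\<exists>k. e = pr k (g k)" if "scan e (p2 (h n))" for e n
        using that by (auto simp: h_def scan_cdl)
      have ok: "?ok x (h n)" for n
      proof (intro allI impI)
        fix e1 e2 e3 e4 e5
        assume "scan e1 (p2 (h n)) \<and> scan e2 (p2 (h n)) \<and> scan e3 (p2 (h n)) \<and>
          scan e4 (p2 (h n)) \<and> scan e5 (p2 (h n))"
        then obtain k1 k2 k3 k4 k5 where "e1 = pr k1 (g k1)" "e2 = pr k2 (g k2)" "e3 = pr k3 (g k3)"
          "e4 = pr k4 (g k4)" "e5 = pr k5 (g k5)" using sc by meson
        then show "B x (p1 (p1 (h n))) e1 e2 e3 e4 e5" using g by (simp add: h_def)
      qed
      have "?D x (h n) (h (Suc n))" for n
        using ok[of n] by (simp add: h_def)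
      moreover have "h 0 = pr (pr a 0) 0" by (simp add: h_def)
      ultimately show "\<exists>h. h 0 = pr (pr a 0) 0 \<and> (\<forall>n. ?D x (h n) (h (Suc n)))" by blast
    qed
  qed
qed

lemmas C_intros = C_eq C_less C_conj C_disj C_imp C_iff C_not C_ex C_all basic.intros

end

section \<open>Relations decided by total machines\<close>

definition dec :: "(nat set \<Rightarrow> nat \<Rightarrow> bool) \<Rightarrow> bool" where
  "dec A \<longleftrightarrow> computable (\<lambda>x a. of_bool (A x a))"

lemma computable_bas: "basic f \<Longrightarrow> computable (\<lambda>x a. f a)"
  by (induction rule: basic.induct)
    (intro computable_id computable_const computable_Suc computable_pred computable_p1 computable_p2 computable_pr; assumption)+

interpretation dec: path_class dec
proof
  show "basic f \<Longrightarrow> basic g \<Longrightarrow> dec (\<lambda>x a. f a = g a)" for f g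
    unfolding dec_def by (intro computable_eq computable_bas)
  show "basic f \<Longrightarrow> dec (\<lambda>x a. f a \<in> x)" for f
    unfolding dec_def by (intro computable_mem computable_bas)
  show "dec A \<Longrightarrow> dec (\<lambda>x a. \<not> A x a)" for A
    unfolding dec_def by (rule computable_not)
  show "dec A \<Longrightarrow> dec B \<Longrightarrow> dec (\<lambda>x a. A x a \<and> B x a)" for A B
    unfolding dec_def by (rule computable_and)
  show "dec A \<Longrightarrow> basic f \<Longrightarrow> dec (\<lambda>x a. A x (f a))" for A f
    unfolding dec_def by (rule computable_comp[OF computable_bas])
  show "dec A \<Longrightarrow> dec (\<lambda>x a. \<exists>f. f 0 = a \<and> (\<forall>n. A x (pr (f n) (f (Suc n)))))" for A
    unfolding dec_def by (rule computable_path)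
qed

lemma dec_decidable:
  assumes "dec (\<lambda>x a. A x)"
  shows "ITRM_decidable {x. A x}"
proof -
  obtain p where p: "\<And>x R. hoare 1 p x R (\<lambda>R'. R' 1 = of_bool (A x))"
    using computableE[OF assms[unfolded dec_def], of 0 1] by auto
  let ?p = "p ;; [Copy 1 0]"
  have h: "hoare 0 ?p x R (\<lambda>R'. R' 0 = of_bool (A x))" for x R
    by (rule hoare_sq, rule hoare_conseq[OF p]) (auto intro!: hoare_Copy)
  have "halts_with ?p x (of_bool (A x))" for x
  proof -
    have "shiftI 0 I = I" for I by (cases I) auto
    then have "placed ?p 0 ?p" by (auto simp: pl_def)
    then obtain R' m where "seg (stp ?p x) (cfg 0 (\<lambda>_. 0)) m (cfg (0 + length ?p) R')" "R' 0 = of_bool (A x)"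
      using h unfolding hoare_def pseg_def by blast
    moreover have "cfg 0 (\<lambda>_. 0) = (\<lambda>_. 0)" by (auto split: nat.split)
    ultimately obtain t where "run (stp ?p x) (\<lambda>_. 0) t = cfg (length ?p) R'"
      using seg_run[of "stp ?p x" "\<lambda>_. 0" m "cfg (length ?p) R'" "\<lambda>_. 0" z0] by auto
    then show ?thesis unfolding halts_with_iff using \<open>R' 0 = of_bool (A x)\<close> by (intro exI[of _ t]) simp
  qed
  then show ?thesis unfolding ITRM_decidable_def
    by (intro exI[of _ ?p] allI) (metis mem_Collect_eq of_bool_eq(1,2))
qed

section \<open>Sets of reals defined by the absence of infinite paths\<close>

text \<open>Literals about a real. Tag \<open>0\<close> is always true and serves as padding,
  \<open>1\<close> asserts membership and \<open>2\<close> denies it.\<close>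

definition lit :: "nat set \<Rightarrow> nat \<Rightarrow> bool" where
  "lit z l \<longleftrightarrow> p1 l = 0 \<or> (p1 l = 1 \<and> p2 l \<in> z) \<or> (p1 l = 2 \<and> p2 l \<notin> z)"

text \<open>The first component of a node carries three literals, as many as are needed to compare a
  conjunction with both of its parts. The second component is free for other data.\<close>

definition lits :: "nat set \<Rightarrow> nat \<Rightarrow> bool" where
  "lits z i \<longleftrightarrow> lit z (p1 (p1 i)) \<and> lit z (p1 (p2 (p1 i))) \<and> lit z (p2 (p2 (p1 i)))"

lemma lit_simps [simp]: "lit z 0" "lit z (pr (Suc 0) q) \<longleftrightarrow> q \<in> z" "lit z (pr 2 q) \<longleftrightarrow> q \<notin> z"
  by (simp_all add: lit_def) (metis fst_conv le_zero_eq le_prod_encode_1 prod.collapse prod_decode_inverse)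

lemma lits_pr: "lits z (pr (pr a (pr b c)) s) \<longleftrightarrow> lit z a \<and> lit z b \<and> lit z c"
  by (simp add: lits_def)

text \<open>An effective form of co-analyticity: the edge relation \<open>D\<close> does not depend
  on the real \<open>z\<close> and is ITRM-decidable, while \<open>z\<close> enters only by deleting
  nodes whose literals it violates. Each node hence depends on finitely many bits of
  \<open>z\<close>.\<close>

definition coanalytic :: "nat set set \<Rightarrow> bool" where
  "coanalytic Z \<longleftrightarrow> (\<exists>D. dec (\<lambda>x. D) \<and>
     (\<forall>z. z \<in> Z \<longleftrightarrow> \<not> (\<exists>f. \<forall>n. D (pr (f n) (f (Suc n))) \<and> lits z (f n))))"

lemma coanalyticI:
  assumes "dec (\<lambda>x p. D (p1 p) (p2 p))"
    and "\<And>z. z \<in> Z \<longleftrightarrow> \<not> (\<exists>f. \<forall>n. D (f n) (f (Suc n)) \<and> lits z (f n))"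
  shows "coanalytic Z"
  unfolding coanalytic_def using assms by (intro exI[of _ "\<lambda>p. D (p1 p) (p2 p)"]) simp

lemma coanalyticE:
  assumes "coanalytic Z"
  obtains D where "\<And>f g. basic f \<Longrightarrow> basic g \<Longrightarrow> dec (\<lambda>x p. D (f p) (g p))"
    "\<And>z. z \<in> Z \<longleftrightarrow> \<not> (\<exists>f. \<forall>n. D (f n) (f (Suc n)) \<and> lits z (f n))"
proof -
  obtain D where D: "dec (\<lambda>x. D)" "\<And>z. z \<in> Z \<longleftrightarrow> \<not> (\<exists>f. \<forall>n. D (pr (f n) (f (Suc n))) \<and> lits z (f n))"
    using assms unfolding coanalytic_def by blast
  show thesis
  proof (rule that[of "\<lambda>u w. D (pr u w)"])
    show "dec (\<lambda>x p. D (pr (f p) (g p)))" if "basic f" "basic g" for f g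
      using dec.C_sub[OF D(1) basic_pr[OF that]] .
  qed (rule D(2))
qed

text \<open>The disjoint union of the two graphs. A tag in the second component, constant along
  paths, tells the copies apart; \<open>?u\<close> removes it and leaves the literals alone.\<close>

lemma coanalytic_Int:
  assumes "coanalytic Z1" "coanalytic Z2"
  shows "coanalytic (Z1 \<inter> Z2)"
proof -
  obtain D1 where D1: "\<And>f g. basic f \<Longrightarrow> basic g \<Longrightarrow> dec (\<lambda>x p. D1 (f p) (g p))"
    "\<And>z. z \<in> Z1 \<longleftrightarrow> \<not> (\<exists>f. \<forall>n. D1 (f n) (f (Suc n)) \<and> lits z (f n))" using coanalyticE[OF assms(1)] by blast
  obtain D2 where D2: "\<And>f g. basic f \<Longrightarrow> basic g \<Longrightarrow> dec (\<lambda>x p. D2 (f p) (g p))"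
    "\<And>z. z \<in> Z2 \<longleftrightarrow> \<not> (\<exists>f. \<forall>n. D2 (f n) (f (Suc n)) \<and> lits z (f n))" using coanalyticE[OF assms(2)] by blast
  let ?u = "\<lambda>i. pr (p1 i) (p2 (p2 i))"
  let ?D = "\<lambda>i j. p1 (p2 i) = p1 (p2 j) \<and>
    ((p1 (p2 i) = 0 \<and> D1 (?u i) (?u j)) \<or> (p1 (p2 i) \<noteq> 0 \<and> D2 (?u i) (?u j)))"
  show ?thesis
  proof (rule coanalyticI[of ?D])
    show "dec (\<lambda>x p. ?D (p1 p) (p2 p))"
      by (intro dec.C_intros D1(1) D2(1))
    fix z
    have u: "lits z (?u i) = lits z i" for i by (simp add: lits_def)
    show "z \<in> Z1 \<inter> Z2 \<longleftrightarrow> \<not> (\<exists>f. \<forall>n. ?D (f n) (f (Suc n)) \<and> lits z (f n))"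
    proof
      assume z: "z \<in> Z1 \<inter> Z2"
      show "\<not> (\<exists>f. \<forall>n. ?D (f n) (f (Suc n)) \<and> lits z (f n))"
      proof
        assume "\<exists>f. \<forall>n. ?D (f n) (f (Suc n)) \<and> lits z (f n)"
        then obtain f where f: "\<And>n. ?D (f n) (f (Suc n))" "\<And>n. lits z (f n)" by blast
        have t: "p1 (p2 (f n)) = p1 (p2 (f 0))" for n by (induction n) (use f(1) in auto)
        let ?g = "\<lambda>n. ?u (f n)"
        show False
        proof (cases "p1 (p2 (f 0)) = 0")
          case True
          then have "D1 (?g n) (?g (Suc n)) \<and> lits z (?g n)" for n
            using f(1)[of n] f(2)[of n] t[of n] u by simp
          then have "\<exists>g. \<forall>n. D1 (g n) (g (Suc n)) \<and> lits z (g n)" by (intro exI[of _ ?g]) blast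
          then show False using z D1(2) by blast
        next
          case False
          then have "D2 (?g n) (?g (Suc n)) \<and> lits z (?g n)" for n
            using f(1)[of n] f(2)[of n] t[of n] u by simp
          then have "\<exists>g. \<forall>n. D2 (g n) (g (Suc n)) \<and> lits z (g n)" by (intro exI[of _ ?g]) blast
          then show False using z D2(2) by blast
        qed
      qed
    next
      assume n: "\<not> (\<exists>f. \<forall>n. ?D (f n) (f (Suc n)) \<and> lits z (f n))"
      have "z \<in> Z1"
      proof (rule ccontr)
        assume "z \<notin> Z1"
        then obtain g where g: "\<And>n. D1 (g n) (g (Suc n)) \<and> lits z (g n)" using D1(2) by blast
        have "\<forall>n. ?D (pr (p1 (g n)) (pr 0 (p2 (g n)))) (pr (p1 (g (Suc n))) (pr 0 (p2 (g (Suc n))))) \<and>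
           lits z (pr (p1 (g n)) (pr 0 (p2 (g n))))"
          using g by (simp add: lits_def)
        then show False using n[unfolded not_ex, rule_format, of "\<lambda>n. pr (p1 (g n)) (pr 0 (p2 (g n)))"] by blast
      qed
      moreover have "z \<in> Z2"
      proof (rule ccontr)
        assume "z \<notin> Z2"
        then obtain g where g: "\<And>n. D2 (g n) (g (Suc n)) \<and> lits z (g n)" using D2(2) by blast
        have "\<forall>n. ?D (pr (p1 (g n)) (pr 1 (p2 (g n)))) (pr (p1 (g (Suc n))) (pr 1 (p2 (g (Suc n))))) \<and>
           lits z (pr (p1 (g n)) (pr 1 (p2 (g n))))"
          using g by (simp add: lits_def)
        then show False using n[unfolded not_ex, rule_format, of "\<lambda>n. pr (p1 (g n)) (pr 1 (p2 (g n)))"] by blast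
      qed
      ultimately show "z \<in> Z1 \<inter> Z2" by blast
    qed
  qed
qed

definition sec :: "nat \<Rightarrow> nat set \<Rightarrow> nat set" where
  "sec k z = {a. pr k a \<in> z}"

text \<open>A literal about \<open>sec k z\<close> is a literal about \<open>z\<close> with
  \<open>k\<close> prefixed. \<open>?T\<close> and \<open>?S\<close> translate in the two
  directions, and \<open>?ok\<close> discards nodes that mention other sections.\<close>

lemma coanalytic_sec:
  assumes "coanalytic Z"
  shows "coanalytic {z. sec k z \<in> Z}"
proof -
  obtain D where D: "\<And>f g. basic f \<Longrightarrow> basic g \<Longrightarrow> dec (\<lambda>x p. D (f p) (g p))"
    "\<And>z. z \<in> Z \<longleftrightarrow> \<not> (\<exists>f. \<forall>n. D (f n) (f (Suc n)) \<and> lits z (f n))" using coanalyticE[OF assms] by blast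
  let ?v = "\<lambda>l. p1 l = 0 \<or> p1 (p2 l) = k"
  let ?t = "\<lambda>l. pr (p1 l) (p2 (p2 l))"
  let ?s = "\<lambda>l. pr (p1 l) (pr k (p2 l))"
  let ?ok = "\<lambda>i. ?v (p1 (p1 i)) \<and> ?v (p1 (p2 (p1 i))) \<and> ?v (p2 (p2 (p1 i)))"
  let ?T = "\<lambda>i. pr (pr (?t (p1 (p1 i))) (pr (?t (p1 (p2 (p1 i)))) (?t (p2 (p2 (p1 i)))))) (p2 i)"
  let ?S = "\<lambda>i. pr (pr (?s (p1 (p1 i))) (pr (?s (p1 (p2 (p1 i)))) (?s (p2 (p2 (p1 i)))))) (p2 i)"
  let ?D = "\<lambda>i j. ?ok i \<and> D (?T i) (?T j)"
  have v: "lit (sec k z) (?t l) = lit z l" if "?v l" for l z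
  proof -
    have "p1 l \<noteq> 0 \<Longrightarrow> pr k (p2 (p2 l)) = p2 l" using that by auto
    then show ?thesis by (auto simp: lit_def sec_def)
  qed
  have s: "lit z (?s l) = lit (sec k z) l" for l z by (simp add: lit_def sec_def)
  show ?thesis
  proof (rule coanalyticI[of ?D])
    show "dec (\<lambda>x p. ?D (p1 p) (p2 p))" by (intro dec.C_intros D(1))
    fix z
    show "z \<in> {z. sec k z \<in> Z} \<longleftrightarrow> \<not> (\<exists>f. \<forall>n. ?D (f n) (f (Suc n)) \<and> lits z (f n))"
    proof -
      have "(\<exists>f. \<forall>n. ?D (f n) (f (Suc n)) \<and> lits z (f n)) \<longleftrightarrow>
        (\<exists>f. \<forall>n. D (f n) (f (Suc n)) \<and> lits (sec k z) (f n))"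
      proof
        assume "\<exists>f. \<forall>n. ?D (f n) (f (Suc n)) \<and> lits z (f n)"
        then obtain f where f: "\<And>n. ?D (f n) (f (Suc n))" "\<And>n. lits z (f n)" by blast
        have "D (?T (f n)) (?T (f (Suc n))) \<and> lits (sec k z) (?T (f n))" for n
          using f(1)[of n] f(2)[of n] v unfolding lits_pr by (simp add: lits_def)
        then show "\<exists>f. \<forall>n. D (f n) (f (Suc n)) \<and> lits (sec k z) (f n)"
          by (intro exI[of _ "\<lambda>n. ?T (f n)"]) blast
      next
        assume "\<exists>f. \<forall>n. D (f n) (f (Suc n)) \<and> lits (sec k z) (f n)"
        then obtain f where f: "\<And>n. D (f n) (f (Suc n))" "\<And>n. lits (sec k z) (f n)" by blast
        have "?D (?S (f n)) (?S (f (Suc n))) \<and> lits z (?S (f n))" for n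
          using f(1)[of n] f(2)[of n] s unfolding lits_pr by (simp add: lits_def)
        then show "\<exists>f. \<forall>n. ?D (f n) (f (Suc n)) \<and> lits z (f n)"
          by (intro exI[of _ "\<lambda>n. ?S (f n)"]) blast
      qed
      then show ?thesis using D(2) by simp
    qed
  qed
qed

text \<open>A violation at \<open>a\<close> is turned into a node that carries \<open>a\<close> with
  its three literals and has only itself as successor.\<close>

lemma coanalytic_loc:
  assumes "basic l1" "basic l2" "basic l3" and G: "dec (\<lambda>x. G)"
  shows "coanalytic {z. \<forall>a. G a \<longrightarrow> \<not> (lit z (l1 a) \<and> lit z (l2 a) \<and> lit z (l3 a))}"
proof (rule coanalyticI[of "\<lambda>i j. j = i \<and> G (p2 i) \<and> p1 i = pr (l1 (p2 i)) (pr (l2 (p2 i)) (l3 (p2 i)))"])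
  have G': "dec (\<lambda>x p. G (f p))" if "basic f" for f using dec.C_sub[OF G that] .
  show "dec (\<lambda>x p. p2 p = p1 p \<and> G (p2 (p1 p)) \<and>
      p1 (p1 p) = pr (l1 (p2 (p1 p))) (pr (l2 (p2 (p1 p))) (l3 (p2 (p1 p)))))"
    by (intro dec.C_intros G' basic_comp[OF assms(1)] basic_comp[OF assms(2)] basic_comp[OF assms(3)])
  fix z
  have "(\<exists>f. \<forall>n. (f (Suc n) = f n \<and> G (p2 (f n)) \<and> p1 (f n) = pr (l1 (p2 (f n))) (pr (l2 (p2 (f n))) (l3 (p2 (f n)))))
    \<and> lits z (f n)) \<longleftrightarrow> (\<exists>a. G a \<and> lit z (l1 a) \<and> lit z (l2 a) \<and> lit z (l3 a))" (is "?A \<longleftrightarrow> ?B")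
  proof
    assume ?A
    then obtain f where "G (p2 (f 0))" "p1 (f 0) = pr (l1 (p2 (f 0))) (pr (l2 (p2 (f 0))) (l3 (p2 (f 0))))" "lits z (f 0)"
      by blast
    then show ?B by (auto simp: lits_def)
  next
    assume ?B
    then obtain a where "G a \<and> lit z (l1 a) \<and> lit z (l2 a) \<and> lit z (l3 a)" by blast
    then show ?A by (intro exI[of _ "\<lambda>n. pr (pr (l1 a) (pr (l2 a) (l3 a))) a"]) (simp add: lits_pr)
  qed
  then show "z \<in> {z. \<forall>a. G a \<longrightarrow> \<not> (lit z (l1 a) \<and> lit z (l2 a) \<and> lit z (l3 a))} \<longleftrightarrow>
    \<not> (\<exists>f. \<forall>n. (f (Suc n) = f n \<and> G (p2 (f n)) \<and> p1 (f n) = pr (l1 (p2 (f n))) (pr (l2 (p2 (f n))) (l3 (p2 (f n)))))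
    \<and> lits z (f n))" by blast
qed

text \<open>The literals belong to edges, so a node of the new graph stores an edge of the old one,
  and successive edges must fit together.\<close>

lemma coanalytic_no_path:
  assumes "basic l1" "basic l2"
  shows "coanalytic {z. \<not> (\<exists>f. \<forall>n. lit z (l1 (pr (f n) (f (Suc n)))) \<and> lit z (l2 (pr (f n) (f (Suc n)))))}"
proof (rule coanalyticI[of "\<lambda>i j. p1 i = pr (l1 (p2 i)) (pr (l2 (p2 i)) 0) \<and> p1 (p2 j) = p2 (p2 i)"])
  show "dec (\<lambda>x p. p1 (p1 p) = pr (l1 (p2 (p1 p))) (pr (l2 (p2 (p1 p))) 0) \<and> p1 (p2 (p2 p)) = p2 (p2 (p1 p)))"
    by (intro dec.C_intros basic_comp[OF assms(1)] basic_comp[OF assms(2)])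
  fix z
  have "(\<exists>f. \<forall>n. (p1 (f n) = pr (l1 (p2 (f n))) (pr (l2 (p2 (f n))) 0) \<and> p1 (p2 (f (Suc n))) = p2 (p2 (f n))) \<and> lits z (f n))
    \<longleftrightarrow> (\<exists>f. \<forall>n. lit z (l1 (pr (f n) (f (Suc n)))) \<and> lit z (l2 (pr (f n) (f (Suc n)))))" (is "?A \<longleftrightarrow> ?B")
  proof
    assume ?A
    then obtain f where f: "\<And>n. p1 (f n) = pr (l1 (p2 (f n))) (pr (l2 (p2 (f n))) 0)"
      "\<And>n. p1 (p2 (f (Suc n))) = p2 (p2 (f n))" "\<And>n. lits z (f n)" by blast
    let ?g = "\<lambda>n. p1 (p2 (f n))"
    have "p2 (f n) = pr (?g n) (?g (Suc n))" for n using f(2)[of n] by simp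
    then have "lit z (l1 (pr (?g n) (?g (Suc n)))) \<and> lit z (l2 (pr (?g n) (?g (Suc n))))" for n
      using f(1)[of n] f(3)[of n] by (simp add: lits_def)
    then show ?B by (intro exI[of _ ?g]) blast
  next
    assume ?B
    then obtain f where "\<And>n. lit z (l1 (pr (f n) (f (Suc n)))) \<and> lit z (l2 (pr (f n) (f (Suc n))))" by blast
    then show ?A
      by (intro exI[of _ "\<lambda>n. pr (pr (l1 (pr (f n) (f (Suc n)))) (pr (l2 (pr (f n) (f (Suc n)))) 0)) (pr (f n) (f (Suc n)))"])
        (simp add: lits_pr)
  qed
  then show "z \<in> {z. \<not> (\<exists>f. \<forall>n. lit z (l1 (pr (f n) (f (Suc n)))) \<and> lit z (l2 (pr (f n) (f (Suc n)))))} \<longleftrightarrow>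
    \<not> (\<exists>f. \<forall>n. (p1 (f n) = pr (l1 (p2 (f n))) (pr (l2 (p2 (f n))) 0) \<and> p1 (p2 (f (Suc n))) = p2 (p2 (f n))) \<and> lits z (f n))"
    by blast
qed

text \<open>A path may start anywhere, so the candidates \<open>b\<close> are decoded from a counter in such a way that each of
  them recurs infinitely often.\<close>

lemma coanalytic_ex:
  assumes "basic k" "basic l1" "basic l2"
  shows "coanalytic {z. \<forall>a. \<not> (lit z (k a) \<and> (\<forall>b. lit z (l1 (pr a b)) \<or> lit z (l2 (pr a b))))}"
proof (rule coanalyticI[of "\<lambda>i j. p1 (p2 j) = p1 (p2 i) \<and> p2 (p2 j) = Suc (p2 (p2 i)) \<and>
    (p1 i = pr (k (p1 (p2 i))) (pr (l1 (pr (p1 (p2 i)) (p1 (p2 (p2 i))))) 0) \<or>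
     p1 i = pr (k (p1 (p2 i))) (pr (l2 (pr (p1 (p2 i)) (p1 (p2 (p2 i))))) 0))"])
  let ?D = "\<lambda>i j. p1 (p2 j) = p1 (p2 i) \<and> p2 (p2 j) = Suc (p2 (p2 i)) \<and>
    (p1 i = pr (k (p1 (p2 i))) (pr (l1 (pr (p1 (p2 i)) (p1 (p2 (p2 i))))) 0) \<or>
     p1 i = pr (k (p1 (p2 i))) (pr (l2 (pr (p1 (p2 i)) (p1 (p2 (p2 i))))) 0))"
  show "dec (\<lambda>x p. ?D (p1 p) (p2 p))"
    by (intro dec.C_intros basic_comp[OF assms(1)] basic_comp[OF assms(2)] basic_comp[OF assms(3)])
  fix z
  have "(\<exists>f. \<forall>n. ?D (f n) (f (Suc n)) \<and> lits z (f n))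
    \<longleftrightarrow> (\<exists>a. lit z (k a) \<and> (\<forall>b. lit z (l1 (pr a b)) \<or> lit z (l2 (pr a b))))" (is "?A \<longleftrightarrow> ?B")
  proof
    assume ?A
    then obtain f where f: "\<And>n. ?D (f n) (f (Suc n))" "\<And>n. lits z (f n)" by blast
    define a where "a = p1 (p2 (f 0))"
    have a: "p1 (p2 (f n)) = a" for n by (induction n) (use f(1) in \<open>auto simp: a_def\<close>)
    define t where "t = p2 (p2 (f 0))"
    have t: "p2 (p2 (f n)) = t + n" for n by (induction n) (use f(1) in \<open>auto simp: t_def\<close>)
    have l: "lit z (k a) \<and> (lit z (l1 (pr a (p1 (t + n)))) \<or> lit z (l2 (pr a (p1 (t + n)))))" for n
      using f(1)[of n] f(2)[of n] unfolding a t by (auto simp: lits_def)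
    have "lit z (l1 (pr a b)) \<or> lit z (l2 (pr a b))" for b
    proof -
      \<comment> \<open>The counter may start at any \<open>t\<close>. The number
        \<open>pr b t\<close> is at least \<open>t\<close> and decodes to the candidate
        \<open>b\<close>, so every \<open>b\<close> is still met.\<close>
      have "t \<le> pr b t" by (rule le_prod_encode_2)
      then show ?thesis using l[of "pr b t - t"] by simp
    qed
    then show ?B using l by blast
  next
    assume ?B
    then obtain a where a: "lit z (k a)" "\<And>b. lit z (l1 (pr a b)) \<or> lit z (l2 (pr a b))" by blast
    let ?f = "\<lambda>n. pr (pr (k a) (pr (if lit z (l1 (pr a (p1 n))) then l1 (pr a (p1 n)) else l2 (pr a (p1 n))) 0)) (pr a n)"
    have "?D (?f n) (?f (Suc n)) \<and> lits z (?f n)" for n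
      using a by (auto simp: lits_pr)
    then show ?A by (intro exI[of _ ?f]) blast
  qed
  then show "z \<in> {z. \<forall>a. \<not> (lit z (k a) \<and> (\<forall>b. lit z (l1 (pr a b)) \<or> lit z (l2 (pr a b))))} \<longleftrightarrow>
    \<not> (\<exists>f. \<forall>n. ?D (f n) (f (Suc n)) \<and> lits z (f n))" by blast
qed

section \<open>Relations with uniquely determined certificates\<close>

text \<open>Section \<open>0\<close> of a certificate is the real it belongs to, and section \<open>1\<close> is the certified relation.\<close>

definition cert :: "(nat set \<Rightarrow> nat set) \<Rightarrow> bool" where
  "cert \<Psi> \<longleftrightarrow> dec (\<lambda>x a. a \<in> \<Psi> x) \<and> coanalytic (range \<Psi>) \<and> (\<forall>x. sec 0 (\<Psi> x) = x)"

definition certified :: "(nat set \<Rightarrow> nat \<Rightarrow> bool) \<Rightarrow> bool" where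
  "certified A \<longleftrightarrow> (\<exists>\<Psi>. cert \<Psi> \<and> (\<forall>x. sec 1 (\<Psi> x) = {a. A x a}))"

definition join :: "nat set \<Rightarrow> nat set \<Rightarrow> nat set \<Rightarrow> nat set \<Rightarrow> nat set" where
  "join x b y1 y2 = {c. (p1 c = 0 \<and> p2 c \<in> x) \<or> (p1 c = 1 \<and> p2 c \<in> b) \<or>
     (p1 c = 2 \<and> p2 c \<in> y1) \<or> (p1 c = 3 \<and> p2 c \<in> y2)}"

lemma sec_join [simp]: "sec 0 (join x b y1 y2) = x" "sec (Suc 0) (join x b y1 y2) = b"
    "sec 2 (join x b y1 y2) = y1" "sec 3 (join x b y1 y2) = y2"
  by (auto simp: sec_def join_def)

lemma join_sec:
  assumes "\<And>a. 4 \<le> p1 a \<Longrightarrow> a \<notin> z"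
  shows "z = join (sec 0 z) (sec 1 z) (sec 2 z) (sec 3 z)"
proof (rule set_eqI)
  fix c
  obtain k a where c: "c = pr k a" by (metis prod.collapse prod_decode_inverse)
  consider "p1 c = 0" | "p1 c = 1" | "p1 c = 2" | "p1 c = 3" | "4 \<le> p1 c" by linarith
  then show "c \<in> z \<longleftrightarrow> c \<in> join (sec 0 z) (sec 1 z) (sec 2 z) (sec 3 z)"
  proof cases
    case 5
    then show ?thesis using assms[of c] by (auto simp: join_def)
  qed (auto simp: join_def sec_def c)
qed

lemma coanalytic_cong: "coanalytic Z \<Longrightarrow> Z = Z' \<Longrightarrow> coanalytic Z'" by simp

lemma coanalytic_loc1: "basic l1 \<Longrightarrow> dec (\<lambda>x. G) \<Longrightarrow> coanalytic {z. \<forall>a. G a \<longrightarrow> \<not> lit z (l1 a)}"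
  by (rule coanalytic_cong[OF coanalytic_loc[OF _ basic_const[of 0] basic_const[of 0]]]) auto

lemma coanalytic_iff:
  assumes "basic f" "basic g"
  shows "coanalytic {z. \<forall>a. f a \<in> z \<longleftrightarrow> g a \<in> z}"
proof (rule coanalytic_cong[OF coanalytic_Int[OF
    coanalytic_loc[of "\<lambda>a. pr 1 (f a)" "\<lambda>a. pr 2 (g a)" "\<lambda>a. 0" "\<lambda>a. True"]
    coanalytic_loc[of "\<lambda>a. pr 2 (f a)" "\<lambda>a. pr 1 (g a)" "\<lambda>a. 0" "\<lambda>a. True"]]])
qed (auto intro!: basic.intros assms dec.C_const)

lemma coanalytic_iff_not:
  assumes "basic f" "basic g"
  shows "coanalytic {z. \<forall>a. f a \<in> z \<longleftrightarrow> g a \<notin> z}"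
proof (rule coanalytic_cong[OF coanalytic_Int[OF
    coanalytic_loc[of "\<lambda>a. pr 1 (f a)" "\<lambda>a. pr 1 (g a)" "\<lambda>a. 0" "\<lambda>a. True"]
    coanalytic_loc[of "\<lambda>a. pr 2 (f a)" "\<lambda>a. pr 2 (g a)" "\<lambda>a. 0" "\<lambda>a. True"]]])
qed (auto intro!: basic.intros assms dec.C_const)

text \<open>The new certificate keeps the certificates of the at most two relations from which
  \<open>A\<close> is built. It remains to give a co-analytic condition \<open>V\<close> that pins
  down section \<open>1\<close> once these are correct; correctness of \<open>A\<close> itself never
  has to be expressed as a co-analytic property of \<open>x\<close>.\<close>

lemma certifiedI:
  assumes \<Psi>1: "cert \<Psi>1" and \<Psi>2: "cert \<Psi>2" and A: "dec A" and V: "coanalytic V"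
    and VA: "\<And>x b. join x b (\<Psi>1 x) (\<Psi>2 x) \<in> V \<longleftrightarrow> b = {a. A x a}"
  shows "certified A"
proof -
  define \<Psi> where "\<Psi> x = join x {a. A x a} (\<Psi>1 x) (\<Psi>2 x)" for x
  have d1: "dec (\<lambda>x a. f a \<in> \<Psi>1 x)" and d2: "dec (\<lambda>x a. f a \<in> \<Psi>2 x)" and dA: "dec (\<lambda>x a. A x (f a))"
    if "basic f" for f
    using \<Psi>1 \<Psi>2 A that dec.C_sub[of "\<lambda>x a. a \<in> \<Psi>1 x"] dec.C_sub[of "\<lambda>x a. a \<in> \<Psi>2 x"] dec.C_sub[of A]
    unfolding cert_def by auto
  have "dec (\<lambda>x a. a \<in> \<Psi> x)"
    unfolding \<Psi>_def join_def mem_Collect_eq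
    by (intro dec.C_intros dec.C_mem d1 d2 dA)
  moreover have "coanalytic (range \<Psi>)"
  proof -
    \<comment> \<open>Besides \<open>V\<close>, sections \<open>2\<close> and \<open>3\<close> must
      be certificates, they must belong to the real in section \<open>0\<close>, and nothing may lie
      outside the four sections. This makes the certificate unique.\<close>
    let ?Z = "V \<inter> ({z. sec 2 z \<in> range \<Psi>1} \<inter> ({z. sec 3 z \<in> range \<Psi>2} \<inter>
      ({z. \<forall>a. pr 0 a \<in> z \<longleftrightarrow> pr 2 (pr 0 a) \<in> z} \<inter> ({z. \<forall>a. pr 0 a \<in> z \<longleftrightarrow> pr 3 (pr 0 a) \<in> z} \<inter>
       {z. \<forall>a. \<not> p1 a < 4 \<longrightarrow> \<not> lit z (pr 1 a)}))))"
    have r1: "coanalytic (range \<Psi>1)" "coanalytic (range \<Psi>2)" "\<And>x. sec 0 (\<Psi>1 x) = x" "\<And>x. sec 0 (\<Psi>2 x) = x"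
      using \<Psi>1 \<Psi>2 by (auto simp: cert_def)
    have "coanalytic ?Z"
      by (intro coanalytic_Int V coanalytic_sec r1(1,2) coanalytic_iff coanalytic_loc1 dec.C_intros)
    moreover have "?Z = range \<Psi>"
    proof
      show "range \<Psi> \<subseteq> ?Z"
      proof
        fix z assume "z \<in> range \<Psi>"
        then obtain x where z: "z = join x {a. A x a} (\<Psi>1 x) (\<Psi>2 x)" by (auto simp: \<Psi>_def)
        have "z \<in> V" using VA z by simp
        moreover have "pr 0 a \<in> z \<longleftrightarrow> pr 2 (pr 0 a) \<in> z" "pr 0 a \<in> z \<longleftrightarrow> pr 3 (pr 0 a) \<in> z" for a
          using r1(3)[of x] r1(4)[of x] by (auto simp: z join_def sec_def)
        moreover have "\<not> lit z (pr 1 a)" if "\<not> p1 a < 4" for a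
          using that by (auto simp: z join_def)
        ultimately show "z \<in> ?Z" by (auto simp: z)
      qed
      show "?Z \<subseteq> range \<Psi>"
      proof
        fix z assume z: "z \<in> ?Z"
        obtain x1 x2 where x: "sec 2 z = \<Psi>1 x1" "sec 3 z = \<Psi>2 x2" using z by auto
        have "sec 0 z = sec 0 (sec 2 z)" "sec 0 z = sec 0 (sec 3 z)" using z by (auto simp: sec_def)
        then have x': "x1 = sec 0 z" "x2 = sec 0 z" using x r1(3,4) by auto
        have "z = join (sec 0 z) (sec 1 z) (sec 2 z) (sec 3 z)"
          by (rule join_sec) (use z in auto)
        then have j: "z = join (sec 0 z) (sec 1 z) (\<Psi>1 (sec 0 z)) (\<Psi>2 (sec 0 z))" using x x' by simp
        then have "sec 1 z = {a. A (sec 0 z) a}" using VA[of "sec 0 z" "sec 1 z"] z by auto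
        then have "z = \<Psi> (sec 0 z)" using j unfolding \<Psi>_def by simp
        then show "z \<in> range \<Psi>" by blast
      qed
    qed
    ultimately show ?thesis by simp
  qed
  ultimately have "cert \<Psi>" by (simp add: cert_def \<Psi>_def)
  moreover have "sec 1 (\<Psi> x) = {a. A x a}" for x by (simp add: \<Psi>_def)
  ultimately show ?thesis unfolding certified_def by blast
qed

lemma certifiedE:
  assumes "certified A"
  obtains \<Psi> where "cert \<Psi>" "\<And>x a. pr 1 a \<in> \<Psi> x \<longleftrightarrow> A x a"
  using assms unfolding certified_def sec_def by blast

lemma certified_dec: "certified A \<Longrightarrow> dec A"
proof -
  assume "certified A"
  then obtain \<Psi> where \<Psi>: "cert \<Psi>" "\<And>x a. pr 1 a \<in> \<Psi> x \<longleftrightarrow> A x a" using certifiedE by blast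
  have "dec (\<lambda>x a. pr 1 a \<in> \<Psi> x)"
    using \<Psi>(1) dec.C_sub[OF _ basic_pr[OF basic_const[of 1] basic_id], of "\<lambda>x a. a \<in> \<Psi> x"] unfolding cert_def by blast
  then show "dec A" using \<Psi>(2) by simp
qed

definition cert0 :: "nat set \<Rightarrow> nat set" where "cert0 x = {c. p1 c = 0 \<and> p2 c \<in> x}"

lemma cert_cert0: "cert cert0"
proof -
  have "coanalytic {z. \<forall>a. p1 a \<noteq> 0 \<longrightarrow> \<not> lit z (pr 1 a)}"
    by (intro coanalytic_loc1 dec.C_intros)
  moreover have "{z. \<forall>a. p1 a \<noteq> 0 \<longrightarrow> \<not> lit z (pr 1 a)} = range cert0"
  proof (intro set_eqI iffI)
    fix z assume z: "z \<in> {z. \<forall>a. p1 a \<noteq> 0 \<longrightarrow> \<not> lit z (pr 1 a)}"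
    have "z = cert0 (sec 0 z)"
    proof (rule set_eqI)
      fix c
      obtain k a where c: "c = pr k a" by (metis prod.collapse prod_decode_inverse)
      show "c \<in> z \<longleftrightarrow> c \<in> cert0 (sec 0 z)" using z[unfolded mem_Collect_eq, rule_format, of "pr k a"]
        by (cases "k = 0") (auto simp: cert0_def sec_def c)
    qed
    then show "z \<in> range cert0" by blast
  qed (auto simp: cert0_def)
  ultimately have "coanalytic (range cert0)" by simp
  moreover have "dec (\<lambda>x a. a \<in> cert0 x)"
    unfolding cert0_def mem_Collect_eq by (intro dec.C_intros dec.C_mem)
  ultimately show ?thesis by (auto simp: cert_def cert0_def sec_def)
qed

interpretation certified: path_class certified
proof
  fix f g :: "nat \<Rightarrow> nat" assume fg: "basic f" "basic g"
  let ?V = "{z. \<forall>a. f a = g a \<longrightarrow> \<not> lit z (pr 2 (pr 1 a))} \<inter> {z. \<forall>a. f a \<noteq> g a \<longrightarrow> \<not> lit z (pr 1 (pr 1 a))}"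
  show "certified (\<lambda>x a. f a = g a)"
  proof (rule certifiedI[OF cert_cert0 cert_cert0, of _ ?V])
    show "dec (\<lambda>x a. f a = g a)" by (rule dec.C_eq[OF fg])
    show "coanalytic ?V" by (intro coanalytic_Int coanalytic_loc1 dec.C_not dec.C_eq basic.intros fg)
    show "join x b (cert0 x) (cert0 x) \<in> ?V \<longleftrightarrow> b = {a. f a = g a}" for x b
      by (auto simp: join_def)
  qed
next
  fix f :: "nat \<Rightarrow> nat" assume f: "basic f"
  show "certified (\<lambda>x a. f a \<in> x)"
  proof (rule certifiedI[OF cert_cert0 cert_cert0, of _ "{z. \<forall>a. pr 1 a \<in> z \<longleftrightarrow> pr 0 (f a) \<in> z}"])
    show "dec (\<lambda>x a. f a \<in> x)" by (rule dec.C_mem[OF f])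
    show "coanalytic {z. \<forall>a. pr 1 a \<in> z \<longleftrightarrow> pr 0 (f a) \<in> z}" by (intro coanalytic_iff basic.intros f)
    show "join x b (cert0 x) (cert0 x) \<in> {z. \<forall>a. pr 1 a \<in> z \<longleftrightarrow> pr 0 (f a) \<in> z} \<longleftrightarrow> b = {a. f a \<in> x}" for x b
      by (auto simp: join_def)
  qed
next
  fix A assume A: "certified A"
  obtain \<Psi> where \<Psi>: "cert \<Psi>" "\<And>x a. pr 1 a \<in> \<Psi> x \<longleftrightarrow> A x a" using certifiedE[OF A] by blast
  show "certified (\<lambda>x a. \<not> A x a)"
  proof (rule certifiedI[OF \<Psi>(1) \<Psi>(1), of _ "{z. \<forall>a. pr 1 a \<in> z \<longleftrightarrow> pr 2 (pr 1 a) \<notin> z}"])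
    show "dec (\<lambda>x a. \<not> A x a)" by (rule dec.C_not[OF certified_dec[OF A]])
    show "coanalytic {z. \<forall>a. pr 1 a \<in> z \<longleftrightarrow> pr 2 (pr 1 a) \<notin> z}" by (intro coanalytic_iff_not basic.intros)
    show "join x b (\<Psi> x) (\<Psi> x) \<in> {z. \<forall>a. pr 1 a \<in> z \<longleftrightarrow> pr 2 (pr 1 a) \<notin> z} \<longleftrightarrow> b = {a. \<not> A x a}" for x b
      using \<Psi>(2) by (auto simp: join_def)
  qed
  fix f :: "nat \<Rightarrow> nat" assume f: "basic f"
  show "certified (\<lambda>x a. A x (f a))"
  proof (rule certifiedI[OF \<Psi>(1) \<Psi>(1), of _ "{z. \<forall>a. pr 1 a \<in> z \<longleftrightarrow> pr 2 (pr 1 (f a)) \<in> z}"])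
    show "dec (\<lambda>x a. A x (f a))" by (rule dec.C_sub[OF certified_dec[OF A] f])
    show "coanalytic {z. \<forall>a. pr 1 a \<in> z \<longleftrightarrow> pr 2 (pr 1 (f a)) \<in> z}" by (intro coanalytic_iff basic.intros f)
    show "join x b (\<Psi> x) (\<Psi> x) \<in> {z. \<forall>a. pr 1 a \<in> z \<longleftrightarrow> pr 2 (pr 1 (f a)) \<in> z} \<longleftrightarrow> b = {a. A x (f a)}" for x b
      using \<Psi>(2) by (auto simp: join_def)
  qed
next
  fix A B assume A: "certified A" and B: "certified B"
  obtain \<Psi> where \<Psi>: "cert \<Psi>" "\<And>x a. pr 1 a \<in> \<Psi> x \<longleftrightarrow> A x a" using certifiedE[OF A] by blast
  obtain \<Psi>' where \<Psi>': "cert \<Psi>'" "\<And>x a. pr 1 a \<in> \<Psi>' x \<longleftrightarrow> B x a" using certifiedE[OF B] by blast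
  let ?V = "{z. \<forall>a. True \<longrightarrow> \<not> (lit z (pr 1 (pr 1 a)) \<and> lit z (pr 2 (pr 2 (pr 1 a))) \<and> lit z 0)} \<inter>
    ({z. \<forall>a. True \<longrightarrow> \<not> (lit z (pr 1 (pr 1 a)) \<and> lit z (pr 2 (pr 3 (pr 1 a))) \<and> lit z 0)} \<inter>
     {z. \<forall>a. True \<longrightarrow> \<not> (lit z (pr 2 (pr 1 a)) \<and> lit z (pr 1 (pr 2 (pr 1 a))) \<and> lit z (pr 1 (pr 3 (pr 1 a))))})"
  show "certified (\<lambda>x a. A x a \<and> B x a)"
  proof (rule certifiedI[OF \<Psi>(1) \<Psi>'(1), of _ ?V])
    show "dec (\<lambda>x a. A x a \<and> B x a)" by (rule dec.C_conj[OF certified_dec[OF A] certified_dec[OF B]])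
    show "coanalytic ?V" by (intro coanalytic_Int coanalytic_loc dec.C_const basic.intros)
    show "join x b (\<Psi> x) (\<Psi>' x) \<in> ?V \<longleftrightarrow> b = {a. A x a \<and> B x a}" for x b
      using \<Psi>(2) \<Psi>'(2) by (auto simp: join_def)
  qed
next
  fix A assume A: "certified A"
  obtain \<Psi> where \<Psi>: "cert \<Psi>" "\<And>x a. pr 1 a \<in> \<Psi> x \<longleftrightarrow> A x a" using certifiedE[OF A] by blast
  let ?E = "\<lambda>x a. \<exists>f. f 0 = a \<and> (\<forall>n. A x (pr (f n) (f (Suc n))))"
  \<comment> \<open>Three conditions characterize the set \<open>b\<close> of starting points of
    infinite paths. By \<open>?V1\<close> every point of \<open>b\<close> has an edge into
    \<open>b\<close>, so paths can be continued forever. By \<open>?V3\<close> predecessors of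
    points of \<open>b\<close> lie in \<open>b\<close>, so a path starting outside stays outside,
    and \<open>?V2\<close> excludes such a path.\<close>
  let ?V1 = "{z. \<forall>a. \<not> (lit z (pr 1 (pr 1 a)) \<and>
    (\<forall>b. lit z (pr 2 (pr 2 (pr 1 (pr a b)))) \<or> lit z (pr 2 (pr 1 (p2 (pr a b))))))}"
  let ?V2 = "{z. \<not> (\<exists>f. \<forall>n. lit z (pr 2 (pr 1 (p1 (pr (f n) (f (Suc n)))))) \<and>
    lit z (pr 1 (pr 2 (pr 1 (pr (f n) (f (Suc n)))))))}"
  let ?V3 = "{z. \<forall>a. True \<longrightarrow> \<not> (lit z (pr 1 (pr 2 (pr 1 a))) \<and> lit z (pr 1 (pr 1 (p2 a))) \<and> lit z (pr 2 (pr 1 (p1 a))))}"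
  show "certified ?E"
  proof (rule certifiedI[OF \<Psi>(1) \<Psi>(1), of _ "?V1 \<inter> (?V2 \<inter> ?V3)"])
    show "dec ?E" by (rule dec.C_path[OF certified_dec[OF A]])
    have "coanalytic ?V1" by (rule coanalytic_ex) (intro basic.intros)+
    moreover have "coanalytic ?V2" by (rule coanalytic_no_path) (intro basic.intros)+
    moreover have "coanalytic ?V3" by (intro coanalytic_loc dec.C_const basic.intros)
    ultimately show "coanalytic (?V1 \<inter> (?V2 \<inter> ?V3))" by (intro coanalytic_Int)
    fix x b
    let ?z = "join x b (\<Psi> x) (\<Psi> x)"
    have m: "pr 1 a \<in> ?z \<longleftrightarrow> a \<in> b" "pr 2 (pr 1 a) \<in> ?z \<longleftrightarrow> A x a" for a
      using \<Psi>(2) by (auto simp: join_def)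
    have V1: "?z \<in> ?V1 \<longleftrightarrow> (\<forall>a\<in>b. \<exists>c. A x (pr a c) \<and> c \<in> b)"
      using m by auto
    have V2: "?z \<in> ?V2 \<longleftrightarrow> \<not> (\<exists>f. \<forall>n. f n \<notin> b \<and> A x (pr (f n) (f (Suc n))))"
      using m by simp
    have V3: "?z \<in> ?V3 \<longleftrightarrow> (\<forall>a c. A x (pr a c) \<and> c \<in> b \<longrightarrow> a \<in> b)"
    proof -
      have "?z \<in> ?V3 \<longleftrightarrow> (\<forall>q. \<not> (A x q \<and> p2 q \<in> b \<and> p1 q \<notin> b))" using m by simp
      also have "\<dots> \<longleftrightarrow> (\<forall>a c. A x (pr a c) \<and> c \<in> b \<longrightarrow> a \<in> b)"
        by (metis fst_conv prod.collapse prod_decode_inverse prod_encode_inverse snd_conv)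
      finally show ?thesis .
    qed
    show "?z \<in> ?V1 \<inter> (?V2 \<inter> ?V3) \<longleftrightarrow> b = {a. ?E x a}"
    proof
      assume "?z \<in> ?V1 \<inter> (?V2 \<inter> ?V3)"
      then have 1: "\<And>a. a \<in> b \<Longrightarrow> \<exists>c. A x (pr a c) \<and> c \<in> b"
        and 2: "\<And>f. \<not> (\<forall>n. f n \<notin> b \<and> A x (pr (f n) (f (Suc n))))"
        and 3: "\<And>a c. A x (pr a c) \<Longrightarrow> c \<in> b \<Longrightarrow> a \<in> b" using V1 V2 V3 by blast+
      show "b = {a. ?E x a}"
      proof (intro set_eqI iffI)
        fix a assume a: "a \<in> b"
        have "\<exists>f. \<forall>n. (f n \<in> b \<and> (n = 0 \<longrightarrow> f n = a)) \<and> A x (pr (f n) (f (Suc n)))"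
        proof (rule dependent_nat_choice)
          show "\<exists>c. c \<in> b \<and> (0 = (0::nat) \<longrightarrow> c = a)" using a by blast
          fix c and n :: nat assume "c \<in> b \<and> (n = 0 \<longrightarrow> c = a)"
          then show "\<exists>d. (d \<in> b \<and> (Suc n = 0 \<longrightarrow> d = a)) \<and> A x (pr c d)" using 1[of c] by blast
        qed
        then show "a \<in> {a. ?E x a}" by blast
      next
        fix a assume "a \<in> {a. ?E x a}"
        then obtain f where f: "f 0 = a" "\<And>n. A x (pr (f n) (f (Suc n)))" by blast
        show "a \<in> b"
        proof (rule ccontr)
          assume "a \<notin> b"
          have "f n \<notin> b" for n by (induction n) (use f 3 \<open>a \<notin> b\<close> in blast)+
          then show False using 2[of f] f(2) by blast
        qed
      qed
    next
      assume b: "b = {a. ?E x a}"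
      have "\<exists>c. A x (pr a c) \<and> c \<in> b" if "a \<in> b" for a
      proof -
        have "?E x a" using that unfolding b mem_Collect_eq .
        then obtain f where "f 0 = a \<and> (\<forall>n. A x (pr (f n) (f (Suc n))))" ..
        then have f: "f 0 = a" "\<And>n. A x (pr (f n) (f (Suc n)))" by simp_all
        have "?E x (f 1)" using f(2) by (intro exI[of _ "\<lambda>n. f (Suc n)"]) simp
        then have "f 1 \<in> b" unfolding b mem_Collect_eq .
        then show ?thesis using f(1) f(2)[of 0] by (intro exI[of _ "f 1"]) simp
      qed
      moreover have "\<not> (\<forall>n. f n \<notin> b \<and> A x (pr (f n) (f (Suc n))))" for f
      proof
        assume a: "\<forall>n. f n \<notin> b \<and> A x (pr (f n) (f (Suc n)))"
        then have "?E x (f 0)" by blast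
        then have "f 0 \<in> b" unfolding b mem_Collect_eq .
        then show False using a by blast
      qed
      moreover have "a \<in> b" if "A x (pr a c)" "c \<in> b" for a c
      proof -
        have "?E x c" using that(2) unfolding b mem_Collect_eq .
        then obtain f where "f 0 = c \<and> (\<forall>n. A x (pr (f n) (f (Suc n))))" ..
        then have f: "f 0 = c" "\<And>n. A x (pr (f n) (f (Suc n)))" by simp_all
        have "?E x a" using f that(1)
          by (intro exI[of _ "case_nat a f"]) (auto split: nat.split)
        then show ?thesis unfolding b mem_Collect_eq .
      qed
      ultimately show "?z \<in> ?V1 \<inter> (?V2 \<inter> ?V3)" using V1 V2 V3 by blast
    qed
  qed
qed


section \<open>A definable element of a nonempty set\<close>

text \<open>Undoes the shift by one in the second component that frees node \<open>0\<close> for an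
  additional root.\<close>

definition dn :: "nat \<Rightarrow> nat" where "dn i = pr (p1 i) (p2 i - 1)"

lemma lits_dn: "lits z (dn i) = lits z i" by (simp add: lits_def dn_def)

lemma lits_0: "lits z 0"
proof -
  have "p1 0 = 0" "p2 0 = 0" using prod_encode_inverse[of "(0, 0)"] by (simp_all add: prod_encode_def)
  then show ?thesis by (simp add: lits_def)
qed

text \<open>A node mentions three numbers, and their sum plus one exceeds each of them. This
  continuity moves nodes between reals that agree far enough.\<close>

lemma lits_agree:
  assumes "\<And>q. q < p2 (p1 (p1 i)) + p2 (p1 (p2 (p1 i))) + p2 (p2 (p2 (p1 i))) + 1 \<Longrightarrow> q \<in> z \<longleftrightarrow> q \<in> w"
  shows "lits z i \<longleftrightarrow> lits w i"
  using assms unfolding lits_def lit_def by simp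

locale kondo =
  fixes D :: "nat \<Rightarrow> nat \<Rightarrow> bool" and Z :: "nat set set"
  assumes D: "\<And>f g. basic f \<Longrightarrow> basic g \<Longrightarrow> dec (\<lambda>x p. D (f p) (g p))"
    and Z: "\<And>z. z \<in> Z \<longleftrightarrow> \<not> (\<exists>f. \<forall>n. D (f n) (f (Suc n)) \<and> lits z (f n))"
    and ne: "Z \<noteq> {}"
begin

text \<open>Node \<open>0\<close> is put above all other nodes, so that its rank bounds theirs.\<close>

definition E2 :: "nat \<Rightarrow> nat \<Rightarrow> bool" where
  "E2 i j \<longleftrightarrow> (i = 0 \<and> p2 j \<noteq> 0) \<or> (p2 i \<noteq> 0 \<and> p2 j \<noteq> 0 \<and> D (dn i) (dn j))"

definition E :: "nat set \<Rightarrow> nat \<Rightarrow> nat \<Rightarrow> bool" where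
  "E z i j \<longleftrightarrow> E2 i j \<and> lits z i \<and> lits z j"

abbreviation Er :: "nat set \<Rightarrow> (nat \<times> nat) set" where "Er z \<equiv> {(j, i). E z i j}"

lemma E_root: "E z i j \<Longrightarrow> E z 0 j"
  by (auto simp: E_def E2_def lits_0)

lemma Z_wf: "z \<in> Z \<longleftrightarrow> wf (Er z)"
proof -
  have "(\<exists>f. \<forall>n. E z (f n) (f (Suc n))) \<longleftrightarrow> (\<exists>f. \<forall>n. D (f n) (f (Suc n)) \<and> lits z (f n))"
  proof
    assume "\<exists>f. \<forall>n. E z (f n) (f (Suc n))"
    then obtain f where f: "\<And>n. E z (f n) (f (Suc n))" by blast
    have "p2 (f (Suc n)) \<noteq> 0" for n using f[of n] by (auto simp: E_def E2_def)
    moreover have "p2 0 = 0" using prod_encode_inverse[of "(0, 0)"] by (simp add: prod_encode_def)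
    ultimately have n0: "f (Suc n) \<noteq> 0" for n by metis
    have "D (dn (f (Suc n))) (dn (f (Suc (Suc n)))) \<and> lits z (dn (f (Suc n)))" for n
      using f[of "Suc n"] n0[of n] by (simp add: E_def E2_def lits_dn)
    then show "\<exists>f. \<forall>n. D (f n) (f (Suc n)) \<and> lits z (f n)"
      by (intro exI[of _ "\<lambda>n. dn (f (Suc n))"]) blast
  next
    assume "\<exists>f. \<forall>n. D (f n) (f (Suc n)) \<and> lits z (f n)"
    then obtain g where g: "\<And>n. D (g n) (g (Suc n)) \<and> lits z (g n)" by blast
    let ?f = "\<lambda>n. pr (p1 (g n)) (Suc (p2 (g n)))"
    have d: "dn (?f n) = g n" for n by (simp add: dn_def)
    then have "lits z (?f n)" for n using g lits_dn by metis
    then have "E z (?f n) (?f (Suc n))" for n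
      using g[of n] d unfolding E_def E2_def by simp
    then show "\<exists>f. \<forall>n. E z (f n) (f (Suc n))" by (intro exI[of _ ?f]) blast
  qed
  then show ?thesis using Z[of z] by (simp add: wf_iff_no_infinite_down_chain)
qed

text \<open>The usual rank of a well-founded relation. Countable ordinals suffice because a node has
  only countably many successors.\<close>

definition rk :: "nat set \<Rightarrow> nat \<Rightarrow> om1" where
  "rk z = wfrec (Er z) (\<lambda>h i. LEAST \<alpha>. \<forall>j. E z i j \<longrightarrow> h j < \<alpha>)"

lemma rk_unfold: "z \<in> Z \<Longrightarrow> rk z i = (LEAST \<alpha>. \<forall>j. E z i j \<longrightarrow> rk z j < \<alpha>)"
proof -
  assume "z \<in> Z"
  then have w: "wf (Er z)" by (simp add: Z_wf)
  have "rk z i = (LEAST \<alpha>. \<forall>j. E z i j \<longrightarrow> cut (rk z) (Er z) i j < \<alpha>)"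
    unfolding rk_def by (subst wfrec[OF w]) simp
  moreover have "(\<forall>j. E z i j \<longrightarrow> cut (rk z) (Er z) i j < \<alpha>) \<longleftrightarrow> (\<forall>j. E z i j \<longrightarrow> rk z j < \<alpha>)" for \<alpha>
    by (auto simp: cut_apply)
  ultimately show ?thesis by simp
qed

lemma rk_less: "z \<in> Z \<Longrightarrow> E z i j \<Longrightarrow> rk z j < rk z i"
proof -
  assume z: "z \<in> Z" and e: "E z i j"
  have "\<exists>\<alpha>. \<forall>j. E z i j \<longrightarrow> rk z j < \<alpha>" using om1_seq_bdd[of "rk z"] by auto
  from LeastI_ex[OF this] show ?thesis using e rk_unfold[OF z, of i] by auto
qed

lemma rk_le: "z \<in> Z \<Longrightarrow> (\<And>j. E z i j \<Longrightarrow> rk z j < \<alpha>) \<Longrightarrow> rk z i \<le> \<alpha>"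
  using rk_unfold[of z i] by (simp add: Least_le)

lemma rk_ge_ex: "z \<in> Z \<Longrightarrow> \<alpha> < rk z i \<Longrightarrow> \<exists>j. E z i j \<and> \<alpha> \<le> rk z j"
  using rk_le[of z i \<alpha>] by (meson not_le)

definition kl :: "nat \<Rightarrow> nat set \<Rightarrow> nat set \<Rightarrow> bool" where
  "kl n w y \<longleftrightarrow> rk w n < rk y n \<or> (rk w n = rk y n \<and> n \<notin> w \<and> n \<in> y)"

primrec Zs :: "nat \<Rightarrow> nat set set" where
  "Zs 0 = Z"
| "Zs (Suc n) = {z \<in> Zs n. \<forall>w\<in>Zs n. \<not> kl n w z}"

lemma Zs_dec: "m \<le> n \<Longrightarrow> Zs n \<subseteq> Zs m"
  by (induction n) (auto simp: le_Suc_eq)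

lemma Zs_Z: "Zs n \<subseteq> Z" using Zs_dec[of 0 n] by simp

lemma Zs_ne: "Zs n \<noteq> {}"
proof (induction n)
  case 0
  then show ?case using ne by simp
next
  case (Suc n)
  then obtain z0 where z0: "z0 \<in> Zs n" by blast
  define \<alpha> where "\<alpha> = (LEAST \<alpha>. \<exists>z\<in>Zs n. rk z n = \<alpha>)"
  have "\<exists>z\<in>Zs n. rk z n = \<alpha>" unfolding \<alpha>_def by (rule LeastI[of _ "rk z0 n"]) (use z0 in blast)
  then obtain z1 where z1: "z1 \<in> Zs n" "rk z1 n = \<alpha>" by blast
  have min: "\<alpha> \<le> rk z n" if "z \<in> Zs n" for z unfolding \<alpha>_def by (rule Least_le) (use that in blast)
  show ?case
  proof (cases "\<exists>z\<in>Zs n. rk z n = \<alpha> \<and> n \<notin> z")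
    case True
    then obtain z where "z \<in> Zs n" "rk z n = \<alpha>" "n \<notin> z" by blast
    then have "z \<in> Zs (Suc n)" using min by (auto simp: kl_def dest: leD)
    then show ?thesis by blast
  next
    case False
    then have "z1 \<in> Zs (Suc n)" using z1 min by (auto simp: kl_def dest: leD)
    then show ?thesis by blast
  qed
qed

lemma Zs_Suc_agree: "z \<in> Zs (Suc n) \<Longrightarrow> w \<in> Zs (Suc n) \<Longrightarrow> rk z n = rk w n \<and> (n \<in> z \<longleftrightarrow> n \<in> w)"
  by (auto simp: kl_def) (metis less_linear)+

definition zs :: "nat set" where "zs = {n. \<forall>z\<in>Zs (Suc n). n \<in> z}"

text \<open>The final rank of node \<open>n\<close>: all members of \<open>Zs (Suc n)\<close> agree
  on it, so the choice of \<open>z\<close> does not affect the value.\<close>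

definition ar :: "nat \<Rightarrow> om1" where "ar n = rk (SOME z. z \<in> Zs (Suc n)) n"

lemma Zs_agree:
  assumes "w \<in> Zs N" "n < N"
  shows "rk w n = ar n" "n \<in> w \<longleftrightarrow> n \<in> zs"
proof -
  have w: "w \<in> Zs (Suc n)" using assms Zs_dec[of "Suc n" N] by auto
  have "(SOME z. z \<in> Zs (Suc n)) \<in> Zs (Suc n)" using Zs_ne[of "Suc n"] by (rule some_in_eq[THEN iffD2])
  then show "rk w n = ar n" using Zs_Suc_agree w unfolding ar_def by blast
  show "n \<in> w \<longleftrightarrow> n \<in> zs" using w Zs_Suc_agree unfolding zs_def by blast
qed

text \<open>The edge depends on finitely many bits, so it is also present for a real
  \<open>w\<close> that agrees with \<open>zs\<close> on these bits and whose ranks at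
  \<open>i\<close> and \<open>j\<close> are already final. Thus \<open>ar\<close> ranks the limit
  relation. This is why ranks are minimized along with bits: they keep the limit inside
  \<open>Z\<close>.\<close>

lemma E_zs_ar: assumes "E zs i j" shows "ar j < ar i"
proof -
  let ?b = "\<lambda>i. p2 (p1 (p1 i)) + p2 (p1 (p2 (p1 i))) + p2 (p2 (p2 (p1 i))) + 1"
  define N where "N = Suc (?b i + ?b j + i + j)"
  obtain w where w: "w \<in> Zs N" using Zs_ne by blast
  have "lits zs i \<longleftrightarrow> lits w i" by (rule lits_agree) (use Zs_agree(2)[OF w] in \<open>auto simp: N_def\<close>)
  moreover have "lits zs j \<longleftrightarrow> lits w j" by (rule lits_agree) (use Zs_agree(2)[OF w] in \<open>auto simp: N_def\<close>)
  ultimately have "E w i j" using assms by (simp add: E_def)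
  then have "rk w j < rk w i" using rk_less w Zs_Z by blast
  moreover have "i < N" "j < N" by (auto simp: N_def)
  ultimately show ?thesis using Zs_agree(1)[OF w] by simp
qed

lemma zs_Z: "zs \<in> Z"
  unfolding Z_wf
proof (rule wf_subset[OF wf_inv_image[of "{(a, b). a < b}" ar]])
  show "wf {(a, b :: om1). a < b}" by (rule wf)
  show "Er zs \<subseteq> inv_image {(a, b). a < b} ar" using E_zs_ar by (auto simp: inv_image_def)
qed

lemma rk_zs: "rk zs i \<le> ar i"
proof -
  have "wf (Er zs)" using zs_Z Z_wf by blast
  then show ?thesis
  proof (induction i)
    case (less i)
    show ?case
    proof (rule rk_le[OF zs_Z])
      fix j assume j: "E zs i j"
      then have "rk zs j \<le> ar j" using less by blast
      then show "rk zs j < ar i" using E_zs_ar[OF j] by simp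
    qed
  qed
qed

text \<open>By \<open>rk_zs\<close> ranks can only drop in the limit. A real below \<open>zs\<close>
  at \<open>n\<close> would therefore also be below \<open>w0\<close>, which is minimal at
  \<open>n\<close>.\<close>

lemma zs_Zs: "zs \<in> Zs n"
proof (induction n)
  case 0
  then show ?case using zs_Z by simp
next
  case (Suc n)
  obtain w0 where w0: "w0 \<in> Zs (Suc n)" using Zs_ne by blast
  have a: "rk w0 n = ar n" "n \<in> w0 \<longleftrightarrow> n \<in> zs" using Zs_agree[OF w0] by auto
  have "\<not> kl n w zs" if w: "w \<in> Zs n" for w
  proof
    assume k: "kl n w zs"
    have "kl n w w0"
      using k rk_zs[of n] a unfolding kl_def by (auto dest: less_le_trans)
    then show False using w0 w by simp
  qed
  then show ?case using Suc by simp
qed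

definition below :: "nat set \<Rightarrow> nat set \<Rightarrow> bool" where
  "below w y \<longleftrightarrow> (\<exists>n. (\<forall>i<n. rk w i = rk y i \<and> (i \<in> w \<longleftrightarrow> i \<in> y)) \<and> kl n w y)"

text \<open>The stagewise sets \<open>Zs\<close> give way to minimality in one lexicographic order
  on \<open>Z\<close>, a single quantifier over reals. Below \<open>n\<close> the order demands
  equal ranks and bits, which puts a competitor into the same stages.\<close>

lemma zs_iff: "y = zs \<longleftrightarrow> y \<in> Z \<and> \<not> (\<exists>w\<in>Z. below w y)"
proof
  assume y: "y = zs"
  have "\<not> below w y" if w: "w \<in> Z" for w
  proof
    assume "below w y"
    then obtain n where n: "\<And>i. i < n \<Longrightarrow> rk w i = rk y i \<and> (i \<in> w \<longleftrightarrow> i \<in> y)" "kl n w y"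
      unfolding below_def by blast
    have "i \<le> n \<Longrightarrow> w \<in> Zs i" for i
    proof (induction i)
      case (Suc i)
      then have "kl i v w \<longleftrightarrow> kl i v y" for v using n(1)[of i] by (simp add: kl_def)
      moreover have "y \<in> Zs (Suc i)" using zs_Zs y by blast
      ultimately show ?case using Suc by simp
    qed (use w in simp)
    then have "w \<in> Zs n" by simp
    moreover have "y \<in> Zs (Suc n)" using zs_Zs y by blast
    ultimately show False using n(2) by simp
  qed
  then show "y \<in> Z \<and> \<not> (\<exists>w\<in>Z. below w y)" using y zs_Z by blast
next
  assume y: "y \<in> Z \<and> \<not> (\<exists>w\<in>Z. below w y)"
  have all: "y \<in> Zs n" for n
  proof (induction n)
    case (Suc n)
    show ?case
    proof (rule ccontr)
      assume "y \<notin> Zs (Suc n)"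
      then obtain w where w: "w \<in> Zs n" "kl n w y" using Suc by auto
      have "rk w i = rk y i \<and> (i \<in> w \<longleftrightarrow> i \<in> y)" if "i < n" for i
        using Zs_agree[OF w(1) that] Zs_agree[OF Suc that] by simp
      then have "below w y" using w(2) unfolding below_def by blast
      then show False using y w(1) Zs_Z by blast
    qed
  qed (use y in simp)
  show "y = zs" using Zs_agree(2)[OF all lessI] by blast
qed

section \<open>Comparison of ranks by simulations\<close>

definition sim :: "nat set \<Rightarrow> nat set \<Rightarrow> (nat \<Rightarrow> nat \<Rightarrow> bool) \<Rightarrow> bool" where
  "sim w y L \<longleftrightarrow> (\<forall>i j i'. L i j \<and> E w i i' \<longrightarrow> (\<exists>j'. E y j j' \<and> L i' j'))"

lemma sim_rk:
  assumes y: "y \<in> Z" and w: "w \<in> Z" and s: "sim w y L"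
  shows "L i j \<Longrightarrow> rk w i \<le> rk y j"
proof -
  have "wf (Er y)" using y Z_wf by blast
  then show "L i j \<Longrightarrow> rk w i \<le> rk y j"
  proof (induction j arbitrary: i)
    case (less j)
    show ?case
    proof (rule rk_le[OF w])
      fix i' assume "E w i i'"
      then obtain j' where j': "E y j j'" "L i' j'" using s less.prems unfolding sim_def by blast
      then have "rk w i' \<le> rk y j'" using less.IH by blast
      then show "rk w i' < rk y j" using rk_less[OF y j'(1)] by simp
    qed
  qed
qed

text \<open>An infinite path of \<open>w\<close> can be made to start at the root \<open>0\<close>,
  which \<open>L\<close> relates to a node of \<open>y\<close>; following it through the simulation
  gives an infinite descent in \<open>y\<close>. Membership of \<open>w\<close> in \<open>Z\<close>
  thus comes for free with a simulation.\<close>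

lemma sim_Z:
  assumes y: "y \<in> Z" and s: "sim w y L" and r: "L 0 j0"
  shows "w \<in> Z"
proof -
  have "wf (Er y)" using y Z_wf by blast
  then have no: "L i j \<Longrightarrow> \<not> (\<exists>f. f 0 = i \<and> (\<forall>n. E w (f n) (f (Suc n))))" for i j
  proof (induction j arbitrary: i)
    case (less j)
    show ?case
    proof
      assume "\<exists>f. f 0 = i \<and> (\<forall>n. E w (f n) (f (Suc n)))"
      then obtain f where f: "f 0 = i" "\<And>n. E w (f n) (f (Suc n))" by blast
      obtain j' where j': "E y j j'" "L (f 1) j'" using s[unfolded sim_def, rule_format, of i j "f 1"] less.prems f(2)[of 0] f(1) by auto
      have "\<exists>g. g 0 = f 1 \<and> (\<forall>n. E w (g n) (g (Suc n)))"
        using f(2) by (intro exI[of _ "\<lambda>n. f (Suc n)"]) simp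
      then show False using less.IH[OF _ j'(2)] j'(1) by blast
    qed
  qed
  show ?thesis
    unfolding Z_wf wf_iff_no_infinite_down_chain
  proof
    assume "\<exists>f. \<forall>n. (f (Suc n), f n) \<in> Er w"
    then obtain f where f: "\<And>n. E w (f n) (f (Suc n))" by blast
    have "E w 0 (f (Suc 0))" using E_root f by blast
    then have "\<exists>g. g 0 = 0 \<and> (\<forall>n. E w (g n) (g (Suc n)))"
      using f by (intro exI[of _ "\<lambda>n. if n = 0 then 0 else f n"]) auto
    then show False using no[OF r] by blast
  qed
qed

text \<open>From left to right, comparison of ranks is the simulation. Conversely a simulation only
  yields inequalities between ranks where \<open>below\<close> asks for equality before
  \<open>n\<close>. This does no harm: if some inequality before \<open>n\<close> is strict, the
  least such place witnesses \<open>below\<close> instead of \<open>n\<close>.\<close>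

lemma below_iff:
  assumes y: "y \<in> Z"
  shows "(\<exists>w\<in>Z. below w y) \<longleftrightarrow> (\<exists>n j w L. sim w y L \<and> (\<forall>i<n. L i i \<and> (i \<in> w \<longleftrightarrow> i \<in> y)) \<and>
    ((E y n j \<and> L n j) \<or> (L n n \<and> n \<notin> w \<and> n \<in> y)))"
proof
  assume "\<exists>w\<in>Z. below w y"
  then obtain w n where w: "w \<in> Z" and n: "\<And>i. i < n \<Longrightarrow> rk w i = rk y i \<and> (i \<in> w \<longleftrightarrow> i \<in> y)" "kl n w y"
    unfolding below_def by blast
  let ?L = "\<lambda>i j. rk w i \<le> rk y j"
  have "sim w y ?L" unfolding sim_def
  proof (intro allI impI)
    fix i j i' assume "rk w i \<le> rk y j \<and> E w i i'"
    then have "rk w i' < rk y j" using rk_less[OF w, of i i'] by auto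
    then show "\<exists>j'. E y j j' \<and> rk w i' \<le> rk y j'" using rk_ge_ex[OF y] by blast
  qed
  moreover have "\<exists>j. (E y n j \<and> ?L n j) \<or> (?L n n \<and> n \<notin> w \<and> n \<in> y)"
    using n(2) rk_ge_ex[OF y, of "rk w n" n] unfolding kl_def by auto
  moreover have "\<forall>i<n. ?L i i \<and> (i \<in> w \<longleftrightarrow> i \<in> y)" using n(1) by simp
  ultimately show "\<exists>n j w L. sim w y L \<and> (\<forall>i<n. L i i \<and> (i \<in> w \<longleftrightarrow> i \<in> y)) \<and>
    ((E y n j \<and> L n j) \<or> (L n n \<and> n \<notin> w \<and> n \<in> y))" by blast
next
  assume "\<exists>n j w L. sim w y L \<and> (\<forall>i<n. L i i \<and> (i \<in> w \<longleftrightarrow> i \<in> y)) \<and>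
    ((E y n j \<and> L n j) \<or> (L n n \<and> n \<notin> w \<and> n \<in> y))"
  then obtain n j w L where s: "sim w y L" and n: "\<And>i. i < n \<Longrightarrow> L i i \<and> (i \<in> w \<longleftrightarrow> i \<in> y)"
    and c: "(E y n j \<and> L n j) \<or> (L n n \<and> n \<notin> w \<and> n \<in> y)" by blast
  have "\<exists>j. L 0 j" using n c by (cases n) auto
  then have w: "w \<in> Z" using sim_Z[OF y s] by blast
  have le: "rk w i \<le> rk y i" if "i < n" for i using sim_rk[OF y w s] n that by blast
  have "below w y"
  proof (cases "\<exists>i<n. rk w i < rk y i")
    case True
    define m where "m = (LEAST i. i < n \<and> rk w i < rk y i)"
    have m: "m < n \<and> rk w m < rk y m" unfolding m_def using True by (rule LeastI_ex)
    have "\<not> rk w i < rk y i" if "i < m" for i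
      using that m not_less_Least[of i "\<lambda>i. i < n \<and> rk w i < rk y i"] unfolding m_def by auto
    then have "rk w i = rk y i" if "i < m" for i using that le[of i] m by (metis le_less less_trans)
    then show ?thesis unfolding below_def kl_def using m n by (intro exI[of _ m]) auto
  next
    case False
    then have eq: "rk w i = rk y i" if "i < n" for i using le[OF that] that by auto
    have "kl n w y"
    proof -
      consider "E y n j" "L n j" | "L n n" "n \<notin> w" "n \<in> y" using c by blast
      then show ?thesis
      proof cases
        case 1
        then have "rk w n < rk y n" using sim_rk[OF y w s] rk_less[OF y] by (metis le_less_trans)
        then show ?thesis by (simp add: kl_def)
      next
        case 2
        then have "rk w n \<le> rk y n" using sim_rk[OF y w s] by blast
        then show ?thesis using 2 by (auto simp: kl_def)
      qed
    qed
    then show ?thesis unfolding below_def using eq n by blast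
  qed
  then show "\<exists>w\<in>Z. below w y" using w by blast
qed

text \<open>A candidate smaller than a given real is searched for as a function whose value at \<open>k\<close> codes the
  bit of \<open>w\<close> at \<open>k\<close>, whether \<open>k\<close> codes a pair in the simulation, the witness required by the
  simulation at \<open>k\<close>, and whether \<open>w\<close> satisfies the literals of node \<open>k\<close>.\<close>

abbreviation "vw v \<equiv> p1 v"
abbreviation "vl v \<equiv> p1 (p2 v)"
abbreviation "vs v \<equiv> p1 (p2 (p2 v))"
abbreviation "vt v \<equiv> p2 (p2 (p2 v))"

definition litv :: "nat \<Rightarrow> nat \<Rightarrow> bool" where
  "litv b l \<longleftrightarrow> p1 l = 0 \<or> (p1 l = 1 \<and> b = 1) \<or> (p1 l = 2 \<and> b \<noteq> 1)"

lemma litv: "(b = 1 \<longleftrightarrow> p2 l \<in> z) \<Longrightarrow> litv b l = lit z l" by (auto simp: litv_def lit_def)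

text \<open>Each \<open>e\<close> is an argument paired with its value, and the premises select the
  arguments that a clause speaks about. The clauses express in order the simulation, the correctness
  of the stored truth values of literals, agreement before \<open>n\<close>, and the final
  alternative of \<open>below_iff\<close>. Storing these truth values keeps the first clause down to
  five entries.\<close>

definition sim_check :: "nat set \<Rightarrow> nat \<Rightarrow> nat \<Rightarrow> nat \<Rightarrow> nat \<Rightarrow> nat \<Rightarrow> nat \<Rightarrow> nat \<Rightarrow> bool" where
  "sim_check y n j e1 e2 e3 e4 e5 \<longleftrightarrow>
    (p1 e2 = p1 (p1 e1) \<and> p1 e3 = pr (p2 (p1 e1)) (vs (p2 e1)) \<and> p1 e4 = p1 (p1 (p1 e1)) \<and> p1 e5 = p2 (p1 e1) \<and>
       vl (p2 e2) = 1 \<and> E2 (p1 (p1 (p1 e1))) (p2 (p1 e1)) \<and> vt (p2 e4) = 1 \<and> vt (p2 e5) = 1 \<longrightarrow>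
       E2 (p2 (p1 (p1 e1))) (vs (p2 e1)) \<and> lits y (p2 (p1 (p1 e1))) \<and> lits y (vs (p2 e1)) \<and> vl (p2 e3) = 1) \<and>
    (p1 e2 = p2 (p1 (p1 (p1 e1))) \<and> p1 e3 = p2 (p1 (p2 (p1 (p1 e1)))) \<and> p1 e4 = p2 (p2 (p2 (p1 (p1 e1)))) \<longrightarrow>
       (vt (p2 e1) = 1 \<longleftrightarrow> litv (vw (p2 e2)) (p1 (p1 (p1 e1))) \<and>
         litv (vw (p2 e3)) (p1 (p2 (p1 (p1 e1)))) \<and> litv (vw (p2 e4)) (p2 (p2 (p1 (p1 e1)))))) \<and>
    (p1 e1 < n \<and> p1 e2 = pr (p1 e1) (p1 e1) \<longrightarrow> (vw (p2 e1) = 1 \<longleftrightarrow> p1 e1 \<in> y) \<and> vl (p2 e2) = 1) \<and>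
    (p1 e1 = pr n j \<and> p1 e2 = pr n n \<and> p1 e3 = n \<longrightarrow>
       (E2 n j \<and> lits y n \<and> lits y j \<and> vl (p2 e1) = 1) \<or> (vl (p2 e2) = 1 \<and> vw (p2 e3) \<noteq> 1 \<and> n \<in> y))"

lemma sim_check_iff:
  "(\<exists>g. \<forall>k1 k2 k3 k4 k5. sim_check y n j (pr k1 (g k1)) (pr k2 (g k2)) (pr k3 (g k3)) (pr k4 (g k4)) (pr k5 (g k5)))
   \<longleftrightarrow> (\<exists>w L. sim w y L \<and> (\<forall>i<n. L i i \<and> (i \<in> w \<longleftrightarrow> i \<in> y)) \<and>
    ((E y n j \<and> L n j) \<or> (L n n \<and> n \<notin> w \<and> n \<in> y)))"
proof
  assume "\<exists>g. \<forall>k1 k2 k3 k4 k5. sim_check y n j (pr k1 (g k1)) (pr k2 (g k2)) (pr k3 (g k3)) (pr k4 (g k4)) (pr k5 (g k5))"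
  then obtain g where g: "\<And>k1 k2 k3 k4 k5. sim_check y n j (pr k1 (g k1)) (pr k2 (g k2)) (pr k3 (g k3)) (pr k4 (g k4)) (pr k5 (g k5))"
    by blast
  define w where "w = {k. vw (g k) = 1}"
  define L where "L i j \<longleftrightarrow> vl (g (pr i j)) = 1" for i j
  have t: "vt (g i) = 1 \<longleftrightarrow> lits w i" for i
  proof -
    have l: "litv (vw (g (p2 l))) l = lit w l" for l by (rule litv) (simp add: w_def)
    show ?thesis
      using g[of i "p2 (p1 (p1 i))" "p2 (p1 (p2 (p1 i)))" "p2 (p2 (p2 (p1 i)))" 0]
      unfolding sim_check_def lits_def l[symmetric] by simp
  qed
  have "sim w y L" unfolding sim_def
  proof (intro allI impI)
    fix i j i' assume a: "L i j \<and> E w i i'"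
    let ?s = "vs (g (pr (pr i j) i'))"
    have "E y j ?s \<and> L i' ?s"
      using g[of "pr (pr i j) i'" "pr i j" "pr i' ?s" i i'] a t
      unfolding sim_check_def L_def E_def by simp
    then show "\<exists>j'. E y j j' \<and> L i' j'" by blast
  qed
  moreover have "\<forall>i<n. L i i \<and> (i \<in> w \<longleftrightarrow> i \<in> y)"
  proof (intro allI impI)
    fix i assume "i < n"
    then show "L i i \<and> (i \<in> w \<longleftrightarrow> i \<in> y)"
      using g[of i "pr i i" 0 0 0] unfolding sim_check_def L_def w_def by simp
  qed
  moreover have "(E y n j \<and> L n j) \<or> (L n n \<and> n \<notin> w \<and> n \<in> y)"
    using g[of "pr n j" "pr n n" n 0 0] unfolding sim_check_def L_def w_def E_def by simp
  ultimately show "\<exists>w L. sim w y L \<and> (\<forall>i<n. L i i \<and> (i \<in> w \<longleftrightarrow> i \<in> y)) \<and>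
    ((E y n j \<and> L n j) \<or> (L n n \<and> n \<notin> w \<and> n \<in> y))" by blast
next
  assume "\<exists>w L. sim w y L \<and> (\<forall>i<n. L i i \<and> (i \<in> w \<longleftrightarrow> i \<in> y)) \<and>
    ((E y n j \<and> L n j) \<or> (L n n \<and> n \<notin> w \<and> n \<in> y))"
  then obtain w L where s: "sim w y L" and n: "\<And>i. i < n \<Longrightarrow> L i i \<and> (i \<in> w \<longleftrightarrow> i \<in> y)"
    and c: "(E y n j \<and> L n j) \<or> (L n n \<and> n \<notin> w \<and> n \<in> y)" by blast
  obtain \<sigma> where \<sigma>: "\<And>i j i'. L i j \<Longrightarrow> E w i i' \<Longrightarrow> E y j (\<sigma> i j i') \<and> L i' (\<sigma> i j i')"
    using s unfolding sim_def by metis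
  define g where "g k = pr (of_bool (k \<in> w)) (pr (of_bool (L (p1 k) (p2 k)))
    (pr (\<sigma> (p1 (p1 k)) (p2 (p1 k)) (p2 k)) (of_bool (lits w k))))" for k
  have gw: "vw (g k) = 1 \<longleftrightarrow> k \<in> w" and gl: "vl (g k) = 1 \<longleftrightarrow> L (p1 k) (p2 k)"
    and gs: "vs (g k) = \<sigma> (p1 (p1 k)) (p2 (p1 k)) (p2 k)" and gt: "vt (g k) = 1 \<longleftrightarrow> lits w k" for k
    by (simp_all add: g_def)
  have l: "litv (vw (g k)) l = lit w l" if "k = p2 l" for k l by (rule litv) (use gw that in simp)
  have "sim_check y n j (pr k1 (g k1)) (pr k2 (g k2)) (pr k3 (g k3)) (pr k4 (g k4)) (pr k5 (g k5))" for k1 k2 k3 k4 k5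
    unfolding sim_check_def prod_encode_inverse fst_conv snd_conv
  proof (intro conjI)
    show "k2 = p1 k1 \<and> k3 = pr (p2 k1) (vs (g k1)) \<and> k4 = p1 (p1 k1) \<and> k5 = p2 k1 \<and>
       vl (g k2) = 1 \<and> E2 (p1 (p1 k1)) (p2 k1) \<and> vt (g k4) = 1 \<and> vt (g k5) = 1 \<longrightarrow>
       E2 (p2 (p1 k1)) (vs (g k1)) \<and> lits y (p2 (p1 k1)) \<and> lits y (vs (g k1)) \<and> vl (g k3) = 1"
      unfolding gl gt gs using \<sigma>[of "p1 (p1 k1)" "p2 (p1 k1)" "p2 k1"] by (auto simp: E_def)
    show "k2 = p2 (p1 (p1 k1)) \<and> k3 = p2 (p1 (p2 (p1 k1))) \<and> k4 = p2 (p2 (p2 (p1 k1))) \<longrightarrow>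
       (vt (g k1) = 1 \<longleftrightarrow> litv (vw (g k2)) (p1 (p1 k1)) \<and>
         litv (vw (g k3)) (p1 (p2 (p1 k1))) \<and> litv (vw (g k4)) (p2 (p2 (p1 k1))))"
      unfolding gt lits_def using l by auto
    show "k1 < n \<and> k2 = pr k1 k1 \<longrightarrow> (vw (g k1) = 1 \<longleftrightarrow> k1 \<in> y) \<and> vl (g k2) = 1"
      unfolding gl gw using n by auto
    show "k1 = pr n j \<and> k2 = pr n n \<and> k3 = n \<longrightarrow>
       (E2 n j \<and> lits y n \<and> lits y j \<and> vl (g k1) = 1) \<or> (vl (g k2) = 1 \<and> vw (g k3) \<noteq> 1 \<and> n \<in> y)"
      unfolding gl gw using c by (auto simp: E_def)
  qed
  then show "\<exists>g. \<forall>k1 k2 k3 k4 k5. sim_check y n j (pr k1 (g k1)) (pr k2 (g k2)) (pr k3 (g k3)) (pr k4 (g k4)) (pr k5 (g k5))"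
    by blast
qed

lemma dec_zs:
  assumes \<Psi>: "dec (\<lambda>x a. a \<in> \<Psi> x)"
  shows "dec (\<lambda>x a. \<Psi> x = zs)"
proof -
  have m: "dec (\<lambda>x a. f a \<in> \<Psi> x)" if "basic f" for f using dec.C_sub[OF \<Psi> that] .
  have E2: "dec (\<lambda>x a. E2 (f a) (g a))" if "basic f" "basic g" for f g
    unfolding E2_def dn_def by (intro dec.C_intros D that)
  have lt: "dec (\<lambda>x a. lit (\<Psi> x) (f a))" if "basic f" for f
    unfolding lit_def by (intro dec.C_intros m that)
  have ls: "dec (\<lambda>x a. lits (\<Psi> x) (f a))" if "basic f" for f
    unfolding lits_def by (intro dec.C_intros lt that)
  have lv: "dec (\<lambda>x a. litv (f a) (g a))" if "basic f" "basic g" for f g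
    unfolding litv_def by (intro dec.C_intros that)
  have ck: "dec (\<lambda>x a. sim_check (\<Psi> x) (f0 a) (f0' a) (f1 a) (f2 a) (f3 a) (f4 a) (f5 a))"
    if "basic f0" "basic f0'" "basic f1" "basic f2" "basic f3" "basic f4" "basic f5" for f0 f0' f1 f2 f3 f4 f5
    unfolding sim_check_def by (intro dec.C_intros E2 ls lv m that)
  have "dec (\<lambda>x a. \<exists>g. \<forall>k1 k2 k3 k4 k5. sim_check (\<Psi> x) (p1 a) (p2 a) (pr k1 (g k1)) (pr k2 (g k2)) (pr k3 (g k3)) (pr k4 (g k4)) (pr k5 (g k5)))"
    by (rule dec.C_so[where B = "\<lambda>x a. sim_check (\<Psi> x) (p1 a) (p2 a)"]) (intro ck basic.intros)
  then have S: "dec (\<lambda>x a. \<exists>w L. sim w (\<Psi> x) L \<and> (\<forall>i<f a. L i i \<and> (i \<in> w \<longleftrightarrow> i \<in> \<Psi> x)) \<and>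
    ((E (\<Psi> x) (f a) (h a) \<and> L (f a) (h a)) \<or> (L (f a) (f a) \<and> f a \<notin> w \<and> f a \<in> \<Psi> x)))" if "basic f" "basic h" for f h
    unfolding sim_check_iff using dec.C_sub[OF _ basic_pr[OF that]] by fastforce
  have 1: "dec (\<lambda>x a. \<exists>n j w L. sim w (\<Psi> x) L \<and> (\<forall>i<n. L i i \<and> (i \<in> w \<longleftrightarrow> i \<in> \<Psi> x)) \<and>
    ((E (\<Psi> x) n j \<and> L n j) \<or> (L n n \<and> n \<notin> w \<and> n \<in> \<Psi> x)))"
    by (intro dec.C_ex S basic.intros)
  have 2: "dec (\<lambda>x a. \<exists>k f. f 0 = k \<and> (\<forall>n. D (f n) (f (Suc n)) \<and> lits (\<Psi> x) (f n)))"
    by (intro dec.C_ex dec.C_path_from[where A = "\<lambda>x u w. D u w \<and> lits (\<Psi> x) u"] dec.C_conj D ls basic.intros)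
  have "dec (\<lambda>x a. \<not> (\<exists>k f. f 0 = k \<and> (\<forall>n. D (f n) (f (Suc n)) \<and> lits (\<Psi> x) (f n))) \<and>
     \<not> (\<exists>n j w L. sim w (\<Psi> x) L \<and> (\<forall>i<n. L i i \<and> (i \<in> w \<longleftrightarrow> i \<in> \<Psi> x)) \<and>
    ((E (\<Psi> x) n j \<and> L n j) \<or> (L n n \<and> n \<notin> w \<and> n \<in> \<Psi> x))))"
    by (rule dec.C_conj[OF dec.C_not[OF 2] dec.C_not[OF 1]])
  then show ?thesis
  proof (rule dec.C_cong)
    fix x a
    have "\<not> (\<exists>k f. f 0 = k \<and> (\<forall>n. D (f n) (f (Suc n)) \<and> lits (\<Psi> x) (f n))) \<longleftrightarrow> \<Psi> x \<in> Z"
      unfolding Z by blast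
    then show "(\<not> (\<exists>k f. f 0 = k \<and> (\<forall>n. D (f n) (f (Suc n)) \<and> lits (\<Psi> x) (f n))) \<and>
     \<not> (\<exists>n j w L. sim w (\<Psi> x) L \<and> (\<forall>i<n. L i i \<and> (i \<in> w \<longleftrightarrow> i \<in> \<Psi> x)) \<and>
    ((E (\<Psi> x) n j \<and> L n j) \<or> (L n n \<and> n \<notin> w \<and> n \<in> \<Psi> x)))) \<longleftrightarrow> \<Psi> x = zs"
      using zs_iff[of "\<Psi> x"] below_iff[of "\<Psi> x"] by blast
  qed
qed

end

lemma coanalytic_definable_element:
  assumes "coanalytic Z" "Z \<noteq> {}"
  shows "\<exists>z\<in>Z. \<forall>\<Psi>. dec (\<lambda>x a. a \<in> \<Psi> x) \<longrightarrow> dec (\<lambda>x a. \<Psi> x = z)"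
proof -
  obtain D where D: "\<And>f g. basic f \<Longrightarrow> basic g \<Longrightarrow> dec (\<lambda>x p. D (f p) (g p))"
    "\<And>z. z \<in> Z \<longleftrightarrow> \<not> (\<exists>f. \<forall>n. D (f n) (f (Suc n)) \<and> lits z (f n))" using coanalyticE[OF assms(1)] by blast
  interpret kondo D Z by unfold_locales (use D assms(2) in auto)
  show ?thesis using zs_Z dec_zs by blast
qed

lemma certified_recognizable:
  assumes A: "certified A" and ne: "A x0 0"
  shows "\<exists>x. A x 0 \<and> ITRM_recognizable x"
proof -
  obtain \<Psi> where \<Psi>: "cert \<Psi>" "\<And>x a. pr 1 a \<in> \<Psi> x \<longleftrightarrow> A x a" using certifiedE[OF A] by blast
  let ?Z = "range \<Psi> \<inter> {z. \<forall>a::nat. True \<longrightarrow> \<not> lit z (pr 2 (pr 1 0))}"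
  have "coanalytic ?Z" using \<Psi>(1) by (intro coanalytic_Int coanalytic_loc1 dec.C_const basic.intros) (simp add: cert_def)
  moreover have "\<Psi> x0 \<in> ?Z" using ne \<Psi>(2) by simp
  ultimately obtain z where z: "z \<in> ?Z" "\<And>\<Psi>. dec (\<lambda>x a. a \<in> \<Psi> x) \<Longrightarrow> dec (\<lambda>x a. \<Psi> x = z)"
    using coanalytic_definable_element[of ?Z] by blast
  obtain x where x: "z = \<Psi> x" using z(1) by blast
  have "A x 0" using z(1) x \<Psi>(2) by auto
  moreover have "dec (\<lambda>y a. \<Psi> y = \<Psi> x)" using z(2) \<Psi>(1) x unfolding cert_def by blast
  \<comment> \<open>Section \<open>0\<close> of a certificate returns the real, so
    \<open>\<Psi>\<close> is injective.\<close>
  moreover have "\<Psi> y = \<Psi> x \<longleftrightarrow> y = x" for y using \<Psi>(1) unfolding cert_def by metis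
  ultimately have "ITRM_decidable {y. y = x}" using dec_decidable[of "\<lambda>y. y = x"] by simp
  then show ?thesis using \<open>A x 0\<close> unfolding ITRM_recognizable_def by auto
qed

section \<open>Addition of countable ordinals\<close>

text \<open>Ordinal addition. Time \<open>t\<close> of the run restarted from its configuration at
  \<open>s\<close> is time \<open>add s t\<close> of the original run.\<close>

definition add :: "om1 \<Rightarrow> om1 \<Rightarrow> om1" where
  "add s = wfrec {(a, b). a < b} (\<lambda>h t. LEAST b. s \<le> b \<and> (\<forall>t'<t. h t' < b))"

lemma add_unfold: "add s t = (LEAST b. s \<le> b \<and> (\<forall>t'<t. add s t' < b))"
proof -
  have w: "wf {(a, b :: om1). a < b}" by (rule wf)
  have "add s t = (LEAST b. s \<le> b \<and> (\<forall>t'<t. cut (add s) {(a, b). a < b} t t' < b))"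
    unfolding add_def by (subst wfrec[OF w]) simp
  moreover have "(\<forall>t'<t. cut (add s) {(a, b). a < b} t t' < b) \<longleftrightarrow> (\<forall>t'<t. add s t' < b)" for b
    by (auto simp: cut_apply)
  ultimately show ?thesis by simp
qed

lemma add_props: "s \<le> add s t \<and> (\<forall>t'<t. add s t' < add s t)"
proof -
  have "countable (insert s (add s ` {..<t}))" using countable_lessThan_om1 by simp
  then obtain b where "\<forall>a\<in>insert s (add s ` {..<t}). a < b" using om1_bdd by blast
  then have "\<exists>b. s \<le> b \<and> (\<forall>t'<t. add s t' < b)" by (intro exI[of _ b]) auto
  from LeastI_ex[OF this] show ?thesis unfolding add_unfold[symmetric] .
qed

lemma add_ge: "s \<le> add s t" and add_less: "t' < t \<Longrightarrow> add s t' < add s t"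
  using add_props by blast+

lemma add_least: "s \<le> b \<Longrightarrow> (\<And>t'. t' < t \<Longrightarrow> add s t' < b) \<Longrightarrow> add s t \<le> b"
  unfolding add_unfold[of s t] by (rule Least_le) blast

lemma add_less_iff: "add s t' < add s t \<longleftrightarrow> t' < t"
  using add_less by (metis less_asym neqE)

lemma add_le_iff: "add s t' \<le> add s t \<longleftrightarrow> t' \<le> t"
  using add_less_iff by (metis not_le)

lemma add_z0 [simp]: "add s z0 = s"
  using add_least[of s s z0] add_ge[of s z0] z0_le by (metis leD order.antisym order_refl)

lemma add_self: "t \<le> add s t"
proof (induction t rule: less_induct)
  case (less t)
  show ?case
  proof (rule ccontr)
    assume "\<not> t \<le> add s t"
    then have "add s t < t" by simp
    then show False using less[of "add s t"] add_less[of "add s t" t s] by (meson leD)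
  qed
qed

lemma add_surj: "s \<le> b \<Longrightarrow> \<exists>t. b = add s t"
proof -
  assume s: "s \<le> b"
  define t where "t = (LEAST t. b \<le> add s t)"
  have "b \<le> add s t" unfolding t_def using add_self by (rule LeastI)
  moreover have "add s t \<le> b"
  proof (rule add_least[OF s])
    fix t' assume "t' < t"
    then show "add s t' < b" using not_less_Least unfolding t_def by (metis not_le)
  qed
  ultimately show ?thesis by (intro exI[of _ t]) simp
qed

lemma add_sc: "add s (sc t) = sc (add s t)"
proof (rule order.antisym)
  show "sc (add s t) \<le> add s (sc t)" by (intro sc_le add_less sc_gt)
  show "add s (sc t) \<le> sc (add s t)"
    by (rule add_least) (auto simp: less_sc add_le_iff intro: order_trans[OF add_ge less_imp_le[OF sc_gt]])
qed

lemma add_limo: "t \<noteq> z0 \<Longrightarrow> limo (add s t) \<longleftrightarrow> limo t"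
proof (cases t rule: om1_cases)
  case (2 p)
  then show ?thesis by (simp add: add_sc not_limo_sc)
next
  case 3
  have "limo (add s t)" unfolding limo_def
  proof (intro conjI allI impI)
    obtain q where "q < t" using 3 by (auto simp: limo_def)
    then show "\<exists>p. p < add s t" using add_less by blast
    fix p assume p: "p < add s t"
    show "\<exists>q>p. q < add s t"
    proof (cases "s \<le> p")
      case True
      then obtain p' where p': "p = add s p'" using add_surj by blast
      then have "p' < t" using p add_less_iff by simp
      then obtain q' where "p' < q'" "q' < t" using 3 by (auto simp: limo_def)
      then show ?thesis using p' add_less by blast
    next
      case False
      have "z0 < t" using 3 not_limo_z0 z0_le[of t] by (metis le_less)
      then have "s < add s t" using add_less[of z0 t s] by simp
      then show ?thesis using False by (intro exI[of _ s]) simp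
    qed
  qed
  then show ?thesis using 3 by simp
qed simp

lemma Lim_add:
  assumes "limo t"
  shows "Lim (add s t) f = Lim t (\<lambda>q. f (add s q))"
proof -
  have single: "s < add s t"
  proof -
    have "z0 < t" using assms not_limo_z0 z0_le[of t] by (metis le_less)
    then show ?thesis using add_less[of z0 t s] by simp
  qed
  have "cofv {(a, b). a \<le> b} (add s t) f v = cofv {(a, b). a \<le> b} t (\<lambda>q. f (add s q)) v" for v
  proof
    assume a: "cofv {(a, b). a \<le> b} (add s t) f v"
    show "cofv {(a, b). a \<le> b} t (\<lambda>q. f (add s q)) v"
      unfolding cofv_alt lt_om1
    proof (intro allI impI)
      fix p assume "p < t"
      then obtain q where q: "add s p \<le> q" "q < add s t" "f q = v"
        using a add_less unfolding cofv_alt lt_om1 by blast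
      obtain q' where "q = add s q'" using add_surj add_ge q(1) order_trans by blast
      then show "\<exists>q. (p, q) \<in> {(a, b). a \<le> b} \<and> q < t \<and> f (add s q) = v"
        using q by (intro exI[of _ q']) (simp add: add_le_iff add_less_iff)
    qed
  next
    assume a: "cofv {(a, b). a \<le> b} t (\<lambda>q. f (add s q)) v"
    show "cofv {(a, b). a \<le> b} (add s t) f v"
      unfolding cofv_alt lt_om1
    proof (intro allI impI)
      fix p assume "p < add s t"
      then have "max p s < add s t" using single by simp
      obtain p' where p': "max p s = add s p'" using add_surj[of s "max p s"] by auto
      then have "p' < t" using \<open>max p s < add s t\<close> by (simp add: add_less_iff)
      then obtain q where q: "p' \<le> q" "q < t" "f (add s q) = v" using a unfolding cofv_alt lt_om1 by blast
      have "p \<le> add s q" using q(1) p' add_le_iff[of s p' q] by (metis max.bounded_iff)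
      then show "\<exists>q. (p, q) \<in> {(a, b). a \<le> b} \<and> q < add s t \<and> f q = v"
        using q by (intro exI[of _ "add s q"]) (simp add: add_less_iff)
    qed
  qed
  then show ?thesis unfolding liminf_below_cofv by presburger
qed

lemma run_shift: "run F (run F c s) t = run F c (add s t)"
proof (induction t rule: less_induct)
  case (less t)
  show ?case
  proof (cases t rule: om1_cases)
    case (2 p)
    then show ?thesis using less[of p] sc_gt by (simp add: add_sc)
  next
    case 3
    then have "limo (add s t)" using add_limo not_limo_z0 by metis
    show ?thesis
    proof
      fix l
      have "run F (run F c s) t l = Lim t (\<lambda>q. run F (run F c s) q l)" by (rule run_lim[OF 3])
      also have "\<dots> = Lim t (\<lambda>q. run F c (add s q) l)" by (rule Lim_cong) (simp add: less)
      also have "\<dots> = run F c (add s t) l" using Lim_add[OF 3] run_lim[OF \<open>limo (add s t)\<close>] by simp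
      finally show "run F (run F c s) t l = run F c (add s t) l" .
    qed
  qed simp
qed

lemma mn_shift: "mn (run F (run F c s)) z0 t m \<longleftrightarrow> mn (run F c) s (add s t) m"
proof -
  have 1: "(\<forall>q. z0 \<le> q \<and> q < t \<longrightarrow> Q (add s q)) \<longleftrightarrow> (\<forall>q. s \<le> q \<and> q < add s t \<longrightarrow> Q q)" for Q
    by (metis add_ge add_less_iff add_surj z0_le)
  have 2: "(\<exists>q. z0 \<le> q \<and> q < t \<and> Q (add s q)) \<longleftrightarrow> (\<exists>q. s \<le> q \<and> q < add s t \<and> Q q)" for Q
    by (metis add_ge add_less_iff add_surj z0_le)
  have "((\<forall>q. z0 \<le> q \<and> q < t \<longrightarrow> m l \<le> run F c (add s q) l) \<and> (\<exists>q. z0 \<le> q \<and> q < t \<and> run F c (add s q) l = m l)) \<longleftrightarrow>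
      ((\<forall>q. s \<le> q \<and> q < add s t \<longrightarrow> m l \<le> run F c q l) \<and> (\<exists>q. s \<le> q \<and> q < add s t \<and> run F c q l = m l))" for l
    by (rule arg_cong2[where f = "(\<and>)"]) (rule 1, rule 2)
  then show ?thesis unfolding mn_def run_shift by (rule all_cong1)
qed

section \<open>The structure of overflow times\<close>

text \<open>An overflow time is a limit time at which some component tends to infinity. The set
  \<open>B c j\<close> is the \<open>j\<close>-th Cantor-Bendixson-style derivative of the set of overflow times. At a point of
  \<open>B c j\<close> at least \<open>j + 1\<close> components either overflow or have overflown cofinally often, so the derivatives
  vanish after as many steps as there are components.\<close>

locale runs =
  fixes F :: "cf \<Rightarrow> cf" and K :: nat
  assumes F: "\<And>c. supp K c \<Longrightarrow> supp K (F c)"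
begin

definition overflow :: "cf \<Rightarrow> om1 \<Rightarrow> nat \<Rightarrow> bool" where
  "overflow c t l \<longleftrightarrow> limo t \<and> (\<forall>n. \<exists>s<t. \<forall>q. s \<le> q \<and> q < t \<longrightarrow> n \<le> run F c q l)"

primrec B :: "cf \<Rightarrow> nat \<Rightarrow> om1 set" where
  "B c 0 = {t. \<exists>l. overflow c t l}"
| "B c (Suc j) = {t \<in> B c j. \<forall>s<t. \<exists>q\<in>B c j. s < q \<and> q < t}"

lemma lb_run: "lb {(a, b). a \<le> b} t (\<lambda>q. run F c q l) n \<longleftrightarrow> (\<exists>s<t. \<forall>q. s \<le> q \<and> q < t \<longrightarrow> n \<le> run F c q l)"
  unfolding lb_def lt_om1 by simp

lemma cofv_run: "cofv {(a, b). a \<le> b} t (\<lambda>q. run F c q l) n \<longleftrightarrow> (\<forall>s<t. \<exists>q. s \<le> q \<and> q < t \<and> run F c q l = n)"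
  unfolding cofv_alt lt_om1 by simp

lemma run_overflow: "overflow c t l \<Longrightarrow> run F c t l = 0"
  using wor.liminf_inf[OF wor_om1] run_lim unfolding overflow_def lb_run[symmetric] by metis

lemma run_not_overflow:
  assumes "limo t" "\<not> overflow c t l"
  shows "\<exists>s<t. \<forall>q. s \<le> q \<and> q < t \<longrightarrow> run F c t l \<le> run F c q l"
    and "\<And>s. s < t \<Longrightarrow> \<exists>q. s \<le> q \<and> q < t \<and> run F c q l = run F c t l"
proof -
  obtain s0 where s0: "s0 < t" using assms(1) by (auto simp: limo_def)
  obtain v where v: "lb {(a, b). a \<le> b} t (\<lambda>q. run F c q l) v" "cofv {(a, b). a \<le> b} t (\<lambda>q. run F c q l) v"
    using wor.liminf_cases[OF wor_om1, of s0 t "\<lambda>q. run F c q l"] s0 assms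
    unfolding overflow_def lb_run lt_om1 by blast
  have "run F c t l = v" using wor.liminf_fin[OF wor_om1 v] run_lim[OF assms(1)] by simp
  then show "\<exists>s<t. \<forall>q. s \<le> q \<and> q < t \<longrightarrow> run F c t l \<le> run F c q l"
    "\<And>s. s < t \<Longrightarrow> \<exists>q. s \<le> q \<and> q < t \<and> run F c q l = run F c t l"
    using v unfolding lb_run cofv_run by blast+
qed

lemma supp_run: "supp K c \<Longrightarrow> supp K (run F c t)"
proof (induction t rule: less_induct)
  case (less t)
  show ?case
  proof (cases t rule: om1_cases)
    case (2 p)
    then show ?thesis using less sc_gt F by simp
  next
    case 3
    have "run F c t l = 0" if "K \<le> l" for l
    proof -
      have "\<not> overflow c t l"
      proof
        assume "overflow c t l"
        then obtain s where "s < t" "1 \<le> run F c s l" unfolding overflow_def by (meson order_refl)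
        then show False using less that by (simp add: supp_def)
      qed
      moreover obtain s where "s < t" using 3 by (auto simp: limo_def)
      ultimately obtain q where "q < t" "run F c q l = run F c t l" using run_not_overflow(2)[OF 3] by blast
      then show ?thesis using less that by (simp add: supp_def)
    qed
    then show ?thesis by (simp add: supp_def)
  qed (use less in simp)
qed

lemma overflow_lt_K: "supp K c \<Longrightarrow> overflow c t l \<Longrightarrow> l < K"
proof (rule ccontr)
  assume c: "supp K c" and o: "overflow c t l" and "\<not> l < K"
  obtain s where "s < t" "1 \<le> run F c s l" using o unfolding overflow_def by (meson order_refl)
  then show False using supp_run[OF c] \<open>\<not> l < K\<close> by (simp add: supp_def)
qed

lemma B_limo: "t \<in> B c j \<Longrightarrow> limo t"
  by (induction j) (auto simp: overflow_def)

lemma B_mono: "i \<le> j \<Longrightarrow> B c j \<subseteq> B c i"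
  by (induction j) (auto simp: le_Suc_eq)

definition cov :: "cf \<Rightarrow> om1 \<Rightarrow> nat \<Rightarrow> bool" where
  "cov c t l \<longleftrightarrow> (\<forall>s<t. \<exists>q. s < q \<and> q < t \<and> overflow c q l)"

text \<open>An overflowing component is reset to \<open>0\<close>, so cofinally many overflows
  prevent it from tending to infinity.\<close>

lemma cov_not_overflow: "limo t \<Longrightarrow> cov c t l \<Longrightarrow> \<not> overflow c t l"
proof
  assume "limo t" "cov c t l" "overflow c t l"
  then obtain s where s: "s < t" "\<And>q. s \<le> q \<Longrightarrow> q < t \<Longrightarrow> 1 \<le> run F c q l" unfolding overflow_def by blast
  obtain q where "s < q" "q < t" "overflow c q l" using \<open>cov c t l\<close> s(1) unfolding cov_def by blast
  then show False using s(2)[of q] run_overflow by fastforce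
qed

text \<open>Beyond a suitable \<open>s\<close> before \<open>t\<close>, only components that
  overflow cofinally below \<open>t\<close> overflow at all. A point of \<open>B c j\<close> chosen
  there contributes more than \<open>j\<close> such components, and the component overflowing at
  \<open>t\<close> itself is a further one by \<open>cov_not_overflow\<close>.\<close>

lemma B_card:
  assumes c: "supp K c"
  shows "t \<in> B c j \<Longrightarrow> j < card {l. l < K \<and> (cov c t l \<or> overflow c t l)}"
proof (induction j arbitrary: t)
  case 0
  then obtain l where "overflow c t l" by auto
  then have "l \<in> {l. l < K \<and> (cov c t l \<or> overflow c t l)}" using overflow_lt_K[OF c] by blast
  then show ?case by (simp add: card_gt_0_iff) blast
next
  case (Suc j)
  let ?W = "{l. l < K \<and> cov c t l}"
  have t: "limo t" using Suc.prems B_limo by blast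
  obtain s0 where s0: "s0 < t" using t by (auto simp: limo_def)
  have "\<forall>l. \<exists>s. l \<in> {l. l < K \<and> \<not> cov c t l} \<longrightarrow> s < t \<and> (\<forall>q. s < q \<and> q < t \<longrightarrow> \<not> overflow c q l)"
    unfolding cov_def by blast
  then obtain f where f: "\<And>l. l \<in> {l. l < K \<and> \<not> cov c t l} \<Longrightarrow> f l < t \<and> (\<forall>q. f l < q \<and> q < t \<longrightarrow> \<not> overflow c q l)"
    by metis
  obtain s where s: "s < t" "\<And>l. l < K \<Longrightarrow> \<not> cov c t l \<Longrightarrow> f l \<le> s"
    using wor.max_fin[OF wor_om1, of s0 t "{l. l < K \<and> \<not> cov c t l}" f] s0 f unfolding lt_om1 by auto
  obtain q where q: "q \<in> B c j" "s < q" "q < t" using Suc.prems s(1) by auto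
  have "{l. l < K \<and> (cov c q l \<or> overflow c q l)} \<subseteq> ?W"
  proof
    fix l assume l: "l \<in> {l. l < K \<and> (cov c q l \<or> overflow c q l)}"
    show "l \<in> ?W"
    proof (rule ccontr)
      assume "l \<notin> ?W"
      then have nl: "l < K" "\<not> cov c t l" using l by auto
      then have no: "\<not> overflow c p l" if "s < p" "p < t" for p
        using f[of l] s(2)[of l] that by (auto dest: le_less_trans)
      then have "cov c q l" using l q by blast
      then obtain p where "s < p" "p < q" "overflow c p l" using q(2) unfolding cov_def by blast
      then show False using no[of p] q(3) by auto
    qed
  qed
  then have "card {l. l < K \<and> (cov c q l \<or> overflow c q l)} \<le> card ?W" by (intro card_mono) auto
  then have j: "j < card ?W" using Suc.IH[OF q(1)] by simp
  have "t \<in> B c 0" using Suc.prems B_mono[of 0 "Suc j"] by blast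
  then obtain l where l: "overflow c t l" by auto
  then have "l < K" using overflow_lt_K[OF c] by blast
  have "l \<notin> ?W" using cov_not_overflow[OF t] l by blast
  then have "card (insert l ?W) = Suc (card ?W)" by simp
  moreover have "card (insert l ?W) \<le> card {l. l < K \<and> (cov c t l \<or> overflow c t l)}"
    by (intro card_mono) (use l \<open>l < K\<close> in auto)
  ultimately show ?case using j by simp
qed

lemma B_K: "supp K c \<Longrightarrow> B c K = {}"
proof (rule ccontr)
  assume c: "supp K c" and "B c K \<noteq> {}"
  then obtain t where "t \<in> B c K" by blast
  then have "K < card {l. l < K \<and> (cov c t l \<or> overflow c t l)}" by (rule B_card[OF c])
  also have "\<dots> \<le> card {..<K}" by (intro card_mono) auto
  finally show False by simp
qed

text \<open>Time \<open>z0\<close> has to be excluded: \<open>s\<close> may be an overflow time of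
  the original run, whereas the start of the restarted run is no limit.\<close>

lemma overflow_shift:
  assumes "t \<noteq> z0"
  shows "overflow (run F c s) t l \<longleftrightarrow> overflow c (add s t) l"
proof -
  have zt: "z0 < t" using assms z0_le[of t] by (metis le_less)
  have "(\<exists>p<t. \<forall>q. p \<le> q \<and> q < t \<longrightarrow> n \<le> run F c (add s q) l) \<longleftrightarrow>
    (\<exists>p<add s t. \<forall>q. p \<le> q \<and> q < add s t \<longrightarrow> n \<le> run F c q l)" for n
  proof
    assume "\<exists>p<t. \<forall>q. p \<le> q \<and> q < t \<longrightarrow> n \<le> run F c (add s q) l"
    then obtain p where p: "p < t" "\<And>q. p \<le> q \<Longrightarrow> q < t \<Longrightarrow> n \<le> run F c (add s q) l" by blast
    show "\<exists>p<add s t. \<forall>q. p \<le> q \<and> q < add s t \<longrightarrow> n \<le> run F c q l"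
    proof (intro exI[of _ "add s p"] conjI allI impI)
      show "add s p < add s t" using p(1) by (rule add_less)
      fix q assume q: "add s p \<le> q \<and> q < add s t"
      then obtain q' where "q = add s q'" using add_surj add_ge order_trans by blast
      then show "n \<le> run F c q l" using p(2)[of q'] q by (simp add: add_le_iff add_less_iff)
    qed
  next
    assume "\<exists>p<add s t. \<forall>q. p \<le> q \<and> q < add s t \<longrightarrow> n \<le> run F c q l"
    then obtain p where p: "p < add s t" "\<And>q. p \<le> q \<Longrightarrow> q < add s t \<Longrightarrow> n \<le> run F c q l" by blast
    obtain p' where p': "max p s = add s p'" using add_surj[of s "max p s"] by auto
    have "max p s < add s t" using p(1) add_less[OF zt, of s] by simp
    then have "p' < t" by (simp add: p' add_less_iff)
    moreover have "n \<le> run F c (add s q) l" if "p' \<le> q" "q < t" for q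
    proof -
      have "add s p' \<le> add s q" using that(1) by (simp add: add_le_iff)
      then have "p \<le> add s q" using p' by (metis max.bounded_iff)
      then show ?thesis using p(2) that(2) add_less by blast
    qed
    ultimately show "\<exists>p<t. \<forall>q. p \<le> q \<and> q < t \<longrightarrow> n \<le> run F c (add s q) l" by blast
  qed
  then show ?thesis unfolding overflow_def run_shift add_limo[OF assms] by simp
qed

lemma B_shift: "t \<noteq> z0 \<Longrightarrow> t \<in> B (run F c s) j \<longleftrightarrow> add s t \<in> B c j"
proof (induction j arbitrary: t)
  case 0
  then show ?case using overflow_shift[of t c s] by auto
next
  case (Suc j)
  have zt: "z0 < t" using Suc.prems z0_le[of t] by (metis le_less)
  have "(\<forall>p<t. \<exists>q\<in>B (run F c s) j. p < q \<and> q < t) \<longleftrightarrow> (\<forall>p<add s t. \<exists>q\<in>B c j. p < q \<and> q < add s t)"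
  proof
    assume a: "\<forall>p<t. \<exists>q\<in>B (run F c s) j. p < q \<and> q < t"
    show "\<forall>p<add s t. \<exists>q\<in>B c j. p < q \<and> q < add s t"
    proof (intro allI impI)
      fix p assume "p < add s t"
      then have m: "max p s < add s t" using add_less[OF zt, of s] by simp
      obtain p' where p': "max p s = add s p'" using add_surj[of s "max p s"] by auto
      then have "p' < t" using m by (simp add: add_less_iff)
      then obtain q where q: "q \<in> B (run F c s) j" "p' < q" "q < t" using a by blast
      have "q \<noteq> z0" using q(2) z0_le leD by blast
      then have "add s q \<in> B c j" using Suc.IH q(1) by blast
      moreover have "p < add s q" using add_less[OF q(2), of s] p' by (metis max_less_iff_conj)
      ultimately show "\<exists>q\<in>B c j. p < q \<and> q < add s t" using add_less[OF q(3)] by blast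
    qed
  next
    assume a: "\<forall>p<add s t. \<exists>q\<in>B c j. p < q \<and> q < add s t"
    show "\<forall>p<t. \<exists>q\<in>B (run F c s) j. p < q \<and> q < t"
    proof (intro allI impI)
      fix p assume "p < t"
      then obtain q where q: "q \<in> B c j" "add s p < q" "q < add s t" using a add_less by blast
      obtain q' where q': "q = add s q'" using add_surj add_ge q(2) by (meson less_imp_le order_trans)
      then have "p < q'" "q' < t" using q by (simp_all add: add_less_iff)
      moreover have "q' \<noteq> z0" using \<open>p < q'\<close> z0_le leD by blast
      ultimately show "\<exists>q\<in>B (run F c s) j. p < q \<and> q < t" using Suc.IH q(1) q' by blast
    qed
  qed
  then show ?case using Suc by simp
qed

section \<open>Segments without overflow of a given level\<close>

text \<open>The start is exempt from the condition on \<open>B c j\<close>, since a configuration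
  does not remember how it was reached.\<close>

definition segm :: "nat \<Rightarrow> cf \<Rightarrow> cf \<Rightarrow> cf \<Rightarrow> bool" where
  "segm j c m d \<longleftrightarrow> supp K c \<and> (\<exists>t>z0. run F c t = d \<and> mn (run F c) z0 t m \<and> (\<forall>q. z0 < q \<and> q \<le> t \<longrightarrow> q \<notin> B c j))"

definition jump :: "nat \<Rightarrow> cf \<Rightarrow> cf \<Rightarrow> cf \<Rightarrow> bool" where
  "jump j c m d \<longleftrightarrow> supp K c \<and> (\<exists>t. t \<in> B c j \<and> run F c t = d \<and> mn (run F c) z0 t m \<and> (\<forall>q. z0 < q \<and> q < t \<longrightarrow> q \<notin> B c j))"

definition single :: "cf \<Rightarrow> cf \<Rightarrow> cf \<Rightarrow> bool" where
  "single c m d \<longleftrightarrow> supp K c \<and> m = c \<and> d = F c"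

text \<open>Building blocks of level-\<open>j\<close> segments. Where \<open>B c (Suc j)\<close> has
  no points, those of \<open>B c j\<close> do not accumulate, so each of them can be crossed by a
  single jump of level \<open>j\<close>.\<close>

fun Gen :: "nat \<Rightarrow> cf \<Rightarrow> cf \<Rightarrow> cf \<Rightarrow> bool" where
  "Gen 0 c m d \<longleftrightarrow> single c m d"
| "Gen (Suc j) c m d \<longleftrightarrow> segm j c m d \<or> jump j c m d"

text \<open>The last clause is the limit rule in local form. It speaks of one block with minimum
  \<open>v\<close> instead of \<omega> many: either the limit \<open>v\<close> is already provided,
  or a natural number drops, which can happen only finitely often. Closedness is thereby a condition
  on a few values of \<open>S\<close> and \<open>\<rho>\<close> at a time.\<close>

definition closed :: "(cf \<Rightarrow> cf \<Rightarrow> cf \<Rightarrow> bool) \<Rightarrow> (cf \<Rightarrow> cf \<Rightarrow> cf \<Rightarrow> bool) \<Rightarrow> (cf \<Rightarrow> cf \<Rightarrow> nat) \<Rightarrow> bool" where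
  "closed G S \<rho> \<longleftrightarrow> (\<forall>c m d. G c m d \<longrightarrow> S c m d) \<and>
     (\<forall>c m d m' e. S c m d \<and> S d m' e \<longrightarrow> S c (\<lambda>l. min (m l) (m' l)) e) \<and>
     (\<forall>c v e. S c v e \<longrightarrow> S c v v \<or> \<rho> e v < \<rho> c v)"

lemma mn_supp: "supp K c \<Longrightarrow> mn (run F c) s t m \<Longrightarrow> supp K m"
  unfolding mn_def using supp_run unfolding supp_def by metis

lemma segm_supp: "segm j c m d \<Longrightarrow> supp K c \<and> supp K m \<and> supp K d"
  unfolding segm_def using mn_supp supp_run by blast

lemma Gen_supp: "Gen j c m d \<Longrightarrow> supp K c \<and> supp K m \<and> supp K d"
  by (cases j) (auto simp: single_def F dest: segm_supp, (auto simp: jump_def supp_run mn_supp)+)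

lemma window:
  assumes "supp K c" "s < t" "mn (run F c) s t m"
  obtains t' where "t = add s t'" "t' > z0" "run F (run F c s) t' = run F c t" "mn (run F (run F c s)) z0 t' m"
proof -
  obtain t' where t': "t = add s t'" using add_surj[of s t] assms(2) less_imp_le by blast
  have "z0 < t'" using assms(2) add_less_iff[of s z0 t'] t' by simp
  then show thesis using that[OF t'] t' assms(3) by (simp add: run_shift mn_shift)
qed

lemma segm_window:
  assumes c: "supp K c" "s < t" "mn (run F c) s t m" and nb: "\<And>q. s < q \<Longrightarrow> q \<le> t \<Longrightarrow> q \<notin> B c j"
  shows "segm j (run F c s) m (run F c t)"
proof -
  obtain t' where t': "t = add s t'" "t' > z0" "run F (run F c s) t' = run F c t" "mn (run F (run F c s)) z0 t' m"
    using window[OF c] .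
  have "q \<notin> B (run F c s) j" if "z0 < q" "q \<le> t'" for q
    using nb[of "add s q"] add_less[OF that(1), of s] that B_shift[of q c s j] t'(1) by (auto simp: add_le_iff)
  then show ?thesis unfolding segm_def using t' supp_run[OF c(1)] by blast
qed

lemma jump_window:
  assumes c: "supp K c" "s < t" "mn (run F c) s t m" and t: "t \<in> B c j"
    and nb: "\<And>q. s < q \<Longrightarrow> q < t \<Longrightarrow> q \<notin> B c j"
  shows "jump j (run F c s) m (run F c t)"
proof -
  obtain t' where t': "t = add s t'" "t' > z0" "run F (run F c s) t' = run F c t" "mn (run F (run F c s)) z0 t' m"
    using window[OF c] .
  have "q \<notin> B (run F c s) j" if "z0 < q" "q < t'" for q
    using nb[of "add s q"] add_less[OF that(1), of s] that B_shift[of q c s j] t'(1) by (auto simp: add_less_iff)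
  moreover have "t' \<in> B (run F c s) j" using B_shift[of t' c s j] t'(1,2) t by auto
  ultimately show ?thesis unfolding jump_def using t' supp_run[OF c(1)] by blast
qed

lemma segm_times:
  assumes "segm j (run F c s) m e"
  obtains t where "s < t" "run F c t = e" "mn (run F c) s t m" "\<And>q. s < q \<Longrightarrow> q \<le> t \<Longrightarrow> q \<notin> B c j"
proof -
  obtain t' where t': "t' > z0" "run F (run F c s) t' = e" "mn (run F (run F c s)) z0 t' m"
    "\<And>q. z0 < q \<Longrightarrow> q \<le> t' \<Longrightarrow> q \<notin> B (run F c s) j" using assms unfolding segm_def by blast
  have "q \<notin> B c j" if q: "s < q" "q \<le> add s t'" for q
  proof -
    obtain q' where q': "q = add s q'" using add_surj[of s q] q(1) less_imp_le by blast
    then have "z0 < q'" "q' \<le> t'" using q add_less_iff[of s z0 q'] by (simp_all add: add_le_iff)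
    then show ?thesis using t'(4)[of q'] B_shift[of q' c s j] q' by auto
  qed
  moreover have "s < add s t'" using add_less[OF t'(1), of s] by simp
  ultimately show thesis using that[of "add s t'"] t' by (simp add: run_shift mn_shift)
qed

lemma segm_comp:
  assumes "segm j c m d" "segm j d m' e"
  shows "segm j c (\<lambda>l. min (m l) (m' l)) e"
proof -
  obtain t where t: "t > z0" "run F c t = d" "mn (run F c) z0 t m" "\<And>q. z0 < q \<Longrightarrow> q \<le> t \<Longrightarrow> q \<notin> B c j"
    and c: "supp K c" using assms(1) unfolding segm_def by blast
  have "segm j (run F c t) m' e" using assms(2) t(2) by simp
  then obtain t' where t': "t < t'" "run F c t' = e" "mn (run F c) t t' m'" "\<And>q. t < q \<Longrightarrow> q \<le> t' \<Longrightarrow> q \<notin> B c j"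
    using segm_times by blast
  have "mn (run F c) z0 t' (\<lambda>l. min (m l) (m' l))" using mn_comp t t' by blast
  moreover have "q \<notin> B c j" if "z0 < q" "q \<le> t'" for q
    using t(4)[of q] t'(4)[of q] that by (cases "q \<le> t") auto
  moreover have "z0 < t'" using t(1) t'(1) by auto
  ultimately show ?thesis unfolding segm_def using c t'(2) by blast
qed

lemma single_segm: "single c m d \<Longrightarrow> segm j c m d"
proof -
  assume a: "single c m d"
  have "q \<notin> B c j" if "z0 < q" "q \<le> sc z0" for q
  proof -
    have "q = sc z0" using that sc_le[of z0 q] by simp
    then show ?thesis using B_limo not_limo_sc by blast
  qed
  then show ?thesis unfolding segm_def using a sc_gt mn_step[of "run F c" z0] by (intro conjI exI[of _ "sc z0"]) (auto simp: single_def)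
qed

lemma segm_Suc: "segm j c m d \<Longrightarrow> segm (Suc j) c m d"
  unfolding segm_def by auto

text \<open>The first point of \<open>B c j\<close> is not a limit of such points, so it is not in
  the next derivative.\<close>

lemma jump_segm: "jump j c m d \<Longrightarrow> segm (Suc j) c m d"
proof -
  assume "jump j c m d"
  then obtain t where c: "supp K c" and t: "t \<in> B c j" "run F c t = d" "mn (run F c) z0 t m"
    "\<And>q. z0 < q \<Longrightarrow> q < t \<Longrightarrow> q \<notin> B c j" unfolding jump_def by blast
  have zt: "z0 < t" using B_limo[OF t(1)] not_limo_z0 z0_le[of t] by (metis le_less)
  have "q \<notin> B c (Suc j)" if "z0 < q" "q \<le> t" for q
  proof
    assume "q \<in> B c (Suc j)"
    then have "\<forall>s<q. \<exists>p\<in>B c j. s < p \<and> p < q" by simp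
    then obtain p where "p \<in> B c j" "z0 < p" "p < q" using \<open>z0 < q\<close> by blast
    then show False using t(4)[of p] that(2) by auto
  qed
  then show ?thesis unfolding segm_def using c zt t by blast
qed

lemma Gen_segm: "Gen j c m d \<Longrightarrow> segm j c m d"
  by (cases j) (auto simp: single_segm segm_Suc jump_segm simp del: B.simps)

lemma no_desc: "\<not> (\<forall>i. (f (Suc i) :: nat) < f i)"
  using wf_less wf_iff_no_infinite_down_chain[of "{(x, y :: nat). x < y}"] by auto

text \<open>Every segment is generated: a limit that is not an overflow time is reached by blocks with a common
  minimum \<open>v\<close>, along which \<open>\<rho>\<close> would decrease forever unless the limit step is present.\<close>

lemma segm_closed:
  assumes cl: "closed (Gen j) S \<rho>" and c: "supp K c"
  shows "s < t \<Longrightarrow> mn (run F c) s t m \<Longrightarrow> (\<And>q. s < q \<Longrightarrow> q \<le> t \<Longrightarrow> q \<notin> B c j) \<Longrightarrow> S (run F c s) m (run F c t)"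
proof (induction t arbitrary: s m rule: less_induct)
  case (less t)
  have gen: "\<And>c m d. Gen j c m d \<Longrightarrow> S c m d"
    and comp: "\<And>c m d m' e. S c m d \<Longrightarrow> S d m' e \<Longrightarrow> S c (\<lambda>l. min (m l) (m' l)) e"
    and rho: "\<And>c v e. S c v e \<Longrightarrow> S c v v \<or> \<rho> e v < \<rho> c v" using cl unfolding closed_def by blast+
  have stS: "S (run F c p) (run F c p) (run F c (sc p))" for p
  proof -
    have "single (run F c p) (run F c p) (run F c (sc p))" using supp_run[OF c] by (simp add: single_def)
    then have "Gen j (run F c p) (run F c p) (run F c (sc p))" by (cases j) (auto intro: single_segm)
    then show ?thesis by (rule gen)
  qed
  \<comment> \<open>It suffices to treat some final stretch from \<open>p\<close> to
    \<open>t\<close>; the part before \<open>p\<close> falls under the induction hypothesis, and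
    minima are unique.\<close>
  have glue: ?case if p: "s \<le> p" "p < t" and S: "S (run F c p) m' (run F c t)" and m': "mn (run F c) p t m'" for p m'
  proof (cases "s = p")
    case True
    then show ?thesis using S m' less.prems(2) mn_unique by metis
  next
    case False
    then have sp: "s < p" using p by simp
    obtain m1 where m1: "mn (run F c) s p m1" using mn_ex[OF sp] by blast
    have "S (run F c s) m1 (run F c p)" using less.IH[OF p(2) sp m1] less.prems(3) p(2) by auto
    then have "S (run F c s) (\<lambda>l. min (m1 l) (m' l)) (run F c t)" using comp S by blast
    moreover have "mn (run F c) s t (\<lambda>l. min (m1 l) (m' l))" using mn_comp[OF m1 m' sp p(2)] .
    ultimately show ?thesis using less.prems(2) mn_unique by metis
  qed
  show ?case
  proof (cases t rule: om1_cases)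
    case 1
    then show ?thesis using less.prems(1) z0_le leD by blast
  next
    case (2 p)
    then have "s \<le> p" using less.prems(1) by (simp add: less_sc)
    then show ?thesis using glue[of p "run F c p"] stS[of p] mn_step[of "run F c" p] sc_gt 2 by simp
  next
    case 3
    show ?thesis
    proof (cases "t \<in> B c 0")
      case True
      have tj: "t \<notin> B c j" using less.prems(3)[of t] less.prems(1) by simp
      \<comment> \<open>With \<open>i = Suc i'\<close>, the time \<open>t\<close> is an isolated
        point of \<open>B c i'\<close>, so a short final stretch before it is a jump of level
        \<open>i'\<close>. This is a generator if \<open>i = j\<close>; otherwise it is part of a
        segment of the level preceding \<open>j\<close>, again a generator.\<close>
      define i where "i = (LEAST i. t \<notin> B c i)"
      have i: "t \<notin> B c i" unfolding i_def using tj by (rule LeastI)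
      have ij: "i \<le> j" unfolding i_def using tj by (rule Least_le)
      obtain i' where i': "i = Suc i'" using i True by (cases i) auto
      have ti': "t \<in> B c i'" using not_less_Least[of i' "\<lambda>i. t \<notin> B c i"] i' unfolding i_def by auto
      obtain s0 where s0: "s0 < t" "\<And>q. s0 < q \<Longrightarrow> q < t \<Longrightarrow> q \<notin> B c i'" using i ti' i' by auto
      let ?p = "max s s0"
      have p: "?p < t" using s0 less.prems(1) by simp
      obtain m' where m': "mn (run F c) ?p t m'" using mn_ex[OF p] by blast
      have jw: "jump i' (run F c ?p) m' (run F c t)" by (rule jump_window[OF c p m' ti']) (use s0(2) in auto)
      have "Gen j (run F c ?p) m' (run F c t)"
      proof (cases "i = j")
        case True
        then show ?thesis using jw i' by auto
      next
        case False
        then obtain j' where j': "j = Suc j'" "i \<le> j'" using ij by (cases j) auto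
        have "segm j' (run F c ?p) m' (run F c t)"
        proof (rule segm_window[OF c p m'])
          fix q assume q: "?p < q" "q \<le> t"
          have "q \<notin> B c i" using q i s0(2)[of q] i' by (cases "q = t") auto
          then show "q \<notin> B c j'" using B_mono[OF j'(2)] by blast
        qed
        then show ?thesis using j'(1) by simp
      qed
      then show ?thesis using glue[of ?p m'] gen m' p by auto
    next
      case False
      let ?v = "run F c t"
      have nov: "\<not> overflow c t l" for l using False by auto
      have "\<forall>l. \<exists>p<t. \<forall>q. p \<le> q \<and> q < t \<longrightarrow> ?v l \<le> run F c q l" using run_not_overflow(1)[OF 3 nov] by blast
      then obtain f where f: "\<And>l. f l < t" "\<And>l q. f l \<le> q \<Longrightarrow> q < t \<Longrightarrow> ?v l \<le> run F c q l" by metis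
      obtain s0 where s0: "s0 < t" "s \<le> s0" "\<And>l. l < K \<Longrightarrow> f l \<le> s0"
        using wor.max_fin[OF wor_om1, of s t "{..<K}" f] less.prems(1) f(1) unfolding lt_om1 by auto
      have z: "run F c q l = 0" if "K \<le> l" for q l using supp_run[OF c, of q] that by (simp add: supp_def)
      have lo: "?v l \<le> run F c q l" if "s0 \<le> q" "q < t" for q l
        using f(2)[of l q] s0(3)[of l] that z[of l] by (cases "l < K") auto
      have nxt: "\<exists>p'. p < p' \<and> p' < t \<and> mn (run F c) p p' ?v" if p: "s0 \<le> p" "p < t" for p
      proof -
        have "\<forall>l. \<exists>q. p \<le> q \<and> q < t \<and> run F c q l = ?v l" using run_not_overflow(2)[OF 3 nov] p(2) by blast
        then obtain h where h: "\<And>l. p \<le> h l" "\<And>l. h l < t" "\<And>l. run F c (h l) l = ?v l" by metis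
        obtain b where b: "b < t" "p \<le> b" "\<And>l. l < K \<Longrightarrow> h l \<le> b"
          using wor.max_fin[OF wor_om1, of p t "{..<K}" h] p(2) h(2) unfolding lt_om1 by auto
        obtain p' where p': "b < p'" "p' < t" using 3 b(1) by (auto simp: limo_def)
        have "mn (run F c) p p' ?v"
          unfolding mn_def
        proof (intro allI conjI impI)
          fix l q assume "p \<le> q \<and> q < p'"
          then show "?v l \<le> run F c q l" using lo[of q l] p p'(2) by auto
        next
          fix l
          show "\<exists>q. p \<le> q \<and> q < p' \<and> run F c q l = ?v l"
          proof (cases "l < K")
            case True
            then show ?thesis using h b(3)[of l] p'(1) le_less_trans by blast
          next
            case False
            then show ?thesis using z[of l p] z[of l t] b(2) p'(1) by (intro exI[of _ p]) auto
          qed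
        qed
        then show ?thesis using le_less_trans[OF b(2) p'(1)] p'(2) by blast
      qed
      have "\<exists>g. \<forall>n. ((s0 \<le> g n \<and> g n < t) \<and> (n = 0 \<longrightarrow> g n = s0)) \<and> (g n < g (Suc n) \<and> mn (run F c) (g n) (g (Suc n)) ?v)"
      proof (rule dependent_nat_choice)
        show "\<exists>x. (s0 \<le> x \<and> x < t) \<and> (0 = (0::nat) \<longrightarrow> x = s0)" using s0 by blast
        fix x and n :: nat assume "(s0 \<le> x \<and> x < t) \<and> (n = 0 \<longrightarrow> x = s0)"
        then have x: "s0 \<le> x" "x < t" by auto
        then show "\<exists>y. ((s0 \<le> y \<and> y < t) \<and> (Suc n = 0 \<longrightarrow> y = s0)) \<and> x < y \<and> mn (run F c) x y ?v"
          using nxt[OF x] x(1) less_imp_le order_trans by blast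
      qed
      then obtain g where g: "\<And>n. s0 \<le> g n" "\<And>n. g n < t" "g 0 = s0" "\<And>n. g n < g (Suc n)"
        "\<And>n. mn (run F c) (g n) (g (Suc n)) ?v" by blast
      have nb: "q \<notin> B c j" if "s0 < q" "q \<le> t" for q using less.prems(3)[of q] that s0(2) by auto
      have blk: "S (run F c (g n)) ?v (run F c (g (Suc n)))" for n
      proof (rule less.IH[OF g(2) g(4) g(5)])
        fix q assume q: "g n < q" "q \<le> g (Suc n)"
        have "s0 < q" using g(1)[of n] q(1) by auto
        moreover have "q \<le> t" using q(2) g(2)[of "Suc n"] by auto
        ultimately show "q \<notin> B c j" by (rule nb)
      qed
      have Sn: "S (run F c s0) ?v (run F c (g (Suc n)))" for n
      proof (induction n)
        case 0
        then show ?case using blk[of 0] g(3) by simp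
      next
        case (Suc n)
        then show ?case using comp[OF Suc blk[of "Suc n"]] by simp
      qed
      have Svv: "S (run F c s0) ?v ?v"
      proof (rule ccontr)
        assume no: "\<not> S (run F c s0) ?v ?v"
        have non: "\<not> S (run F c (g n)) ?v ?v" for n
        proof (cases n)
          case 0
          then show ?thesis using no g(3) by simp
        next
          case (Suc k)
          then show ?thesis using comp[OF Sn[of k], of ?v ?v] no by auto
        qed
        have "\<rho> (run F c (g (Suc n))) ?v < \<rho> (run F c (g n)) ?v" for n using rho[OF blk] non by blast
        then show False using no_desc[of "\<lambda>n. \<rho> (run F c (g n)) ?v"] by blast
      qed
      have "mn (run F c) s0 t ?v"
        unfolding mn_def
      proof (intro allI conjI impI)
        show "\<And>l q. s0 \<le> q \<and> q < t \<Longrightarrow> ?v l \<le> run F c q l" using lo by blast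
        show "\<And>l. \<exists>q. s0 \<le> q \<and> q < t \<and> run F c q l = ?v l" using run_not_overflow(2)[OF 3 nov s0(1)] by blast
      qed
      then show ?thesis using glue[OF s0(2,1) Svv] by blast
    qed
  qed
qed

text \<open>Chains of \<open>n\<close> blocks with the same minimum \<open>v\<close>. The predicate
  \<open>CT\<close> below lists the possible end times of such chains in the run.\<close>

primrec chain :: "nat \<Rightarrow> nat \<Rightarrow> cf \<Rightarrow> cf \<Rightarrow> bool" where
  "chain j 0 c v \<longleftrightarrow> True"
| "chain j (Suc n) c v \<longleftrightarrow> (\<exists>e. segm j c v e \<and> chain j n e v)"

primrec CT :: "nat \<Rightarrow> cf \<Rightarrow> cf \<Rightarrow> nat \<Rightarrow> om1 \<Rightarrow> bool" where
  "CT j c v 0 t \<longleftrightarrow> t = z0"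
| "CT j c v (Suc n) t \<longleftrightarrow> (\<exists>s<t. CT j c v n s \<and> mn (run F c) s t v \<and> (\<forall>q. s < q \<and> q \<le> t \<longrightarrow> q \<notin> B c j))"

lemma chain_CT: "chain j n (run F c s) v \<Longrightarrow> CT j c v k s \<Longrightarrow> \<exists>t. CT j c v (k + n) t"
proof (induction n arbitrary: s k)
  case (Suc n)
  then obtain e where e: "segm j (run F c s) v e" "chain j n e v" by auto
  obtain t where t: "s < t" "run F c t = e" "mn (run F c) s t v" "\<And>q. s < q \<Longrightarrow> q \<le> t \<Longrightarrow> q \<notin> B c j"
    using segm_times[OF e(1)] by blast
  have "CT j c v (Suc k) t" using Suc.prems(2) t by auto
  then show ?case using Suc.IH[of t "Suc k"] e(2) t(2) by auto
qed auto

lemma CT_lower: "CT j c v n t \<Longrightarrow> q < t \<Longrightarrow> v l \<le> run F c q l"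
proof (induction n arbitrary: t)
  case 0
  then show ?case using z0_le leD by auto
next
  case (Suc n)
  then obtain s where s: "CT j c v n s" "mn (run F c) s t v" by auto
  then show ?case using Suc.IH[OF s(1)] s(2) Suc.prems(2) unfolding mn_def by (cases "q < s") auto
qed

lemma CT_B: "CT j c v n t \<Longrightarrow> z0 < q \<Longrightarrow> q \<le> t \<Longrightarrow> q \<notin> B c j"
proof (induction n arbitrary: t)
  case 0
  then show ?case by auto
next
  case (Suc n)
  then obtain s where s: "CT j c v n s" "\<forall>q. s < q \<and> q \<le> t \<longrightarrow> q \<notin> B c j" by auto
  then show ?case using Suc.IH[OF s(1)] s(2) Suc.prems by (cases "q \<le> s") auto
qed

text \<open>Chains of different lengths need not extend each other. The least end times
  \<open>T n\<close> are compatible nevertheless: the last but one time of a chain of length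
  \<open>Suc n\<close> is at least \<open>T n\<close>, and nothing in between falls below
  \<open>v\<close>. The configuration at the supremum of the \<open>T n\<close> is
  \<open>v\<close>.\<close>

lemma chain_segm:
  assumes c: "supp K c" and chain: "\<And>n. chain j n c v"
  shows "segm j c v v"
proof -
  have ex: "\<exists>t. CT j c v n t" for n using chain_CT[of j n c z0 v 0] chain by simp
  define T where "T n = (LEAST t. CT j c v n t)" for n
  have T: "CT j c v n (T n)" for n unfolding T_def using ex by (rule LeastI_ex)
  have Tle: "CT j c v n t \<Longrightarrow> T n \<le> t" for n t unfolding T_def by (rule Least_le)
  have step: "T n < T (Suc n) \<and> mn (run F c) (T n) (T (Suc n)) v" for n
  proof -
    obtain s where s: "s < T (Suc n)" "CT j c v n s" "mn (run F c) s (T (Suc n)) v" using T[of "Suc n"] by auto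
    have le: "T n \<le> s" using Tle[OF s(2)] .
    have "mn (run F c) (T n) (T (Suc n)) v"
      using s(3) CT_lower[OF T[of "Suc n"]] le unfolding mn_def by (meson order_trans)
    then show ?thesis using le s(1) by auto
  qed
  have T0: "T 0 = z0" using T[of 0] by simp
  obtain t where t: "\<And>i. T i < t" "\<And>q. q < t \<Longrightarrow> \<exists>i. q < T i" "limo t"
    using om1_sup[of T] step by blast
  have inc: "\<And>i. T i < T (Suc i)" and mnT: "\<And>i. mn (run F c) (T i) (T (Suc i)) v" using step by auto
  have "run F c t = v"
  proof
    fix l
    have "run F c t l = slim (\<lambda>i. v l)" using lim_blocks(1)[OF inc t(1,2) mnT] run_lim[OF t(3)] by simp
    also have "\<dots> = v l" by (rule slim_fin[of 0]) auto
    finally show "run F c t l = v l" .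
  qed
  moreover have "mn (run F c) z0 t v" using lim_blocks(2)[OF inc t(1,2) mnT] T0 by (simp add: Least_equality)
  moreover have "q \<notin> B c j" if "z0 < q" "q \<le> t" for q
  proof (cases "q = t")
    case True
    have "\<not> overflow c t l" for l
    proof
      assume "overflow c t l"
      then obtain s where s: "s < t" "\<And>q. s \<le> q \<Longrightarrow> q < t \<Longrightarrow> Suc (v l) \<le> run F c q l" unfolding overflow_def by blast
      obtain i where i: "s < T i" using t(2) s(1) by blast
      obtain q where q: "T i \<le> q" "q < T (Suc i)" "run F c q l = v l" using mnT[of i] unfolding mn_def by metis
      have "s \<le> q" using i q(1) by auto
      moreover have "q < t" using q(2) t(1) less_trans by blast
      ultimately show False using s(2)[of q] q(3) by simp
    qed
    then have "t \<notin> B c 0" by simp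
    then show ?thesis using True B_mono[of 0 j c] by blast
  next
    case False
    then have "q < t" using that(2) by simp
    then obtain i where "q < T i" using t(2) by blast
    then show ?thesis using CT_B[OF T[of i] that(1)] by simp
  qed
  moreover have "z0 < t" using t(1)[of 0] T0 by simp
  ultimately show ?thesis unfolding segm_def using c by blast
qed

text \<open>\<open>\<rho> c v\<close> is the least length for which no chain from \<open>c\<close>
  with minimum \<open>v\<close> exists. Passing one block shortens the remaining chains, so the
  value drops; if chains of all lengths exist, \<open>chain_segm\<close> supplies the limit.\<close>

lemma closed_segm: "\<exists>\<rho>. closed (Gen j) (segm j) \<rho>"
proof -
  define \<rho> where "\<rho> c v = (LEAST n. \<not> chain j n c v)" for c v
  have "\<rho> e v < \<rho> c v" if a: "segm j c v e" "\<not> segm j c v v" for c v e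
  proof -
    have "\<exists>n. \<not> chain j n c v" using chain_segm[of c j v] a segm_supp by blast
    then have n: "\<not> chain j (\<rho> c v) c v" unfolding \<rho>_def by (rule LeastI_ex)
    then obtain n where n': "\<rho> c v = Suc n" by (cases "\<rho> c v") auto
    then have "\<not> chain j n e v" using n a(1) by auto
    then have "\<rho> e v \<le> n" unfolding \<rho>_def by (rule Least_le)
    then show ?thesis using n' by simp
  qed
  then have "closed (Gen j) (segm j) \<rho>" unfolding closed_def using Gen_segm segm_comp by blast
  then show ?thesis by blast
qed

text \<open>Segments of level \<open>j\<close> are the least closed relation over the generators.
  The only higher quantifiers range over \<open>S\<close> and \<open>\<rho>\<close>, and times have
  disappeared.\<close>

theorem segm_iff: "segm j c m d \<longleftrightarrow> supp K c \<and> (\<forall>S \<rho>. closed (Gen j) S \<rho> \<longrightarrow> S c m d)"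
proof
  assume a: "segm j c m d"
  then obtain t where t: "t > z0" "run F c t = d" "mn (run F c) z0 t m" "\<And>q. z0 < q \<Longrightarrow> q \<le> t \<Longrightarrow> q \<notin> B c j"
    and c: "supp K c" unfolding segm_def by blast
  have "S c m d" if "closed (Gen j) S \<rho>" for S \<rho>
    using segm_closed[OF that c t(1,3)] t(2,4) by simp
  then show "supp K c \<and> (\<forall>S \<rho>. closed (Gen j) S \<rho> \<longrightarrow> S c m d)" using c by blast
qed (use closed_segm in blast)

section \<open>Definability of overflow jumps\<close>

text \<open>Before the next point of \<open>B c j\<close>, component \<open>l\<close> takes a value
  at most \<open>n\<close>. Since the start belongs to every segment, its own value counts.\<close>

definition visits_le :: "nat \<Rightarrow> cf \<Rightarrow> nat \<Rightarrow> nat \<Rightarrow> bool" where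
  "visits_le j c l n \<longleftrightarrow> (\<exists>m d. segm j c m d \<and> m l \<le> n)"

definition liminf_ge :: "nat \<Rightarrow> cf \<Rightarrow> nat \<Rightarrow> nat \<Rightarrow> bool" where
  "liminf_ge j c l n \<longleftrightarrow> (\<exists>d. (d = c \<or> (\<exists>m. segm j c m d)) \<and> \<not> (\<exists>n'<n. visits_le j d l n'))"

text \<open>A jump described by number quantifiers over segments of the same level: some component
  tends to infinity, \<open>d\<close> consists of the lower limits with default \<open>0\<close>,
  and \<open>m\<close> of the least values visited.\<close>

definition jpd :: "nat \<Rightarrow> cf \<Rightarrow> cf \<Rightarrow> cf \<Rightarrow> bool" where
  "jpd j c m d \<longleftrightarrow> supp K c \<and> supp K m \<and> supp K d \<and> (\<exists>l<K. \<forall>n. liminf_ge j c l n) \<and>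
     (\<forall>l<K. ((\<forall>n. liminf_ge j c l n) \<and> d l = 0) \<or> (liminf_ge j c l (d l) \<and> \<not> liminf_ge j c l (Suc (d l)))) \<and>
     (\<forall>l<K. visits_le j c l (m l) \<and> (\<forall>n<m l. \<not> visits_le j c l n))"

text \<open>\<open>P\<close> abstracts from the time range before the next point of
  \<open>B c j\<close>. It is used for the times before the first such point, and for all times when
  there is none.\<close>

lemma visits_le_run:
  assumes c: "supp K c" and nb: "\<And>q. s < q \<Longrightarrow> P q \<Longrightarrow> q \<notin> B c j"
    and Psc: "\<And>q. s \<le> q \<Longrightarrow> (q = s \<or> P q) \<Longrightarrow> P (sc q)"
    and Pd: "\<And>q q'. P q \<Longrightarrow> q' \<le> q \<Longrightarrow> P q'"
    and P: "\<And>q. s < q \<Longrightarrow> (\<And>p. s < p \<Longrightarrow> p \<le> q \<Longrightarrow> p \<notin> B c j) \<Longrightarrow> P q"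
  shows "visits_le j (run F c s) l n \<longleftrightarrow> (\<exists>q. s \<le> q \<and> (q = s \<or> P q) \<and> run F c q l \<le> n)"
proof
  assume "visits_le j (run F c s) l n"
  then obtain m e where me: "segm j (run F c s) m e" "m l \<le> n" unfolding visits_le_def by blast
  obtain t where t: "s < t" "mn (run F c) s t m" "\<And>q. s < q \<Longrightarrow> q \<le> t \<Longrightarrow> q \<notin> B c j" using segm_times[OF me(1)] by metis
  obtain q where q: "s \<le> q" "q < t" "run F c q l = m l" using t(2) unfolding mn_def by metis
  have "P q" using Pd[of t q] P[OF t(1,3)] q(2) by simp
  then show "\<exists>q. s \<le> q \<and> (q = s \<or> P q) \<and> run F c q l \<le> n" using q me(2) by auto
next
  assume "\<exists>q. s \<le> q \<and> (q = s \<or> P q) \<and> run F c q l \<le> n"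
  then obtain q where q: "s \<le> q" "q = s \<or> P q" "run F c q l \<le> n" by blast
  have sq: "s < sc q" using q(1) by (simp add: less_sc)
  obtain m where m: "mn (run F c) s (sc q) m" using mn_ex[OF sq] by blast
  have "segm j (run F c s) m (run F c (sc q))"
  proof (rule segm_window[OF c sq m])
    fix p assume "s < p" "p \<le> sc q"
    then show "p \<notin> B c j" using nb[of p] Pd[OF Psc[OF q(1,2)]] by blast
  qed
  moreover have "m l \<le> run F c q l" using m q(1) sc_gt unfolding mn_def by blast
  ultimately show "visits_le j (run F c s) l n" unfolding visits_le_def using q(3) by (meson le_trans)
qed

lemma jump_iff: "jump j c m d \<longleftrightarrow> jpd j c m d"
proof (cases "supp K c \<and> (\<exists>t. t \<in> B c j)")
  case True
  then have c: "supp K c" by blast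
  define t where "t = (LEAST t. t \<in> B c j)"
  have t: "t \<in> B c j" unfolding t_def using True by (metis LeastI)
  have nt: "q \<notin> B c j" if "q < t" for q using that not_less_Least unfolding t_def by blast
  have lt: "limo t" using B_limo[OF t] .
  have zt: "z0 < t" using lt not_limo_z0 z0_le[of t] by (metis le_less)
  have visits_le: "visits_le j (run F c s) l n \<longleftrightarrow> (\<exists>q. s \<le> q \<and> q < t \<and> run F c q l \<le> n)" if s: "s < t" for s l n
  proof -
    have "visits_le j (run F c s) l n \<longleftrightarrow> (\<exists>q. s \<le> q \<and> (q = s \<or> q < t) \<and> run F c q l \<le> n)"
    proof (rule visits_le_run[OF c])
      show "\<And>q. s \<le> q \<Longrightarrow> q = s \<or> q < t \<Longrightarrow> sc q < t" using limo_sc[OF lt] s by blast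
      fix q assume q: "s < q" "\<And>p. s < p \<Longrightarrow> p \<le> q \<Longrightarrow> p \<notin> B c j"
      then show "q < t" using t s by (meson not_le)
    qed (use nt in auto)
    then show ?thesis using s by auto
  qed
  have reach: "(d' = c \<or> (\<exists>m. segm j c m d')) \<longleftrightarrow> (\<exists>s<t. d' = run F c s)" for d'
  proof
    assume "d' = c \<or> (\<exists>m. segm j c m d')"
    then show "\<exists>s<t. d' = run F c s"
    proof
      assume "\<exists>m. segm j c m d'"
      then obtain s where s: "z0 < s" "run F c s = d'" "\<And>q. z0 < q \<Longrightarrow> q \<le> s \<Longrightarrow> q \<notin> B c j" unfolding segm_def by blast
      have "s < t" using s(3)[OF zt] t by (meson not_le)
      then show ?thesis using s by blast
    qed (use zt run_z0 in metis)
  next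
    assume "\<exists>s<t. d' = run F c s"
    then obtain s where s: "s < t" "d' = run F c s" by blast
    show "d' = c \<or> (\<exists>m. segm j c m d')"
    proof (cases "s = z0")
      case False
      then have zs: "z0 < s" using z0_le[of s] by (metis le_less)
      obtain m where m: "mn (run F c) z0 s m" using mn_ex[OF zs] by blast
      have "segm j (run F c z0) m (run F c s)" by (rule segm_window[OF c zs m]) (use nt s(1) in auto)
      then show ?thesis using s(2) by auto
    qed (use s in simp)
  qed
  have liminf_ge: "liminf_ge j c l n \<longleftrightarrow> (\<exists>s<t. \<forall>q. s \<le> q \<and> q < t \<longrightarrow> n \<le> run F c q l)" for l n
  proof -
    have "liminf_ge j c l n \<longleftrightarrow> (\<exists>s<t. \<not> (\<exists>n'<n. visits_le j (run F c s) l n'))" unfolding liminf_ge_def reach by blast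
    also have "\<dots> \<longleftrightarrow> (\<exists>s<t. \<forall>q. s \<le> q \<and> q < t \<longrightarrow> n \<le> run F c q l)"
    proof (intro ex_cong1 conj_cong refl)
      fix s assume s: "s < t"
      show "(\<not> (\<exists>n'<n. visits_le j (run F c s) l n')) \<longleftrightarrow> (\<forall>q. s \<le> q \<and> q < t \<longrightarrow> n \<le> run F c q l)"
        unfolding visits_le[OF s] by (meson le_less_trans not_le order_refl)
    qed
    finally show ?thesis .
  qed
  have ovl: "(\<forall>n. liminf_ge j c l n) \<longleftrightarrow> overflow c t l" for l unfolding liminf_ge overflow_def using lt by simp
  have dl: "(((\<forall>n. liminf_ge j c l n) \<and> a = 0) \<or> (liminf_ge j c l a \<and> \<not> liminf_ge j c l (Suc a))) \<longleftrightarrow> a = run F c t l" for l a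
  proof (cases "overflow c t l")
    case True
    then show ?thesis using ovl[of l] run_overflow[OF True] by auto
  next
    case False
    obtain s where s: "s < t" "\<forall>q. s \<le> q \<and> q < t \<longrightarrow> run F c t l \<le> run F c q l" using run_not_overflow(1)[OF lt False] by blast
    have 1: "liminf_ge j c l n" if "n \<le> run F c t l" for n unfolding liminf_ge using s that le_trans by blast
    have 2: "\<not> liminf_ge j c l n" if "run F c t l < n" for n
    proof
      assume "liminf_ge j c l n"
      then obtain s where "s < t" "\<forall>q. s \<le> q \<and> q < t \<longrightarrow> n \<le> run F c q l" unfolding liminf_ge by blast
      then show False using run_not_overflow(2)[OF lt False, of s] that by auto
    qed
    show ?thesis using False ovl[of l] 1 2 by (metis Suc_leI lessI linorder_neqE_nat not_le order_refl)
  qed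
  obtain m0 where m0: "mn (run F c) z0 t m0" using mn_ex[OF zt] by blast
  have ml: "(visits_le j c l a \<and> (\<forall>n<a. \<not> visits_le j c l n)) \<longleftrightarrow> a = m0 l" for l a
  proof -
    have "visits_le j c l n \<longleftrightarrow> m0 l \<le> n" for n
      using visits_le[OF zt, of l n] m0 z0_le unfolding mn_def by (metis le_trans order_refl run_z0)
    then show ?thesis by (metis linorder_neqE_nat not_le order_refl)
  qed
  have sm: "supp K m0" "supp K (run F c t)" using mn_supp[OF c m0] supp_run[OF c] by auto
  have ext: "(\<forall>l<K. a l = b l) \<longleftrightarrow> a = b" if "supp K a" "supp K b" for a b
    using that unfolding supp_def fun_eq_iff by (metis not_le)
  have "jpd j c m d \<longleftrightarrow> m = m0 \<and> d = run F c t"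
  proof -
    have "t \<in> B c 0" using t B_mono[of 0 j c] by blast
    then obtain l where "overflow c t l" by auto
    then have "\<exists>l<K. \<forall>n. liminf_ge j c l n" unfolding ovl using overflow_lt_K[OF c] by blast
    then have "jpd j c m d \<longleftrightarrow> supp K m \<and> supp K d \<and> (\<forall>l<K. d l = run F c t l) \<and> (\<forall>l<K. m l = m0 l)"
      unfolding jpd_def dl ml using c by blast
    then show ?thesis using ext sm by metis
  qed
  moreover have "jump j c m d \<longleftrightarrow> m = m0 \<and> d = run F c t"
  proof
    assume "jump j c m d"
    then obtain t' where t': "t' \<in> B c j" "run F c t' = d" "mn (run F c) z0 t' m" "\<And>q. z0 < q \<Longrightarrow> q < t' \<Longrightarrow> q \<notin> B c j"
      unfolding jump_def by blast
    have "t' = t" using nt[of t'] t'(4)[OF zt] t t'(1) by (metis linorder_neqE)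
    then show "m = m0 \<and> d = run F c t" using t' m0 mn_unique by blast
  qed (use c t m0 nt in \<open>auto simp: jump_def\<close>)
  ultimately show ?thesis by simp
next
  case False
  show ?thesis
  proof
    assume "jump j c m d"
    then show "jpd j c m d" using False unfolding jump_def by blast
  next
    assume a: "jpd j c m d"
    then have c: "supp K c" and no: "\<And>t. t \<notin> B c j" using False unfolding jpd_def by blast+
    obtain l where l: "\<And>n. liminf_ge j c l n" using a unfolding jpd_def by blast
    \<comment> \<open>Without a point of \<open>B c j\<close>, component \<open>l\<close> would tend
      to infinity along all of \<omega>_1. The countably many thresholds have a common bound
      \<open>b\<close>, where the component would have to exceed every number, including its own
      value.\<close>
    have "\<forall>n. \<exists>s. \<forall>q\<ge>s. n \<le> run F c q l"
    proof
      fix n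
      obtain d' where d': "d' = c \<or> (\<exists>m. segm j c m d')" "\<not> (\<exists>n'<n. visits_le j d' l n')" using l[of n] unfolding liminf_ge_def by blast
      have "\<exists>s. d' = run F c s" using d'(1) unfolding segm_def by (metis run_z0)
      then obtain s where s: "d' = run F c s" by blast
      have "visits_le j (run F c s) l n' \<longleftrightarrow> (\<exists>q. s \<le> q \<and> (q = s \<or> True) \<and> run F c q l \<le> n')" for n'
        by (rule visits_le_run[OF c]) (use no in auto)
      then have "\<forall>q\<ge>s. n \<le> run F c q l" using d'(2) s by (metis not_le order_refl)
      then show "\<exists>s. \<forall>q\<ge>s. n \<le> run F c q l" by blast
    qed
    then obtain s where s: "\<And>n q. s n \<le> q \<Longrightarrow> n \<le> run F c q l" by metis
    obtain b where "\<And>n. s n < b" using om1_seq_bdd by blast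
    then have "Suc (run F c b l) \<le> run F c b l" using s[of _ b] by (meson less_imp_le)
    then show "jump j c m d" by simp
  qed
qed

end

section \<open>Coding configurations\<close>

primrec ecd :: "nat \<Rightarrow> cf \<Rightarrow> nat" where
  "ecd 0 c = 0"
| "ecd (Suc k) c = pr (c 0) (ecd k (\<lambda>l. c (Suc l)))"

text \<open>Exactly the numbers produced by \<open>ecd K\<close>, that is, \<open>K\<close> entries
  followed by \<open>0\<close>. On them coding and decoding are inverse to each other.\<close>

definition val :: "nat \<Rightarrow> nat \<Rightarrow> bool" where "val K n \<longleftrightarrow> (p2 ^^ K) n = 0"

definition dcd :: "nat \<Rightarrow> nat \<Rightarrow> cf" where
  "dcd K n = (\<lambda>l. if l < K then p1 ((p2 ^^ l) n) else 0)"

lemma ecd_nth: "l < k \<Longrightarrow> p1 ((p2 ^^ l) (ecd k c)) = c l"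
proof (induction k arbitrary: l c)
  case (Suc k)
  then show ?case by (cases l) (simp_all add: funpow_Suc_right del: funpow.simps(2))
qed simp

lemma val_ecd: "val K (ecd K c)"
  unfolding val_def by (induction K arbitrary: c) (simp_all add: funpow_Suc_right del: funpow.simps(2))

lemma code_inj: "(\<And>l. l < k \<Longrightarrow> p1 ((p2 ^^ l) n) = p1 ((p2 ^^ l) n')) \<Longrightarrow> (p2 ^^ k) n = (p2 ^^ k) n' \<Longrightarrow> n = n'"
proof (induction k arbitrary: n n')
  case (Suc k)
  have "p2 n = p2 n'"
  proof (rule Suc.IH)
    show "p1 ((p2 ^^ l) (p2 n)) = p1 ((p2 ^^ l) (p2 n'))" if "l < k" for l
      using Suc.prems(1)[of "Suc l"] that by (simp add: funpow_Suc_right del: funpow.simps(2))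
    show "(p2 ^^ k) (p2 n) = (p2 ^^ k) (p2 n')"
      using Suc.prems(2) by (simp add: funpow_Suc_right del: funpow.simps(2))
  qed
  moreover have "p1 n = p1 n'" using Suc.prems(1)[of 0] by simp
  ultimately show ?case by (metis prod.collapse prod_decode_inverse)
qed simp

lemma supp_dcd: "supp K (dcd K n)" by (simp add: supp_def dcd_def)

lemma dcd_ecd: "supp K c \<Longrightarrow> dcd K (ecd K c) = c"
  by (auto simp: dcd_def supp_def ecd_nth fun_eq_iff)

lemma ecd_dcd: "val K n \<Longrightarrow> ecd K (dcd K n) = n"
  by (rule code_inj[of K]) (use val_ecd[of K "dcd K n"] in \<open>auto simp: ecd_nth val_def dcd_def\<close>)

lemma supp_eq: "supp K a \<Longrightarrow> supp K b \<Longrightarrow> a = b \<longleftrightarrow> (\<forall>l<K. a l = b l)"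
  unfolding supp_def fun_eq_iff by (metis not_le)

lemma basic_dcd: "basic f \<Longrightarrow> basic (\<lambda>a. dcd K (f a) l)"
  unfolding dcd_def by (cases "l < K") (simp_all add: basic_p1 basic_funpow basic_const)

context path_class
begin

lemma C_ball: "(\<And>l. l < (n :: nat) \<Longrightarrow> C (A l)) \<Longrightarrow> C (\<lambda>x a. \<forall>l<n. A l x a)"
proof (induction n)
  case 0
  then show ?case using C_const[of True] by simp
next
  case (Suc n)
  have "C (\<lambda>x a. A n x a \<and> (\<forall>l<n. A l x a))" using Suc by (intro C_conj) auto
  then show ?case by (rule C_cong) (auto simp: less_Suc_eq)
qed

lemma C_bex: "(\<And>l. l < (n :: nat) \<Longrightarrow> C (A l)) \<Longrightarrow> C (\<lambda>x a. \<exists>l<n. A l x a)"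
proof -
  assume "\<And>l. l < n \<Longrightarrow> C (A l)"
  then have "C (\<lambda>x a. \<not> (\<forall>l<n. \<not> A l x a))" by (intro C_not C_ball)
  then show ?thesis by (rule C_cong) blast
qed

lemma C_val: "basic f \<Longrightarrow> C (\<lambda>x a. val K (f a))"
  unfolding val_def by (intro C_eq basic_funpow basic_const)

end

section \<open>Segments, jumps and halting inside a path class\<close>

definition Rl :: "nat \<Rightarrow> (nat set \<Rightarrow> cf \<Rightarrow> cf \<Rightarrow> cf \<Rightarrow> bool) \<Rightarrow> nat set \<Rightarrow> nat \<Rightarrow> bool" where
  "Rl K G x t \<longleftrightarrow> val K (p1 t) \<and> val K (p1 (p2 t)) \<and> val K (p2 (p2 t)) \<and>
     G x (dcd K (p1 t)) (dcd K (p1 (p2 t))) (dcd K (p2 (p2 t)))"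

definition upd :: "nat set \<Rightarrow> instr \<Rightarrow> nat \<Rightarrow> cf \<Rightarrow> cf" where
  "upd x I i k = case_nat (fst (exec x I (i, \<lambda>r. k (Suc r)))) (snd (exec x I (i, \<lambda>r. k (Suc r))))"

lemma stp_upd: "stp P x k = (if k 0 < length P then upd x (P ! k 0) (k 0) k else k)"
  by (simp add: stp_def step_def upd_def)

locale coded = path_class +
  fixes P :: prog and K :: nat
  assumes K: "\<And>x k. supp K k \<Longrightarrow> supp K (stp P x k)"
begin

lemma runs: "runs (stp P x) K" by unfold_locales (rule K)

abbreviation "sgx j x \<equiv> runs.segm (stp P x) K j"
abbreviation "jpx j x \<equiv> runs.jump (stp P x) K j"
abbreviation "stx x \<equiv> runs.single (stp P x) K"
abbreviation "Genx j x \<equiv> runs.Gen (stp P x) K j"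

lemma C_upd:
  assumes f: "basic f" and g: "basic g"
  shows "C (\<lambda>x a. dcd K (g a) l = upd x I i (dcd K (f a)) l)"
proof -
  have d: "basic (\<lambda>a. dcd K (f a) q)" "basic (\<lambda>a. dcd K (g a) q)" for q using basic_dcd f g by blast+
  have e: "C (\<lambda>x a. dcd K (g a) l = dcd K (f a) q)" "C (\<lambda>x a. dcd K (g a) l = n)"
    "C (\<lambda>x a. dcd K (g a) l = Suc (dcd K (f a) q))" for q n
    by (intro C_eq d basic.intros)+
  show ?thesis
  proof (cases I)
    case (Zero r)
    then show ?thesis using e by (cases l; cases "l = Suc r") (simp_all add: upd_def)
  next
    case (Inc r)
    then show ?thesis using e by (cases l; cases "l = Suc r") (simp_all add: upd_def)
  next
    case (Copy r s)
    then show ?thesis using e by (cases l; cases "l = Suc s") (simp_all add: upd_def)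
  next
    case (JumpEq r s t)
    have q: "C (\<lambda>x a. dcd K (f a) (Suc r) = dcd K (f a) (Suc s))" by (intro C_eq d)
    have "C (\<lambda>x a. (dcd K (f a) (Suc r) = dcd K (f a) (Suc s) \<longrightarrow> dcd K (g a) l = (case l of 0 \<Rightarrow> t | Suc m \<Rightarrow> dcd K (f a) l)) \<and>
      (\<not> dcd K (f a) (Suc r) = dcd K (f a) (Suc s) \<longrightarrow> dcd K (g a) l = (case l of 0 \<Rightarrow> Suc i | Suc m \<Rightarrow> dcd K (f a) l)))"
      using e by (intro C_conj C_imp C_not q) (cases l; simp)+
    then show ?thesis by (rule C_cong) (auto simp: upd_def JumpEq split: nat.split)
  next
    case (OracleJump r t)
    have q: "C (\<lambda>x a. dcd K (f a) (Suc r) \<in> x)" by (intro C_mem d)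
    have "C (\<lambda>x a. (dcd K (f a) (Suc r) \<in> x \<longrightarrow> dcd K (g a) l = (case l of 0 \<Rightarrow> t | Suc m \<Rightarrow> dcd K (f a) l)) \<and>
      (\<not> dcd K (f a) (Suc r) \<in> x \<longrightarrow> dcd K (g a) l = (case l of 0 \<Rightarrow> Suc i | Suc m \<Rightarrow> dcd K (f a) l)))"
      using e by (intro C_conj C_imp C_not q) (cases l; simp)+
    then show ?thesis by (rule C_cong) (auto simp: upd_def OracleJump split: nat.split)
  qed
qed

text \<open>The program is fixed, so a machine step is a finite conjunction over its lines, and only
  the oracle test depends on \<open>x\<close>.\<close>

lemma C_stp:
  assumes f: "basic f" and g: "basic g"
  shows "C (\<lambda>x a. dcd K (g a) l = stp P x (dcd K (f a)) l)"
proof -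
  have d: "basic (\<lambda>a. dcd K (f a) q)" "basic (\<lambda>a. dcd K (g a) q)" for q using basic_dcd f g by blast+
  have "C (\<lambda>x a. (\<forall>i<length P. dcd K (f a) 0 = i \<longrightarrow> dcd K (g a) l = upd x (P ! i) i (dcd K (f a)) l) \<and>
    (\<not> dcd K (f a) 0 < length P \<longrightarrow> dcd K (g a) l = dcd K (f a) l))"
    by (intro C_conj C_ball C_imp C_upd f g C_not C_less C_eq d basic_const)
  then show ?thesis by (rule C_cong) (auto simp: stp_upd)
qed

lemma C_single: "C (Rl K stx)"
proof -
  have "C (\<lambda>x t. val K (p1 t) \<and> val K (p1 (p2 t)) \<and> val K (p2 (p2 t)) \<and>
    (\<forall>l<K. dcd K (p1 (p2 t)) l = dcd K (p1 t) l) \<and> (\<forall>l<K. dcd K (p2 (p2 t)) l = stp P x (dcd K (p1 t)) l))"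
    by (intro C_conj C_val C_ball C_eq basic_dcd C_stp basic.intros)
  then show ?thesis
  proof (rule C_cong)
    fix x t
    have "dcd K (p1 (p2 t)) = dcd K (p1 t) \<longleftrightarrow> (\<forall>l<K. dcd K (p1 (p2 t)) l = dcd K (p1 t) l)"
      by (rule supp_eq[OF supp_dcd supp_dcd])
    moreover have "dcd K (p2 (p2 t)) = stp P x (dcd K (p1 t)) \<longleftrightarrow> (\<forall>l<K. dcd K (p2 (p2 t)) l = stp P x (dcd K (p1 t)) l)"
      by (rule supp_eq[OF supp_dcd K[OF supp_dcd]])
    ultimately show "(val K (p1 t) \<and> val K (p1 (p2 t)) \<and> val K (p2 (p2 t)) \<and>
    (\<forall>l<K. dcd K (p1 (p2 t)) l = dcd K (p1 t) l) \<and> (\<forall>l<K. dcd K (p2 (p2 t)) l = stp P x (dcd K (p1 t)) l)) \<longleftrightarrow> Rl K stx x t"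
      unfolding Rl_def runs.single_def[OF runs] using supp_dcd by blast
  qed
qed

definition cmin :: "nat \<Rightarrow> nat \<Rightarrow> nat \<Rightarrow> bool" where
  "cmin m m' n \<longleftrightarrow> val K n \<and> (\<forall>l<K. dcd K n l = min (dcd K m l) (dcd K m' l))"

lemma cmin: "cmin m m' n \<Longrightarrow> dcd K n = (\<lambda>l. min (dcd K m l) (dcd K m' l))"
  by (auto simp: cmin_def dcd_def fun_eq_iff)

lemma C_cmin: assumes "basic f" "basic g" "basic h" shows "C (\<lambda>x a. cmin (f a) (g a) (h a))"
proof -
  have "C (\<lambda>x a. val K (h a) \<and> (\<forall>l<K. (dcd K (f a) l < dcd K (g a) l \<longrightarrow> dcd K (h a) l = dcd K (f a) l) \<and>
    (\<not> dcd K (f a) l < dcd K (g a) l \<longrightarrow> dcd K (h a) l = dcd K (g a) l)))"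
    by (intro C_conj C_ball C_imp C_not C_less C_eq C_val basic_dcd assms)
  moreover have "n = min a b \<longleftrightarrow> (a < b \<longrightarrow> n = a) \<and> (\<not> a < b \<longrightarrow> n = b)" for n a b :: nat
    by (auto simp: min_def)
  ultimately show ?thesis unfolding cmin_def by simp
qed

text \<open>One function codes both witnesses: arguments with tag \<open>0\<close> are triples,
  where a nonzero value means membership in \<open>S\<close>, and arguments with tag
  \<open>1\<close> are pairs, where the value is that of \<open>\<rho>\<close>. The clauses are
  those of \<open>closed\<close>, followed by the requirement that the triple \<open>t\<close> is
  left out.\<close>

definition closure_check :: "(nat \<Rightarrow> bool) \<Rightarrow> nat \<Rightarrow> nat \<Rightarrow> nat \<Rightarrow> nat \<Rightarrow> nat \<Rightarrow> bool" where
  "closure_check G t e1 e2 e3 e4 \<longleftrightarrow>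
    (p1 (p1 e1) = 0 \<and> G (p2 (p1 e1)) \<longrightarrow> p2 e1 \<noteq> 0) \<and>
    (p1 (p1 e1) = 0 \<and> p1 (p1 e2) = 0 \<and> p1 (p1 e3) = 0 \<and> p1 (p2 (p1 e2)) = p2 (p2 (p2 (p1 e1))) \<and>
       p1 (p2 (p1 e3)) = p1 (p2 (p1 e1)) \<and> p2 (p2 (p2 (p1 e3))) = p2 (p2 (p2 (p1 e2))) \<and>
       cmin (p1 (p2 (p2 (p1 e1)))) (p1 (p2 (p2 (p1 e2)))) (p1 (p2 (p2 (p1 e3)))) \<and> p2 e1 \<noteq> 0 \<and> p2 e2 \<noteq> 0
       \<longrightarrow> p2 e3 \<noteq> 0) \<and>
    (p1 (p1 e1) = 0 \<and> p1 e2 = pr 0 (pr (p1 (p2 (p1 e1))) (pr (p1 (p2 (p2 (p1 e1)))) (p1 (p2 (p2 (p1 e1)))))) \<and>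
       p1 e3 = pr 1 (pr (p2 (p2 (p2 (p1 e1)))) (p1 (p2 (p2 (p1 e1))))) \<and>
       p1 e4 = pr 1 (pr (p1 (p2 (p1 e1))) (p1 (p2 (p2 (p1 e1))))) \<and> p2 e1 \<noteq> 0
       \<longrightarrow> p2 e2 \<noteq> 0 \<or> p2 e3 < p2 e4) \<and>
    (p1 e1 = pr 0 t \<longrightarrow> p2 e1 = 0)"

text \<open>Codes reach only configurations supported below \<open>K\<close>. As \<open>G\<close>
  relates only such configurations and minima keep the support, \<open>S\<close> may be cut down to
  them and stays closed. The variable \<open>k5\<close> brings the quantifiers into the form of
  \<open>C_so\<close>.\<close>

lemma closure_check_iff:
  assumes G: "\<And>c m d. G c m d \<Longrightarrow> supp K c \<and> supp K m \<and> supp K d"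
    and t: "val K (p1 t)" "val K (p1 (p2 t))" "val K (p2 (p2 t))"
  shows "(\<exists>g. \<forall>k1 k2 k3 k4 (k5 :: nat). closure_check (Rl K (\<lambda>x. G) x) t (pr k1 (g k1)) (pr k2 (g k2)) (pr k3 (g k3)) (pr k4 (g k4))) \<longleftrightarrow>
    (\<exists>S \<rho>. runs.closed G S \<rho> \<and> \<not> S (dcd K (p1 t)) (dcd K (p1 (p2 t))) (dcd K (p2 (p2 t))))"
proof
  assume "\<exists>g. \<forall>k1 k2 k3 k4 (k5 :: nat). closure_check (Rl K (\<lambda>x. G) x) t (pr k1 (g k1)) (pr k2 (g k2)) (pr k3 (g k3)) (pr k4 (g k4))"
  then obtain g where "\<And>k1 k2 k3 k4. closure_check (Rl K (\<lambda>x. G) x) t (pr k1 (g k1)) (pr k2 (g k2)) (pr k3 (g k3)) (pr k4 (g k4))"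
    by blast
  note g = this[unfolded closure_check_def prod_encode_inverse fst_conv snd_conv]
  define S where "S c m d \<longleftrightarrow> supp K c \<and> supp K m \<and> supp K d \<and> g (pr 0 (pr (ecd K c) (pr (ecd K m) (ecd K d)))) \<noteq> 0" for c m d
  define \<rho> where "\<rho> e v = g (pr 1 (pr (ecd K e) (ecd K v)))" for e v
  have "S c m d" if "G c m d" for c m d
  proof -
    have "Rl K (\<lambda>x. G) x (pr (ecd K c) (pr (ecd K m) (ecd K d)))"
      using that G[OF that] by (simp add: Rl_def val_ecd dcd_ecd)
    then show ?thesis using g[of "pr 0 (pr (ecd K c) (pr (ecd K m) (ecd K d)))"] G[OF that] by (simp add: S_def)
  qed
  moreover have "S c (\<lambda>l. min (m l) (m' l)) e" if a: "S c m d" "S d m' e" for c m d m' e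
  proof -
    let ?m = "\<lambda>l. min (m l) (m' l)"
    have s: "supp K c" "supp K m" "supp K d" "supp K m'" "supp K e" using a by (auto simp: S_def)
    then have sm: "supp K ?m" by (simp add: supp_def)
    have "cmin (ecd K m) (ecd K m') (ecd K ?m)" by (simp add: cmin_def val_ecd dcd_ecd s sm)
    then show ?thesis
      using g[of "pr 0 (pr (ecd K c) (pr (ecd K m) (ecd K d)))" "pr 0 (pr (ecd K d) (pr (ecd K m') (ecd K e)))"
        "pr 0 (pr (ecd K c) (pr (ecd K ?m) (ecd K e)))"] a s sm by (simp add: S_def)
  qed
  moreover have "S c v v \<or> \<rho> e v < \<rho> c v" if a: "S c v e" for c v e
    using g[of "pr 0 (pr (ecd K c) (pr (ecd K v) (ecd K e)))" "pr 0 (pr (ecd K c) (pr (ecd K v) (ecd K v)))"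
      "pr 1 (pr (ecd K e) (ecd K v))" "pr 1 (pr (ecd K c) (ecd K v))"] a by (simp add: S_def \<rho>_def)
  ultimately have "runs.closed G S \<rho>" unfolding runs.closed_def[OF runs] by blast
  moreover have "\<not> S (dcd K (p1 t)) (dcd K (p1 (p2 t))) (dcd K (p2 (p2 t)))"
    using g[of "pr 0 t"] t by (simp add: S_def ecd_dcd)
  ultimately show "\<exists>S \<rho>. runs.closed G S \<rho> \<and> \<not> S (dcd K (p1 t)) (dcd K (p1 (p2 t))) (dcd K (p2 (p2 t)))" by blast
next
  assume "\<exists>S \<rho>. runs.closed G S \<rho> \<and> \<not> S (dcd K (p1 t)) (dcd K (p1 (p2 t))) (dcd K (p2 (p2 t)))"
  then obtain S \<rho> where "runs.closed G S \<rho>" and nS: "\<not> S (dcd K (p1 t)) (dcd K (p1 (p2 t))) (dcd K (p2 (p2 t)))" by blast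
  then have S: "\<And>c m d. G c m d \<Longrightarrow> S c m d" "\<And>c m d m' e. S c m d \<Longrightarrow> S d m' e \<Longrightarrow> S c (\<lambda>l. min (m l) (m' l)) e"
    "\<And>c v e. S c v e \<Longrightarrow> S c v v \<or> \<rho> e v < \<rho> c v" unfolding runs.closed_def[OF runs] by blast+
  define g where "g k = (if p1 k = 0 then of_bool (S (dcd K (p1 (p2 k))) (dcd K (p1 (p2 (p2 k)))) (dcd K (p2 (p2 (p2 k)))))
    else \<rho> (dcd K (p1 (p2 k))) (dcd K (p2 (p2 k))))" for k
  have g0: "g k \<noteq> 0 \<longleftrightarrow> S (dcd K (p1 (p2 k))) (dcd K (p1 (p2 (p2 k)))) (dcd K (p2 (p2 (p2 k))))" if "p1 k = 0" for k
    using that by (simp add: g_def)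
  have g1: "g (pr 1 q) = \<rho> (dcd K (p1 q)) (dcd K (p2 q))" for q by (simp add: g_def)
  have "closure_check (Rl K (\<lambda>x. G) x) t (pr k1 (g k1)) (pr k2 (g k2)) (pr k3 (g k3)) (pr k4 (g k4))" for k1 k2 k3 k4
    unfolding closure_check_def prod_encode_inverse fst_conv snd_conv
  proof (intro conjI impI)
    assume "p1 k1 = 0 \<and> Rl K (\<lambda>x. G) x (p2 k1)"
    then show "g k1 \<noteq> 0" using g0[of k1] S(1) by (simp add: Rl_def)
  next
    assume a: "p1 k1 = 0 \<and> p1 k2 = 0 \<and> p1 k3 = 0 \<and> p1 (p2 k2) = p2 (p2 (p2 k1)) \<and>
       p1 (p2 k3) = p1 (p2 k1) \<and> p2 (p2 (p2 k3)) = p2 (p2 (p2 k2)) \<and>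
       cmin (p1 (p2 (p2 k1))) (p1 (p2 (p2 k2))) (p1 (p2 (p2 k3))) \<and> g k1 \<noteq> 0 \<and> g k2 \<noteq> 0"
    have "S (dcd K (p1 (p2 k1))) (dcd K (p1 (p2 (p2 k1)))) (dcd K (p2 (p2 (p2 k1))))" using a g0[of k1] by simp
    moreover have "S (dcd K (p2 (p2 (p2 k1)))) (dcd K (p1 (p2 (p2 k2)))) (dcd K (p2 (p2 (p2 k2))))" using a g0[of k2] by simp
    ultimately have "S (dcd K (p1 (p2 k1))) (dcd K (p1 (p2 (p2 k3)))) (dcd K (p2 (p2 (p2 k2))))"
      using S(2) cmin[of "p1 (p2 (p2 k1))" "p1 (p2 (p2 k2))" "p1 (p2 (p2 k3))"] a by simp
    then show "g k3 \<noteq> 0" using a g0[of k3] by simp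
  next
    assume a: "p1 k1 = 0 \<and> k2 = pr 0 (pr (p1 (p2 k1)) (pr (p1 (p2 (p2 k1))) (p1 (p2 (p2 k1))))) \<and>
       k3 = pr 1 (pr (p2 (p2 (p2 k1))) (p1 (p2 (p2 k1)))) \<and>
       k4 = pr 1 (pr (p1 (p2 k1)) (p1 (p2 (p2 k1)))) \<and> g k1 \<noteq> 0"
    then have "S (dcd K (p1 (p2 k1))) (dcd K (p1 (p2 (p2 k1)))) (dcd K (p2 (p2 (p2 k1))))" using g0[of k1] by simp
    from S(3)[OF this] show "g k2 \<noteq> 0 \<or> g k3 < g k4" using a g0[of k2] g1 by auto
  next
    assume "k1 = pr 0 t"
    then show "g k1 = 0" using g0[of k1] nS by auto
  qed
  then show "\<exists>g. \<forall>k1 k2 k3 k4 (k5 :: nat). closure_check (Rl K (\<lambda>x. G) x) t (pr k1 (g k1)) (pr k2 (g k2)) (pr k3 (g k3)) (pr k4 (g k4))" by blast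
qed

lemma C_segm:
  assumes G: "C (Rl K (Genx j))"
  shows "C (Rl K (sgx j))"
proof -
  have G': "C (\<lambda>x a. Rl K (Genx j) x (f a))" if "basic f" for f using C_sub[OF G that] .
  have "C (\<lambda>x p. closure_check (Rl K (Genx j) x) (p1 p) (p1 (p2 p)) (p1 (p2 (p2 p))) (p1 (p2 (p2 (p2 p))))
    (p1 (p2 (p2 (p2 (p2 p))))))"
    unfolding closure_check_def by (intro C_conj C_imp C_not C_disj C_less C_eq G' C_cmin basic.intros)
  from C_so[where B = "\<lambda>x a e1 e2 e3 e4 e5. closure_check (Rl K (Genx j) x) a e1 e2 e3 e4", OF this]
  have "C (\<lambda>x a. val K (p1 a) \<and> val K (p1 (p2 a)) \<and> val K (p2 (p2 a)) \<and>
    \<not> (\<exists>g. \<forall>k1 k2 k3 k4 (k5 :: nat). closure_check (Rl K (Genx j) x) a (pr k1 (g k1)) (pr k2 (g k2)) (pr k3 (g k3)) (pr k4 (g k4))))"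
    by (intro C_conj C_val C_not basic.intros)
  then show ?thesis
  proof (rule C_cong)
    fix x a
    show "(val K (p1 a) \<and> val K (p1 (p2 a)) \<and> val K (p2 (p2 a)) \<and>
      \<not> (\<exists>g. \<forall>k1 k2 k3 k4 (k5 :: nat). closure_check (Rl K (Genx j) x) a (pr k1 (g k1)) (pr k2 (g k2)) (pr k3 (g k3)) (pr k4 (g k4)))) \<longleftrightarrow>
      Rl K (sgx j) x a"
    proof (cases "val K (p1 a) \<and> val K (p1 (p2 a)) \<and> val K (p2 (p2 a))")
      case True
      have "Rl K (Genx j) x = Rl K (\<lambda>y. Genx j x) x" by (simp add: Rl_def fun_eq_iff)
      then show ?thesis
        using closure_check_iff[of "Genx j x" a x] True runs.Gen_supp[OF runs] runs.segm_iff[OF runs, of x j] supp_dcd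
        by (auto simp: Rl_def)
    qed (auto simp: Rl_def)
  qed
qed

definition LOW :: "nat \<Rightarrow> nat \<Rightarrow> nat set \<Rightarrow> nat \<Rightarrow> nat \<Rightarrow> bool" where
  "LOW j l x c n \<longleftrightarrow> (\<exists>q. Rl K (sgx j) x (pr c q) \<and> \<not> n < dcd K (p1 q) l)"

definition LM :: "nat \<Rightarrow> nat \<Rightarrow> nat set \<Rightarrow> nat \<Rightarrow> nat \<Rightarrow> bool" where
  "LM j l x c n \<longleftrightarrow> (\<exists>d. (d = c \<or> (\<exists>m. Rl K (sgx j) x (pr c (pr m d)))) \<and> \<not> (\<exists>n'. n' < n \<and> LOW j l x d n'))"

lemma LOW: "val K c \<Longrightarrow> LOW j l x c n \<longleftrightarrow> runs.visits_le (stp P x) K j (dcd K c) l n"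
proof
  assume c: "val K c"
  {
    assume "LOW j l x c n"
    then show "runs.visits_le (stp P x) K j (dcd K c) l n"
      unfolding LOW_def Rl_def runs.visits_le_def[OF runs] by auto
  next
    assume "runs.visits_le (stp P x) K j (dcd K c) l n"
    then obtain m d where md: "sgx j x (dcd K c) m d" "m l \<le> n" unfolding runs.visits_le_def[OF runs] by blast
    then have "supp K m" "supp K d" using runs.segm_supp[OF runs] by blast+
    then show "LOW j l x c n" unfolding LOW_def Rl_def using md c
      by (intro exI[of _ "pr (ecd K m) (ecd K d)"]) (simp add: val_ecd dcd_ecd)
  }
qed

lemma LM: "val K c \<Longrightarrow> LM j l x c n \<longleftrightarrow> runs.liminf_ge (stp P x) K j (dcd K c) l n"
proof
  assume c: "val K c"
  {
    assume "LM j l x c n"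
    then obtain d where d: "d = c \<or> (\<exists>m. Rl K (sgx j) x (pr c (pr m d)))" "\<not> (\<exists>n'. n' < n \<and> LOW j l x d n')"
      unfolding LM_def by blast
    have v: "val K d" using d(1) c by (auto simp: Rl_def)
    have "dcd K d = dcd K c \<or> (\<exists>m. sgx j x (dcd K c) m (dcd K d))" using d(1) by (auto simp: Rl_def)
    then show "runs.liminf_ge (stp P x) K j (dcd K c) l n"
      unfolding runs.liminf_ge_def[OF runs] using d(2) LOW[OF v] by blast
  next
    assume "runs.liminf_ge (stp P x) K j (dcd K c) l n"
    then obtain d where d: "d = dcd K c \<or> (\<exists>m. sgx j x (dcd K c) m d)" "\<not> (\<exists>n'<n. runs.visits_le (stp P x) K j d l n')"
      unfolding runs.liminf_ge_def[OF runs] by blast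
    have s: "supp K d" using d(1) runs.segm_supp[OF runs] supp_dcd by blast
    have n: "\<not> (\<exists>n'. n' < n \<and> LOW j l x (ecd K d) n')" using d(2) LOW[OF val_ecd] dcd_ecd[OF s] by simp
    from d(1) have "ecd K d = c \<or> (\<exists>m. Rl K (sgx j) x (pr c (pr m (ecd K d))))"
    proof
      assume "d = dcd K c"
      then show ?thesis using ecd_dcd[OF c] by simp
    next
      assume "\<exists>m. sgx j x (dcd K c) m d"
      then obtain m where m: "sgx j x (dcd K c) m d" by blast
      then have "supp K m" using runs.segm_supp[OF runs] by blast
      then have "Rl K (sgx j) x (pr c (pr (ecd K m) (ecd K d)))"
        using m c s by (simp add: Rl_def val_ecd dcd_ecd)
      then show ?thesis by blast
    qed
    then show "LM j l x c n" unfolding LM_def using n by blast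
  }
qed

lemma C_jump:
  assumes S: "C (Rl K (sgx j))"
  shows "C (Rl K (jpx j))"
proof -
  have S': "C (\<lambda>x a. Rl K (sgx j) x (f a))" if "basic f" for f using C_sub[OF S that] .
  have LOWC: "C (\<lambda>x a. LOW j l x (f a) (h a))" if "basic f" "basic h" for f h l
    unfolding LOW_def by (intro C_ex C_conj C_not C_less S' basic_dcd basic.intros basic_comp[OF that(1)] basic_comp[OF that(2)])
  have LMC: "C (\<lambda>x a. LM j l x (f a) (h a))" if "basic f" "basic h" for f h l
    unfolding LM_def
    by (intro C_ex C_conj C_disj C_eq C_not C_less S' LOWC basic.intros basic_comp[OF that(1)] basic_comp[OF that(2)])
  have "C (\<lambda>x t. val K (p1 t) \<and> val K (p1 (p2 t)) \<and> val K (p2 (p2 t)) \<and> (\<exists>l<K. \<forall>n. LM j l x (p1 t) n) \<and>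
     (\<forall>l<K. ((\<forall>n. LM j l x (p1 t) n) \<and> dcd K (p2 (p2 t)) l = 0) \<or>
       (LM j l x (p1 t) (dcd K (p2 (p2 t)) l) \<and> \<not> LM j l x (p1 t) (Suc (dcd K (p2 (p2 t)) l)))) \<and>
     (\<forall>l<K. LOW j l x (p1 t) (dcd K (p1 (p2 t)) l) \<and> (\<forall>n. n < dcd K (p1 (p2 t)) l \<longrightarrow> \<not> LOW j l x (p1 t) n)))"
    by (intro C_conj C_val C_bex C_ball C_disj C_all C_imp C_not C_eq C_less LMC LOWC basic_dcd basic.intros)
  then show ?thesis
  proof (rule C_cong)
    fix x t
    show "(val K (p1 t) \<and> val K (p1 (p2 t)) \<and> val K (p2 (p2 t)) \<and> (\<exists>l<K. \<forall>n. LM j l x (p1 t) n) \<and>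
     (\<forall>l<K. ((\<forall>n. LM j l x (p1 t) n) \<and> dcd K (p2 (p2 t)) l = 0) \<or>
       (LM j l x (p1 t) (dcd K (p2 (p2 t)) l) \<and> \<not> LM j l x (p1 t) (Suc (dcd K (p2 (p2 t)) l)))) \<and>
     (\<forall>l<K. LOW j l x (p1 t) (dcd K (p1 (p2 t)) l) \<and> (\<forall>n. n < dcd K (p1 (p2 t)) l \<longrightarrow> \<not> LOW j l x (p1 t) n)))
     \<longleftrightarrow> Rl K (jpx j) x t"
    proof (cases "val K (p1 t)")
      case True
      show ?thesis
        unfolding Rl_def runs.jump_iff[OF runs] runs.jpd_def[OF runs] LM[OF True] LOW[OF True] using supp_dcd by blast
    qed (simp add: Rl_def)
  qed
qed

text \<open>Each level costs one function quantifier for the closure of its generators and number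
  quantifiers for the jumps. The number of levels is finite, so the relation stays in the
  class.\<close>

lemma C_level: "C (Rl K (sgx j))"
proof (induction j)
  case 0
  have "Rl K (Genx 0) = Rl K stx" by (simp add: Rl_def fun_eq_iff runs.Gen.simps(1)[OF runs])
  then show ?case using C_segm[of 0] C_single by simp
next
  case (Suc j)
  have "C (\<lambda>x t. Rl K (sgx j) x t \<or> Rl K (jpx j) x t)" by (intro C_disj Suc C_jump)
  moreover have "(\<lambda>x t. Rl K (sgx j) x t \<or> Rl K (jpx j) x t) = Rl K (Genx (Suc j))"
    by (auto simp: Rl_def fun_eq_iff runs.Gen.simps(2)[OF runs])
  ultimately show ?case using C_segm[of "Suc j"] by simp
qed

text \<open>\<open>B_K\<close> makes level \<open>K\<close> unrestricted: every time after the start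
  ends a segment of that level. One number quantifier over final configurations then expresses
  halting.\<close>

lemma C_halts: "C (\<lambda>x a. halts_with P x 1)"
proof -
  let ?z = "ecd K (\<lambda>_. 0)"
  have S': "C (\<lambda>x a. Rl K (sgx K) x (f a))" if "basic f" for f using C_sub[OF C_level that] .
  have z: "supp K (\<lambda>_. 0)" by (simp add: supp_def)
  have "C (\<lambda>x a. \<exists>m d. Rl K (sgx K) x (pr ?z (pr m d)) \<and> \<not> dcd K d 0 < length P \<and> dcd K d 1 = 1)"
    by (intro C_ex C_conj C_not C_less C_eq S' basic_dcd basic.intros)
  then show ?thesis
  proof (rule C_cong)
    fix x and a :: nat
    have "(\<exists>m d. Rl K (sgx K) x (pr ?z (pr m d)) \<and> \<not> dcd K d 0 < length P \<and> dcd K d 1 = 1) \<longleftrightarrow>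
      (\<exists>m d. sgx K x (\<lambda>_. 0) m d \<and> length P \<le> d 0 \<and> d 1 = 1)"
    proof
      assume "\<exists>m d. Rl K (sgx K) x (pr ?z (pr m d)) \<and> \<not> dcd K d 0 < length P \<and> dcd K d 1 = 1"
      then show "\<exists>m d. sgx K x (\<lambda>_. 0) m d \<and> length P \<le> d 0 \<and> d 1 = 1"
        using dcd_ecd[OF z] by (auto simp: Rl_def not_less)
    next
      assume "\<exists>m d. sgx K x (\<lambda>_. 0) m d \<and> length P \<le> d 0 \<and> d 1 = 1"
      then obtain m d where md: "sgx K x (\<lambda>_. 0) m d" "length P \<le> d 0" "d 1 = 1" by blast
      then have "supp K m" "supp K d" using runs.segm_supp[OF runs] by blast+
      then show "\<exists>m d. Rl K (sgx K) x (pr ?z (pr m d)) \<and> \<not> dcd K d 0 < length P \<and> dcd K d 1 = 1"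
        using md z by (intro exI[of _ "ecd K m"] exI[of _ "ecd K d"]) (simp add: Rl_def val_ecd dcd_ecd)
    qed
    also have "\<dots> \<longleftrightarrow> (\<exists>t>z0. length P \<le> run (stp P x) (\<lambda>_. 0) t 0 \<and> run (stp P x) (\<lambda>_. 0) t 1 = 1)"
    proof
      assume "\<exists>t>z0. length P \<le> run (stp P x) (\<lambda>_. 0) t 0 \<and> run (stp P x) (\<lambda>_. 0) t 1 = 1"
      then obtain t where t: "t > z0" "length P \<le> run (stp P x) (\<lambda>_. 0) t 0" "run (stp P x) (\<lambda>_. 0) t 1 = 1" by blast
      obtain m where "mn (run (stp P x) (\<lambda>_. 0)) z0 t m" using mn_ex[OF t(1)] by blast
      then have "sgx K x (\<lambda>_. 0) m (run (stp P x) (\<lambda>_. 0) t)"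
        unfolding runs.segm_def[OF runs] using t(1) z runs.B_K[OF runs z] by blast
      then show "\<exists>m d. sgx K x (\<lambda>_. 0) m d \<and> length P \<le> d 0 \<and> d 1 = 1" using t by blast
    qed (auto simp: runs.segm_def[OF runs])
    also have "\<dots> \<longleftrightarrow> halts_with P x 1"
    proof
      assume "halts_with P x 1"
      then obtain t where t: "length P \<le> run (stp P x) (\<lambda>_. 0) t 0" "run (stp P x) (\<lambda>_. 0) t (Suc 0) = 1"
        unfolding halts_with_iff by blast
      \<comment> \<open>Segments end strictly after \<open>z0\<close>. The successor time is
        certainly positive and still shows the halted configuration.\<close>
      have "run (stp P x) (\<lambda>_. 0) (sc t) = run (stp P x) (\<lambda>_. 0) t" using run_halted[OF t(1)] sc_gt less_imp_le by blast
      moreover have "z0 < sc t" using z0_le by (simp add: less_sc)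
      ultimately show "\<exists>t>z0. length P \<le> run (stp P x) (\<lambda>_. 0) t 0 \<and> run (stp P x) (\<lambda>_. 0) t 1 = 1"
        using t by (intro exI[of _ "sc t"]) (simp del: run_sc)
    qed (auto simp: halts_with_iff)
    finally show "(\<exists>m d. Rl K (sgx K) x (pr ?z (pr m d)) \<and> \<not> dcd K d 0 < length P \<and> dcd K d 1 = 1) \<longleftrightarrow> halts_with P x 1" .
  qed
qed

end

theorem mainTheorem11:
  fixes X :: "nat set set"
  assumes "X \<noteq> {}" and "ITRM_decidable X"
  shows "\<exists>x\<in>X. ITRM_recognizable x"
proof -
  obtain P where P: "\<And>w. w \<in> X \<Longrightarrow> halts_with P w 1" "\<And>w. w \<notin> X \<Longrightarrow> halts_with P w 0"
    using assms(2) unfolding ITRM_decidable_def by blast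
  have X: "halts_with P w 1 \<longleftrightarrow> w \<in> X" for w
    using P halts_with_unique[of P w 1 0] by auto
  obtain K where "\<And>x k. supp K k \<Longrightarrow> supp K (stp P x k)" using stp_supp by blast
  \<comment> \<open>Definability is needed for the class \<open>certified\<close>: a certificate of
    the halting relation turns \<open>X\<close> into a co-analytic set of certificates.\<close>
  then interpret coded certified P K by unfold_locales
  obtain w where "w \<in> X" using assms(1) by blast
  then show ?thesis using certified_recognizable[OF C_halts, of w] X by blast
qed

end
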